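(* Let $m\ge0$ and let $\mathscr{L}_m:H^1(\mathbb{R},\mathbb{C}^2)\to L^2(\mathbb{R},\mathbb{C}^2)$ be the operator $$(\mathscr{L}_m f)(x)=\begin{pmatrix} m & -\partial_x\\ \partial_x & -m\end{pmatrix}f(x)+i\,\mathrm{sgn}(x)f(x).$$ 1) If $m=0$, then the pseudospectrum of $\mathscr{L}_0$ is trivial and, for all $\varepsilon>0$, $$\mathrm{Spec}_\varepsilon(\mathscr{L}_0)=\{z\in\mathbb{C}:|\mathrm{Im}\,z|\le 1+\varepsilon\}.$$ 2) If $m>0$, then the pseudospectrum of $\mathscr{L}_m$ is non-trivial. Namely, for every fixed $\alpha\in(0,1)$ there exists $M>0$ such that, for all $\varepsilon>0$, $$\Lambda_-^\alpha(\varepsilon)\cap\{|\mathrm{Re}\,z|>M\}\subset\mathrm{Spec}_\varepsilon(\mathscr{L}_m)\cap\{|\mathrm{Re}\,z|>M\}$$ and $$\mathrm{Spec}_\varepsilon(\mathscr{L}_m)\cap\{|\mathrm{Re}\,z|>M\}\subset\Lambda_+^\alpha(\varepsilon)\cap\{|\mathrm{Re}\,z|>M\},$$ where $$\Lambda_\pm^\alpha(\varepsilon)=\left\{z\in\mathbb{C}:|\mathrm{Im}\,z|\le 1+\varepsilon\ \text{ and }\ |\mathrm{Re}\,z|^2\ge\frac{m(1-|\mathrm{Im}\,z|^2)}{(1\pm\alpha)\varepsilon}\right\}.$$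
   Context: For a closed operator $\mathscr{L}$ with resolvent set $\rho(\mathscr{L})$ and $\varepsilon>0$, the $\varepsilon$-pseudospectrum is $\mathrm{Spec}_\varepsilon(\mathscr{L})=\mathrm{Spec}(\mathscr{L})\cup\{z\in\rho(\mathscr{L}):\|(\mathscr{L}-z)^{-1}\|>\varepsilon^{-1}\}$. The pseudospectrum of $\mathscr{L}$ is called trivial if there is a constant $C\ge1$ such that $\mathrm{Spec}_\varepsilon(\mathscr{L})\subseteq\{z\in\mathbb{C}:\mathrm{dist}(z,\mathrm{Spec}(\mathscr{L}))\le C\varepsilon\}$ for all $\varepsilon>0$, and non-trivial otherwise.
   Formalization: With the strict ">" in Spec_ε the lines |Im z| = 1+ε are not in it, so part 1 is proved with |Im z| < 1+ε and the Λ₋ inclusion without those lines; the printed formulas are also proved verbatim for Spec_ε defined with "≥". *)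

theory Defs
  imports "HOL-Analysis.Analysis"
begin

section \<open>The Hilbert space of square-integrable spinors on the real line\<close>

definition square_integrable :: "(real \<Rightarrow> complex ^ 2) \<Rightarrow> bool" where
  "square_integrable f \<longleftrightarrow>
     f \<in> borel_measurable lborel \<and> integrable lborel (\<lambda>x. (norm (f x))\<^sup>2)"

lemma square_integrable_zero: "square_integrable (\<lambda>x. 0)"
  by (simp add: square_integrable_def)

lemma square_integrable_bound:
  assumes "square_integrable f" "square_integrable g" "h \<in> borel_measurable lborel"
    and "\<And>x. norm (h x) \<le> c * norm (f x) + d * norm (g x)"
  shows "square_integrable h"
proof -
  have "integrable lborel (\<lambda>x. (norm (h x))\<^sup>2)"
  proof (rule Bochner_Integration.integrable_bound)
    show "integrable lborel (\<lambda>x. 2 * c\<^sup>2 * (norm (f x))\<^sup>2 + 2 * d\<^sup>2 * (norm (g x))\<^sup>2)"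
      using assms by (auto simp: square_integrable_def)
    show "(\<lambda>x. (norm (h x))\<^sup>2) \<in> borel_measurable lborel"
      using assms by measurable
    have "(norm (h x))\<^sup>2 \<le> 2 * c\<^sup>2 * (norm (f x))\<^sup>2 + 2 * d\<^sup>2 * (norm (g x))\<^sup>2" for x
    proof -
      have "(norm (h x))\<^sup>2 \<le> (c * norm (f x) + d * norm (g x))\<^sup>2"
        by (intro power_mono assms) simp
      also have "\<dots> \<le> 2 * (c * norm (f x))\<^sup>2 + 2 * (d * norm (g x))\<^sup>2"
        using sum_squares_bound[of "c * norm (f x)" "d * norm (g x)"]
        by (simp add: power2_sum)
      finally show ?thesis by (simp add: power_mult_distrib)
    qed
    then show "AE x in lborel. norm ((norm (h x))\<^sup>2)
        \<le> norm (2 * c\<^sup>2 * (norm (f x))\<^sup>2 + 2 * d\<^sup>2 * (norm (g x))\<^sup>2)"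
      by (intro AE_I2) (auto intro: order_trans[OF _ abs_ge_self])
  qed
  with assms show ?thesis by (simp add: square_integrable_def)
qed

lemma square_integrable_add:
  assumes "square_integrable f" "square_integrable g"
  shows "square_integrable (\<lambda>x. f x + g x)"
  by (rule square_integrable_bound[OF assms, of _ 1 1])
    (use assms in \<open>auto simp: square_integrable_def intro: norm_triangle_ineq\<close>)

lemma square_integrable_diff:
  assumes "square_integrable f" "square_integrable g"
  shows "square_integrable (\<lambda>x. f x - g x)"
  by (rule square_integrable_bound[OF assms, of _ 1 1])
    (use assms in \<open>auto simp: square_integrable_def intro: norm_triangle_ineq4\<close>)

lemma square_integrable_scaleR:
  assumes "square_integrable f"
  shows "square_integrable (\<lambda>x. r *\<^sub>R f x)"
  by (rule square_integrable_bound[OF assms assms, of _ "\<bar>r\<bar>" 0])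
    (use assms in \<open>auto simp: square_integrable_def\<close>)

lemma norm_vector_scalar_mult: "norm (z *s v) = cmod z * norm (v :: complex ^ 2)"
  by (simp add: norm_vec_def vector_scalar_mult_def norm_mult L2_set_right_distrib)

lemma continuous_vector_scalar_mult:
  "continuous_on UNIV (\<lambda>p :: complex \<times> (complex ^ 2). fst p *s snd p)"
  unfolding vector_scalar_mult_def by (intro continuous_intros)

lemma borel_measurable_vector_scalar_mult:
  fixes c :: "'a \<Rightarrow> complex" and f :: "'a \<Rightarrow> complex ^ 2"
  assumes "c \<in> borel_measurable M" "f \<in> borel_measurable M"
  shows "(\<lambda>x. c x *s f x) \<in> borel_measurable M"
  using borel_measurable_continuous_Pair[OF assms, of "\<lambda>a b. a *s b"]
    continuous_vector_scalar_mult by simp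

lemma square_integrable_scaleC:
  assumes "square_integrable f"
  shows "square_integrable (\<lambda>x. z *s f x)"
  by (rule square_integrable_bound[OF assms assms, of _ "cmod z" 0])
    (use assms in \<open>auto simp: square_integrable_def norm_vector_scalar_mult
       intro: borel_measurable_vector_scalar_mult\<close>)

lemma integrable_inner_square_integrable:
  assumes "square_integrable f" "square_integrable g"
  shows "integrable lborel (\<lambda>x. f x \<bullet> g x)"
proof (rule Bochner_Integration.integrable_bound)
  show "integrable lborel (\<lambda>x. (norm (f x))\<^sup>2 + (norm (g x))\<^sup>2)"
    using assms by (auto simp: square_integrable_def)
  show "(\<lambda>x. f x \<bullet> g x) \<in> borel_measurable lborel"
    using assms by (auto simp: square_integrable_def intro: borel_measurable_inner)
  have "\<bar>f x \<bullet> g x\<bar> \<le> (norm (f x))\<^sup>2 + (norm (g x))\<^sup>2" for x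
  proof -
    have "\<bar>f x \<bullet> g x\<bar> \<le> norm (f x) * norm (g x)"
      by (rule Cauchy_Schwarz_ineq2)
    moreover have "0 \<le> norm (f x) * norm (g x)"
      by simp
    ultimately show ?thesis
      using sum_squares_bound[of "norm (f x)" "norm (g x)"] by linarith
  qed
  then show "AE x in lborel. norm (f x \<bullet> g x) \<le> norm ((norm (f x))\<^sup>2 + (norm (g x))\<^sup>2)"
    by (intro AE_I2) simp
qed

quotient_type spinor = "real \<Rightarrow> complex ^ 2" / partial:
  "\<lambda>f g. square_integrable f \<and> square_integrable g \<and> (AE x in lborel. f x = g x)"
proof (rule part_equivpI)
  show "\<exists>f. square_integrable f \<and> square_integrable f \<and> (AE x in lborel. f x = f x)"
    using square_integrable_zero by auto
  show "symp (\<lambda>f g. square_integrable f \<and> square_integrable g \<and> (AE x in lborel. f x = g x))"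
    by (auto simp: symp_def elim: eventually_mono)
  show "transp (\<lambda>f g. square_integrable f \<and> square_integrable g \<and> (AE x in lborel. f x = g x))"
    unfolding transp_def by (auto elim: eventually_elim2)
qed

text \<open>The inner product on \<^typ>\<open>complex ^ 2\<close> is the real part of the Hermitian one, with the same
  norm; so \<^const>\<open>norm\<close> on \<^typ>\<open>spinor\<close> is the \<open>L\<^sup>2\<close> norm.\<close>

instantiation spinor :: real_inner
begin

lift_definition zero_spinor :: spinor is "\<lambda>x. 0"
  by (simp add: square_integrable_zero)

lift_definition plus_spinor :: "spinor \<Rightarrow> spinor \<Rightarrow> spinor" is "\<lambda>f g x. f x + g x"
  by (auto intro: square_integrable_add elim: eventually_elim2)

lift_definition minus_spinor :: "spinor \<Rightarrow> spinor \<Rightarrow> spinor" is "\<lambda>f g x. f x - g x"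
  by (auto intro: square_integrable_diff elim: eventually_elim2)

lift_definition scaleR_spinor :: "real \<Rightarrow> spinor \<Rightarrow> spinor" is "\<lambda>r f x. r *\<^sub>R f x"
  by (auto intro: square_integrable_scaleR elim: eventually_mono)

lift_definition inner_spinor :: "spinor \<Rightarrow> spinor \<Rightarrow> real"
  is "\<lambda>f g. LINT x|lborel. f x \<bullet> g x"
  by (rule integral_cong_AE) (auto simp: square_integrable_def)

definition uminus_spinor :: "spinor \<Rightarrow> spinor" where
  "uminus_spinor f = (- 1) *\<^sub>R f"

definition norm_spinor :: "spinor \<Rightarrow> real" where
  "norm_spinor f = sqrt (f \<bullet> f)"

definition dist_spinor :: "spinor \<Rightarrow> spinor \<Rightarrow> real" where
  "dist_spinor f g = norm (f - g)"

definition sgn_spinor :: "spinor \<Rightarrow> spinor" where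
  "sgn_spinor f = inverse (norm f) *\<^sub>R f"

definition uniformity_spinor :: "(spinor \<times> spinor) filter" where
  "uniformity_spinor = (INF e\<in>{0<..}. principal {(f, g). dist f g < e})"

definition open_spinor :: "spinor set \<Rightarrow> bool" where
  "open_spinor U \<longleftrightarrow> (\<forall>f\<in>U. \<forall>\<^sub>F (f', g) in uniformity. f' = f \<longrightarrow> g \<in> U)"

instance
proof
  fix f g h :: spinor and r s :: real and U :: "spinor set"
  show "f + g + h = f + (g + h)"
    by transfer (auto intro!: square_integrable_add simp: add.assoc)
  show "f + g = g + f"
    by transfer (auto intro!: square_integrable_add simp: add.commute)
  show "0 + f = f"
    by transfer auto
  show "- f + f = 0"
    unfolding uminus_spinor_def
    by transfer (auto intro!: square_integrable_add square_integrable_scaleR square_integrable_zero)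
  show "f - g = f + - g"
    unfolding uminus_spinor_def
    by transfer (auto intro!: square_integrable_diff square_integrable_add square_integrable_scaleR)
  show "r *\<^sub>R (f + g) = r *\<^sub>R f + r *\<^sub>R g"
    by transfer (auto intro!: square_integrable_add square_integrable_scaleR simp: scaleR_add_right)
  show "(r + s) *\<^sub>R f = r *\<^sub>R f + s *\<^sub>R f"
    by transfer (auto intro!: square_integrable_add square_integrable_scaleR simp: scaleR_add_left)
  show "r *\<^sub>R s *\<^sub>R f = (r * s) *\<^sub>R f"
    by transfer (auto intro!: square_integrable_scaleR)
  show "1 *\<^sub>R f = f"
    by transfer auto
  show "dist f g = norm (f - g)"
    by (rule dist_spinor_def)
  show "sgn f = inverse (norm f) *\<^sub>R f"
    by (rule sgn_spinor_def)
  show "uniformity = (INF e\<in>{0<..}. principal {(f :: spinor, g). dist f g < e})"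
    by (rule uniformity_spinor_def)
  show "open U \<longleftrightarrow> (\<forall>f\<in>U. \<forall>\<^sub>F (f', g) in uniformity. f' = f \<longrightarrow> g \<in> U)"
    by (rule open_spinor_def)
  show "f \<bullet> g = g \<bullet> f"
    by transfer (simp add: inner_commute)
  show "(f + g) \<bullet> h = f \<bullet> h + g \<bullet> h"
    by transfer (simp add: inner_add_left integrable_inner_square_integrable)
  show "(r *\<^sub>R f) \<bullet> g = r * (f \<bullet> g)"
    by transfer simp
  show "0 \<le> f \<bullet> f"
    by transfer simp
  show "f \<bullet> f = 0 \<longleftrightarrow> f = 0"
  proof transfer
    fix f :: "real \<Rightarrow> complex ^ 2"
    assume f: "square_integrable f \<and> square_integrable f \<and> (AE x in lborel. f x = f x)"
    then have "(LINT x|lborel. f x \<bullet> f x) = 0 \<longleftrightarrow> (AE x in lborel. f x \<bullet> f x = 0)"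
      by (intro integral_nonneg_eq_0_iff_AE integrable_inner_square_integrable) auto
    with f show "(LINT x|lborel. f x \<bullet> f x) = 0 \<longleftrightarrow>
        square_integrable f \<and> square_integrable (\<lambda>x. 0) \<and> (AE x in lborel. f x = 0)"
      by (simp add: square_integrable_zero)
  qed
  show "norm f = sqrt (f \<bullet> f)"
    by (rule norm_spinor_def)
qed

end

lift_definition scaleC :: "complex \<Rightarrow> spinor \<Rightarrow> spinor" is "\<lambda>z f x. z *s f x"
  by (auto intro: square_integrable_scaleC elim: eventually_mono)


section \<open>Spectrum and pseudospectrum of an unbounded operator\<close>

text \<open>An operator is given by its domain \<open>D\<close> and a map \<open>A\<close> of which only the values on \<open>D\<close> matter.
  The norm of \<^typ>\<open>spinor\<close> is the one of \<open>L\<^sup>2\<close>, so \<^const>\<open>onorm\<close> is the operator norm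
  of a bounded operator on \<open>L\<^sup>2\<close>.\<close>

definition resolvent :: "spinor set \<Rightarrow> (spinor \<Rightarrow> spinor) \<Rightarrow> complex \<Rightarrow> spinor \<Rightarrow> spinor" where
  "resolvent D A z = the_inv_into D (\<lambda>f. A f - scaleC z f)"

definition resolvent_set :: "spinor set \<Rightarrow> (spinor \<Rightarrow> spinor) \<Rightarrow> complex set" where
  "resolvent_set D A =
     {z. bij_betw (\<lambda>f. A f - scaleC z f) D UNIV \<and> bounded_linear (resolvent D A z)}"

definition spectrum :: "spinor set \<Rightarrow> (spinor \<Rightarrow> spinor) \<Rightarrow> complex set" where
  "spectrum D A = - resolvent_set D A"

definition pseudospectrum :: "spinor set \<Rightarrow> (spinor \<Rightarrow> spinor) \<Rightarrow> real \<Rightarrow> complex set" where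
  "pseudospectrum D A \<epsilon> =
     spectrum D A \<union> {z \<in> resolvent_set D A. onorm (resolvent D A z) > 1 / \<epsilon>}"

text \<open>The variant with a non-strict inequality. For the Dirac operators below the resolvent norm
  equals \<open>1 / (\<bar>Im z\<bar> - 1)\<close> on \<open>\<bar>Im z\<bar> > 1\<close> (if \<open>m > 0\<close>: for \<open>\<bar>Re z\<bar> \<ge> m\<close>). Hence the lines
  \<open>\<bar>Im z\<bar> = 1 + \<epsilon>\<close> belong to this set, but not to \<^const>\<open>pseudospectrum\<close>.\<close>

definition closed_pseudospectrum :: "spinor set \<Rightarrow> (spinor \<Rightarrow> spinor) \<Rightarrow> real \<Rightarrow> complex set" where
  "closed_pseudospectrum D A \<epsilon> =
     spectrum D A \<union> {z \<in> resolvent_set D A. onorm (resolvent D A z) \<ge> 1 / \<epsilon>}"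

text \<open>The distance to the empty set is infinite, whereas \<^const>\<open>infdist\<close> yields \<open>0\<close>; hence the
  first conjunct below.\<close>

definition trivial_pseudospectrum :: "spinor set \<Rightarrow> (spinor \<Rightarrow> spinor) \<Rightarrow> bool" where
  "trivial_pseudospectrum D A \<longleftrightarrow>
     (\<exists>C\<ge>1. \<forall>\<epsilon>>0. pseudospectrum D A \<epsilon> \<subseteq>
        {z. spectrum D A \<noteq> {} \<and> infdist z (spectrum D A) \<le> C * \<epsilon>})"


section \<open>The Dirac operator\<close>

text \<open>Weak derivatives, tested against compactly supported \<open>C\<^sup>1\<close> functions (as in Brezis,
  Functional Analysis, Sobolev Spaces and Partial Differential Equations, Section 8.2). Real test
  functions suffice, since the integrals are complex linear in them.\<close>

definition test_function :: "(real \<Rightarrow> real) \<Rightarrow> (real \<Rightarrow> real) \<Rightarrow> bool" where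
  "test_function \<phi> \<phi>' \<longleftrightarrow>
     (\<forall>x. (\<phi> has_real_derivative \<phi>' x) (at x)) \<and> continuous_on UNIV \<phi>' \<and>
     (\<exists>R. \<forall>x. \<bar>x\<bar> > R \<longrightarrow> \<phi> x = 0)"

lemma test_function_measurable:
  assumes "test_function \<phi> \<phi>'"
  shows "\<phi> \<in> borel_measurable lborel" "\<phi>' \<in> borel_measurable lborel"
proof -
  have "continuous_on UNIV \<phi>"
    using assms unfolding test_function_def
    by (intro DERIV_continuous_on[of UNIV \<phi> \<phi>']) auto
  then show "\<phi> \<in> borel_measurable lborel"
    by (simp add: borel_measurable_continuous_onI)
  show "\<phi>' \<in> borel_measurable lborel"
    using assms by (simp add: test_function_def borel_measurable_continuous_onI)
qed

lift_definition has_weak_derivative :: "spinor \<Rightarrow> spinor \<Rightarrow> bool"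
  is "\<lambda>f g. \<forall>\<phi> \<phi>'. test_function \<phi> \<phi>' \<longrightarrow>
        (LINT x|lborel. \<phi>' x *\<^sub>R f x) = - (LINT x|lborel. \<phi> x *\<^sub>R g x)"
proof -
  fix f1 f2 g1 g2 :: "real \<Rightarrow> complex ^ 2"
  assume f: "square_integrable f1 \<and> square_integrable f2 \<and> (AE x in lborel. f1 x = f2 x)"
    and g: "square_integrable g1 \<and> square_integrable g2 \<and> (AE x in lborel. g1 x = g2 x)"
  have *: "(LINT x|lborel. \<psi> x *\<^sub>R h1 x) = (LINT x|lborel. \<psi> x *\<^sub>R h2 x)"
    if "\<psi> \<in> borel_measurable lborel"
      and "square_integrable h1 \<and> square_integrable h2 \<and> (AE x in lborel. h1 x = h2 x)"
    for \<psi> and h1 h2 :: "real \<Rightarrow> complex ^ 2"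
    by (rule integral_cong_AE) (use that in \<open>auto simp: square_integrable_def\<close>)
  have "(LINT x|lborel. \<phi>' x *\<^sub>R f1 x) = (LINT x|lborel. \<phi>' x *\<^sub>R f2 x)"
    and "(LINT x|lborel. \<phi> x *\<^sub>R g1 x) = (LINT x|lborel. \<phi> x *\<^sub>R g2 x)"
    if "test_function \<phi> \<phi>'" for \<phi> \<phi>'
    using *[OF test_function_measurable(2)[OF that] f] *[OF test_function_measurable(1)[OF that] g]
    by simp_all
  then show "(\<forall>\<phi> \<phi>'. test_function \<phi> \<phi>' \<longrightarrow>
        (LINT x|lborel. \<phi>' x *\<^sub>R f1 x) = - (LINT x|lborel. \<phi> x *\<^sub>R g1 x)) \<longleftrightarrow>
      (\<forall>\<phi> \<phi>'. test_function \<phi> \<phi>' \<longrightarrow>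
        (LINT x|lborel. \<phi>' x *\<^sub>R f2 x) = - (LINT x|lborel. \<phi> x *\<^sub>R g2 x))"
    by simp
qed

definition H1 :: "spinor set" where
  "H1 = {f. \<exists>g. has_weak_derivative f g}"

definition weak_derivative :: "spinor \<Rightarrow> spinor" where
  "weak_derivative f = (THE g. has_weak_derivative f g)"

lemma continuous_vector_2:
  fixes F G :: "'a::topological_space \<Rightarrow> complex"
  assumes "continuous_on S F" "continuous_on S G"
  shows "continuous_on S (\<lambda>p. vector [F p, G p] :: complex ^ 2)"
proof -
  have "(\<lambda>p. vector [F p, G p] :: complex ^ 2) = (\<lambda>p. \<chi> i. if i = 1 then F p else G p)"
  proof
    fix p
    show "(vector [F p, G p] :: complex ^ 2) = (\<chi> i. if i = 1 then F p else G p)"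
      unfolding vec_eq_iff forall_2 by simp
  qed
  moreover have "continuous_on S (\<lambda>p. if (i :: 2) = 1 then F p else G p)" for i
    using assms by (cases "i = 1") auto
  ultimately show ?thesis
    by (simp only: continuous_on_vec_lambda)
qed

lemma norm_vector_2_le: "norm (vector [a, b] :: complex ^ 2) \<le> cmod a + cmod b"
  using L2_set_le_sum_abs[of "\<lambda>i. norm ((vector [a, b] :: complex ^ 2) $ i)" UNIV]
  by (simp add: norm_vec_def sum_2)

text \<open>The differential expression, with the argument \<open>f'\<close> for the derivative of \<open>f\<close>.\<close>

definition dirac_fun ::
  "real \<Rightarrow> (real \<Rightarrow> complex ^ 2) \<Rightarrow> (real \<Rightarrow> complex ^ 2) \<Rightarrow> real \<Rightarrow> complex ^ 2" where
  "dirac_fun m f f' x =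
     vector [of_real m * f x $ 1 - f' x $ 2, f' x $ 1 - of_real m * f x $ 2]
     + (\<i> * of_real (sgn x)) *s f x"

lemma square_integrable_dirac_fun:
  assumes f: "square_integrable f" and f': "square_integrable f'"
  shows "square_integrable (dirac_fun m f f')"
  unfolding dirac_fun_def [abs_def]
proof (rule square_integrable_bound[OF f f', of _ "2 * \<bar>m\<bar> + 1" 2])
  have meas: "f \<in> borel_measurable lborel" "f' \<in> borel_measurable lborel"
    using f f' by (simp_all add: square_integrable_def)
  have "(\<lambda>x. vector [of_real m * f x $ 1 - f' x $ 2, f' x $ 1 - of_real m * f x $ 2]
      :: complex ^ 2) \<in> borel_measurable lborel"
    by (rule borel_measurable_continuous_Pair[OF meas,
        of "\<lambda>v w. vector [of_real m * v $ 1 - w $ 2, w $ 1 - of_real m * v $ 2] :: complex ^ 2"])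
      (intro continuous_vector_2 continuous_intros)
  moreover have "(\<lambda>x. \<i> * of_real (sgn x)) \<in> borel_measurable (lborel :: real measure)"
    unfolding sgn_real_def by measurable
  ultimately show "(\<lambda>x. vector [of_real m * f x $ 1 - f' x $ 2, f' x $ 1 - of_real m * f x $ 2]
      + (\<i> * of_real (sgn x)) *s f x) \<in> borel_measurable lborel"
    by (intro borel_measurable_add borel_measurable_vector_scalar_mult meas)
  fix x
  let ?v = "f x" and ?w = "f' x"
  let ?p = "vector [of_real m * ?v $ 1 - ?w $ 2, ?w $ 1 - of_real m * ?v $ 2] :: complex ^ 2"
  have "norm ?p \<le> cmod (of_real m * ?v $ 1 - ?w $ 2) + cmod (?w $ 1 - of_real m * ?v $ 2)"
    by (rule norm_vector_2_le)
  also have "\<dots> \<le> (cmod (of_real m * ?v $ 1) + cmod (?w $ 2))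
      + (cmod (?w $ 1) + cmod (of_real m * ?v $ 2))"
    by (intro add_mono norm_triangle_ineq4)
  also have "\<dots> \<le> (\<bar>m\<bar> * norm ?v + norm ?w) + (norm ?w + \<bar>m\<bar> * norm ?v)"
    by (intro add_mono) (auto simp: norm_mult Finite_Cartesian_Product.norm_nth_le
        intro!: mult_left_mono)
  finally have p: "norm ?p \<le> 2 * \<bar>m\<bar> * norm ?v + 2 * norm ?w"
    by simp
  have "norm ((\<i> * of_real (sgn x)) *s ?v) \<le> 1 * norm ?v"
    unfolding norm_vector_scalar_mult
    by (intro mult_right_mono) (auto simp: norm_mult sgn_real_def)
  with p norm_triangle_ineq[of ?p "(\<i> * of_real (sgn x)) *s ?v"]
  show "norm (?p + (\<i> * of_real (sgn x)) *s ?v) \<le> (2 * \<bar>m\<bar> + 1) * norm ?v + 2 * norm ?w"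
    by (simp add: algebra_simps)
qed

lift_definition dirac_expression :: "real \<Rightarrow> spinor \<Rightarrow> spinor \<Rightarrow> spinor" is dirac_fun
proof -
  fix m :: real and f1 f2 g1 g2 :: "real \<Rightarrow> complex ^ 2"
  assume f: "square_integrable f1 \<and> square_integrable f2 \<and> (AE x in lborel. f1 x = f2 x)"
    and g: "square_integrable g1 \<and> square_integrable g2 \<and> (AE x in lborel. g1 x = g2 x)"
  from f have "AE x in lborel. f1 x = f2 x" by simp
  moreover from g have "AE x in lborel. g1 x = g2 x" by simp
  ultimately have "AE x in lborel. dirac_fun m f1 g1 x = dirac_fun m f2 g2 x"
    by eventually_elim (simp add: dirac_fun_def)
  with f g show "square_integrable (dirac_fun m f1 g1) \<and> square_integrable (dirac_fun m f2 g2) \<and>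
      (AE x in lborel. dirac_fun m f1 g1 x = dirac_fun m f2 g2 x)"
    by (simp add: square_integrable_dirac_fun)
qed

text \<open>The domain of the operator \<open>dirac m\<close> is \<^const>\<open>H1\<close>.\<close>

definition dirac :: "real \<Rightarrow> spinor \<Rightarrow> spinor" where
  "dirac m f = dirac_expression m f (weak_derivative f)"

text \<open>The regions \<open>\<Lambda>\<^sub>\<plusminus>\<^sup>\<alpha>(\<epsilon>)\<close> for the mass \<open>m\<close> are \<open>\<Lambda> m (1 \<plusminus> \<alpha>) \<epsilon>\<close>.\<close>

definition \<Lambda> :: "real \<Rightarrow> real \<Rightarrow> real \<Rightarrow> complex set" where
  "\<Lambda> m c \<epsilon> = {z. \<bar>Im z\<bar> \<le> 1 + \<epsilon> \<and> \<bar>Re z\<bar>\<^sup>2 \<ge> m * (1 - \<bar>Im z\<bar>\<^sup>2) / (c * \<epsilon>)}"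

end

theory Submission
  imports Defs
begin

text \<open>
  Put \<open>w = z - \<i>\<close> on the right half-line and \<open>w = z + \<i>\<close> on the left one. On each of them the equation
  \<open>(L - z) f = g\<close> is the system \<open>f1' = (m + w) f2 + g2\<close>, \<open>f2' = (m - w) f1 - g1\<close> with constant
  coefficients, whose homogeneous solutions are \<open>exp (- \<theta> x) (1, - r)\<close> and \<open>exp (\<theta> x) (1, r)\<close> with
  \<open>r = \<theta> / (m + w)\<close>, \<open>\<theta>^2 = m^2 - w^2\<close>, \<open>Re \<theta> > 0\<close>. The component of \<open>g\<close> along a mode is integrated in
  the direction in which that mode decays, and two amplitudes remain free: one of the mode decaying
  at \<open>\<infinity>\<close> and one of the mode decaying at \<open>-\<infinity>\<close>. Continuity at \<open>0\<close> is a linear system for them with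
  determinant \<open>rp + rn\<close>; here and below, the suffixes \<open>p\<close> and \<open>n\<close> refer to the positive and the
  negative half-line. Where this determinant does not vanish,
  \<open>L - z\<close> is onto (\<open>dirac_solution\<close>, \<open>mode_ratio_sum_nonzero\<close>), and since \<open>L - z\<close> is symmetric for
  the bilinear pairing it is then also injective (\<open>dirac_shift_injective\<close>).

  For \<open>\<bar>Im z\<bar> > 1\<close> the numerical range gives \<open>\<parallel>(L - z)\<inverse>\<parallel> \<le> 1 / (\<bar>Im z\<bar> - 1)\<close>. Slowly decaying plane
  waves on one half-line are approximate eigenfunctions for all boundary points of the strip (with
  \<open>\<bar>Re z\<bar> > m\<close> if \<open>m > 0\<close>); they put these points into the spectrum and give equality in the bound.

  For \<open>m = 0\<close> and \<open>\<bar>Im z\<bar> < 1\<close> both decaying modes have the direction \<open>(1, -\<i>)\<close>, so they fit together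
  to an eigenfunction. Hence the spectrum is the closed strip, and the pseudospectrum is trivial.

  For \<open>m > 0\<close> and \<open>\<bar>Im z\<bar> < 1\<close> the two directions differ, but only by
  \<open>\<bar>rp + rn\<bar> \<approx> 2 m / (Re z)^2\<close>, which makes the amplitudes large. The amplitudes are pairings of
  \<open>g\<close> with functions close to the almost-eigenfunction, whose squared norm is about
  \<open>2 / (1 - (Im z)^2)\<close>; the rest of the solution has norm at most \<open>C \<parallel>g\<parallel> / (1 - \<bar>Im z\<bar>)\<close>. So
  \<open>\<parallel>(L - z)\<inverse>\<parallel>\<close> is asymptotic to \<open>(Re z)^2 / (m (1 - (Im z)^2))\<close>, uniformly in the strip; the lower
  bound comes from choosing \<open>g\<close> as the complex conjugate of the kernel of the pairing. This is
  \<open>strip_resolvent_asymptotics\<close>, and inside the strip the inclusions for \<open>m > 0\<close> restate it. The pseudospectrum is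
  non-trivial, because far real points have distance at least \<open>1\<close> from the spectrum while the resolvent
  norm is unbounded there.

  The analysis of \<open>H1\<close> rests on the convolutions \<open>fwd \<theta>\<close> and \<open>bwd \<theta>\<close> with one-sided exponentials,
  which are the inverses of \<open>d/dx + \<theta>\<close> and \<open>- d/dx + \<theta>\<close> and are adjoint to each other. Every \<open>u\<close> in \<open>H1\<close>
  is \<open>fwd 1 (u + u')\<close> and \<open>bwd 1 (u - u')\<close> almost everywhere, so integration by parts in \<open>H1\<close> is
  nothing but this adjointness (\<open>weak_deriv_parts\<close>).
\<close>


section \<open>Square-integrable scalar functions\<close>

definition L2_fun :: "(real \<Rightarrow> complex) \<Rightarrow> bool" where
  "L2_fun u \<longleftrightarrow> u \<in> borel_measurable borel \<and> integrable lborel (\<lambda>x. (cmod (u x))^2)"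

lemma L2_fun_measurable [measurable_dest]: "L2_fun u \<Longrightarrow> u \<in> borel_measurable borel"
  by (simp add: L2_fun_def)

lemma L2_fun_integrable_square: "L2_fun u \<Longrightarrow> integrable lborel (\<lambda>x. (cmod (u x))^2)"
  by (simp add: L2_fun_def)

lemma norm_vector_2: "(norm (vector [a, b] :: complex ^ 2))^2 = (cmod a)^2 + (cmod b)^2"
  by (simp add: norm_vec_def L2_set_def sum_2)

lemma vector_2_eq_iff: "(v :: complex ^ 2) = w \<longleftrightarrow> v $ 1 = w $ 1 \<and> v $ 2 = w $ 2"
  by (simp add: vec_eq_iff forall_2)

lemma borel_measurable_vector:
  fixes f1 f2 :: "real \<Rightarrow> complex"
  assumes "f1 \<in> borel_measurable borel" "f2 \<in> borel_measurable borel"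
  shows "(\<lambda>x. vector [f1 x, f2 x] :: complex ^ 2) \<in> borel_measurable borel"
proof -
  have "continuous_on UNIV (\<lambda>p :: complex \<times> complex. vector [fst p, snd p] :: complex ^ 2)"
    by (intro continuous_vector_2 continuous_intros)
  then show ?thesis
    using borel_measurable_continuous_Pair[OF assms, of "\<lambda>a b. vector [a, b] :: complex ^ 2"] by simp
qed

lemma square_integrable_vector:
  assumes "L2_fun f1" "L2_fun f2"
  shows "square_integrable (\<lambda>x. vector [f1 x, f2 x])"
  using assms by (simp add: square_integrable_def norm_vector_2 L2_fun_def borel_measurable_vector)

lemma square_integrable_component:
  assumes "square_integrable f"
  shows "L2_fun (\<lambda>x. f x $ i)"
proof -
  have m: "f \<in> borel_measurable borel" using assms by (simp add: square_integrable_def)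
  have "continuous_on UNIV (\<lambda>v :: complex ^ 2. v $ i)"
    by (intro continuous_intros)
  from borel_measurable_continuous_on[OF this m]
  have c: "(\<lambda>x. f x $ i) \<in> borel_measurable borel" .
  have "integrable lborel (\<lambda>x. (cmod (f x $ i))^2)"
  proof (rule Bochner_Integration.integrable_bound)
    show "integrable lborel (\<lambda>x. (norm (f x))^2)"
      using assms by (simp add: square_integrable_def)
    show "AE x in lborel. norm ((cmod (f x $ i))^2) \<le> norm ((norm (f x))^2)"
      by (intro AE_I2) (simp add: Finite_Cartesian_Product.norm_nth_le power_mono)
  qed (use c in measurable)
  with c show ?thesis by (simp add: L2_fun_def)
qed

lemma L2_fun_bound:
  assumes f: "L2_fun f" and g: "L2_fun g" and h: "h \<in> borel_measurable borel"
    and le: "\<And>x. cmod (h x) \<le> c * cmod (f x) + d * cmod (g x)"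
  shows "L2_fun h"
proof -
  have zero: "L2_fun (\<lambda>x. 0)" by (simp add: L2_fun_def)
  have n: "norm (vector [a, 0] :: complex ^ 2) = cmod a" for a
    using norm_vector_2[of a 0] by (simp add: power2_eq_iff_nonneg)
  have "square_integrable (\<lambda>x. vector [h x, 0])"
    by (rule square_integrable_bound[OF square_integrable_vector[OF f zero] square_integrable_vector[OF g zero], of _ c d])
      (use le h in \<open>simp_all add: n borel_measurable_vector\<close>)
  from square_integrable_component[OF this, of 1] show ?thesis by simp
qed

lemma L2_fun_dominated:
  assumes "L2_fun f" "h \<in> borel_measurable borel" "\<And>x. cmod (h x) \<le> c * cmod (f x)"
  shows "L2_fun h"
  by (rule L2_fun_bound[OF assms(1,1,2), of c 0]) (use assms(3) in auto)

lemma L2_fun_zero: "L2_fun (\<lambda>x. 0)"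
  by (simp add: L2_fun_def)

lemma L2_fun_add: "L2_fun u \<Longrightarrow> L2_fun v \<Longrightarrow> L2_fun (\<lambda>x. u x + v x)"
  by (rule L2_fun_bound[of u v _ 1 1]) (auto simp: L2_fun_def intro: norm_triangle_ineq)

lemma L2_fun_cmult: "L2_fun u \<Longrightarrow> L2_fun (\<lambda>x. c * u x)"
  by (rule L2_fun_dominated[of u _ "cmod c"]) (auto simp: L2_fun_def norm_mult)

lemma L2_fun_minus: "L2_fun u \<Longrightarrow> L2_fun (\<lambda>x. - u x)"
  using L2_fun_cmult[of u "-1"] by simp

lemma L2_fun_diff: "L2_fun u \<Longrightarrow> L2_fun v \<Longrightarrow> L2_fun (\<lambda>x. u x - v x)"
  using L2_fun_add[OF _ L2_fun_minus, of u v] by simp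

lemma L2_fun_cnj: "L2_fun u \<Longrightarrow> L2_fun (\<lambda>x. cnj (u x))"
  by (rule L2_fun_dominated[of u _ 1])
    (auto simp: L2_fun_def intro: borel_measurable_continuous_on[OF continuous_on_cnj[OF continuous_on_id]])

lemma L2_fun_reflect: "L2_fun u \<Longrightarrow> L2_fun (\<lambda>x. u (- x))"
  using lborel_integrable_real_affine[of "\<lambda>x. (cmod (u x))^2" "-1" 0]
  by (auto simp: L2_fun_def)

lemma L2_fun_integrable_mult:
  assumes "L2_fun u" "L2_fun v"
  shows "integrable lborel (\<lambda>x. u x * v x)"
proof (rule Bochner_Integration.integrable_bound)
  show "integrable lborel (\<lambda>x. (cmod (u x))^2 + (cmod (v x))^2)"
    using assms by (auto simp: L2_fun_def)
  show "(\<lambda>x. u x * v x) \<in> borel_measurable lborel"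
    using assms by (auto simp: L2_fun_def)
  have "cmod (u x) * cmod (v x) \<le> (cmod (u x))^2 + (cmod (v x))^2" for x
    using sum_squares_bound[of "cmod (u x)" "cmod (v x)"]
      mult_nonneg_nonneg[OF norm_ge_zero[of "u x"] norm_ge_zero[of "v x"]] by linarith
  then show "AE x in lborel. norm (u x * v x) \<le> norm ((cmod (u x))^2 + (cmod (v x))^2)"
    by (intro AE_I2) (simp add: norm_mult)
qed

lemma integral_reflect:
  fixes u :: "real \<Rightarrow> 'a :: {banach, second_countable_topology}"
  shows "(LBINT x. u (- x)) = (LBINT x. u x)"
  using lborel_integral_real_affine[of "-1" u 0] by simp

section \<open>Convolution with a one-sided exponential\<close>

text \<open>\<open>decay \<theta>\<close> is the fundamental solution of \<open>d/dx + \<theta>\<close> that vanishes on the left; \<open>fwd \<theta>\<close> is the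
  convolution with it and \<open>bwd \<theta>\<close> the convolution with its reflection.\<close>

definition decay :: "complex \<Rightarrow> real \<Rightarrow> complex" where
  "decay \<theta> t = (if 0 \<le> t then exp (- \<theta> * of_real t) else 0)"

definition fwd :: "complex \<Rightarrow> (real \<Rightarrow> complex) \<Rightarrow> real \<Rightarrow> complex" where
  "fwd \<theta> g x = (LBINT y. decay \<theta> (x - y) * g y)"

definition bwd :: "complex \<Rightarrow> (real \<Rightarrow> complex) \<Rightarrow> real \<Rightarrow> complex" where
  "bwd \<theta> g x = (LBINT y. decay \<theta> (y - x) * g y)"

lemma decay_measurable [measurable]: "decay \<theta> \<in> borel_measurable borel"
proof -
  have [measurable]: "(\<lambda>t::real. exp (- \<theta> * of_real t)) \<in> borel_measurable borel"
    by (intro borel_measurable_continuous_onI continuous_intros)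
  show ?thesis
    unfolding decay_def [abs_def] by measurable
qed

lemma cmod_decay: "cmod (decay \<theta> t) = (if 0 \<le> t then exp (- Re \<theta> * t) else 0)"
  by (simp add: decay_def)

lemma exp_half_line_bochner:
  fixes a :: real
  assumes "a > 0"
  shows "has_bochner_integral lborel (\<lambda>t. if 0 \<le> t then exp (- a * t) else 0) (1 / a)"
proof -
  have "((\<lambda>t. exp (- a * t)) has_integral (exp (- a * 0) / a)) {0..}"
    by (rule has_integral_exp_minus_to_infinity[OF assms])
  from has_integral_restrict_UNIV[THEN iffD2, OF this]
  have "((\<lambda>t. if 0 \<le> t then exp (- a * t) else 0) has_integral (1 / a)) UNIV"
    by simp
  then show ?thesis
    by (intro has_bochner_integral_nn_integral nn_integral_has_integral_lborel) (use assms in auto)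
qed

lemma cmod_decay_bochner:
  assumes "Re \<theta> > 0"
  shows "has_bochner_integral lborel (\<lambda>t. cmod (decay \<theta> t)) (1 / Re \<theta>)"
  using exp_half_line_bochner[OF assms] by (simp add: cmod_decay)

lemma decay_square_bochner:
  assumes "Re \<theta> > 0"
  shows "has_bochner_integral lborel (\<lambda>x. (cmod (decay \<theta> x))^2) (1 / (2 * Re \<theta>))"
    and "has_bochner_integral lborel (\<lambda>x. (cmod (decay \<theta> (- x)))^2) (1 / (2 * Re \<theta>))"
proof -
  have "has_bochner_integral lborel (\<lambda>t. if 0 \<le> t then exp (- (2 * Re \<theta>) * t) else 0) (1 / (2 * Re \<theta>))"
    by (rule exp_half_line_bochner) (use assms in simp)
  moreover have "(\<lambda>t. if 0 \<le> t then exp (- (2 * Re \<theta>) * t) else 0) = (\<lambda>t. (cmod (decay \<theta> t))^2)"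
    by (auto simp: cmod_decay exp_double[symmetric] mult.assoc)
  ultimately show *: "has_bochner_integral lborel (\<lambda>x. (cmod (decay \<theta> x))^2) (1 / (2 * Re \<theta>))"
    by simp
  then show "has_bochner_integral lborel (\<lambda>x. (cmod (decay \<theta> (- x)))^2) (1 / (2 * Re \<theta>))"
    using integral_reflect[of "\<lambda>x. (cmod (decay \<theta> x))^2"]
      lborel_integrable_real_affine[of "\<lambda>x. (cmod (decay \<theta> x))^2" "-1" 0]
    by (auto simp: has_bochner_integral_iff)
qed

lemma L2_fun_decay: "Re \<theta> > 0 \<Longrightarrow> L2_fun (decay \<theta>)"
  using decay_square_bochner(1) by (auto simp: L2_fun_def has_bochner_integral_iff)

lemma bwd_eq_fwd: "bwd \<theta> g x = fwd \<theta> (\<lambda>y. g (- y)) (- x)"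
  unfolding bwd_def fwd_def by (subst integral_reflect[symmetric]) simp

lemma integrable_decay_mult:
  assumes "Re \<theta> > 0" "L2_fun g"
  shows "integrable lborel (\<lambda>y. decay \<theta> (x - y) * g y)" "integrable lborel (\<lambda>y. decay \<theta> (y - x) * g y)"
proof -
  have "L2_fun (\<lambda>y. decay \<theta> (x - y))"
    using L2_fun_decay[OF assms(1)] lborel_integrable_real_affine[of "\<lambda>t. (cmod (decay \<theta> t))^2" "-1" x]
    by (auto simp: L2_fun_def)
  moreover have "L2_fun (\<lambda>y. decay \<theta> (y - x))"
    using L2_fun_decay[OF assms(1)] lborel_integrable_real_affine[of "\<lambda>t. (cmod (decay \<theta> t))^2" 1 "-x"]
    by (auto simp: L2_fun_def)
  ultimately show "integrable lborel (\<lambda>y. decay \<theta> (x - y) * g y)" "integrable lborel (\<lambda>y. decay \<theta> (y - x) * g y)"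
    using assms(2) by (auto intro: L2_fun_integrable_mult)
qed

lemma fwd_measurable [measurable]:
  assumes [measurable]: "g \<in> borel_measurable borel"
  shows "fwd \<theta> g \<in> borel_measurable borel"
  unfolding fwd_def [abs_def] by measurable

lemma decay_translate_bochner:
  assumes "Re \<theta> > 0"
  shows "has_bochner_integral lborel (\<lambda>y. cmod (decay \<theta> (x - y))) (1 / Re \<theta>)"
    and "has_bochner_integral lborel (\<lambda>y. cmod (decay \<theta> (y - x))) (1 / Re \<theta>)"
  using cmod_decay_bochner[OF assms]
    lborel_integral_real_affine[of "-1" "\<lambda>t. cmod (decay \<theta> t)" x]
    lborel_integrable_real_affine[of "\<lambda>t. cmod (decay \<theta> t)" "-1" x]
    lborel_integral_real_affine[of 1 "\<lambda>t. cmod (decay \<theta> t)" "-x"]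
    lborel_integrable_real_affine[of "\<lambda>t. cmod (decay \<theta> t)" 1 "-x"]
  by (simp_all add: has_bochner_integral_iff)

text \<open>Integrability for the two halves of Schur's test with the kernel \<open>decay \<theta> (x - y)\<close>, whose modulus has the same integral
  \<open>1 / Re \<theta>\<close> in either variable.\<close>

lemma schur_kernel_integrable:
  assumes \<theta>: "Re \<theta> > 0" and g: "L2_fun g" and h: "L2_fun h"
  shows "integrable (lborel \<Otimes>\<^sub>M lborel) (\<lambda>(x, y). cmod (decay \<theta> (x - y)) * (cmod (h x))^2)"
    and "integrable (lborel \<Otimes>\<^sub>M lborel) (\<lambda>(x, y). cmod (decay \<theta> (x - y)) * (cmod (g y))^2)"
proof -
  have [measurable]: "g \<in> borel_measurable borel"
    using g by (auto simp: L2_fun_def)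
  show "integrable (lborel \<Otimes>\<^sub>M lborel) (\<lambda>(x, y). cmod (decay \<theta> (x - y)) * (cmod (h x))^2)"
  proof (rule lborel_pair.Fubini_integrable)
    have [measurable]: "h \<in> borel_measurable borel"
      using h by (auto simp: L2_fun_def)
    show "(\<lambda>(x, y). cmod (decay \<theta> (x - y)) * (cmod (h x))^2) \<in> borel_measurable (lborel \<Otimes>\<^sub>M lborel)"
      by measurable
    show "integrable lborel (\<lambda>x. LBINT y. norm (case (x, y) of (x, y) \<Rightarrow> cmod (decay \<theta> (x - y)) * (cmod (h x))^2))"
      using h decay_translate_bochner(1)[OF \<theta>] by (simp add: L2_fun_def has_bochner_integral_iff)
    show "AE x in lborel. integrable lborel (\<lambda>y. case (x, y) of (x, y) \<Rightarrow> cmod (decay \<theta> (x - y)) * (cmod (h x))^2)"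
      using decay_translate_bochner(1)[OF \<theta>] by (simp add: has_bochner_integral_iff)
  qed
  have "integrable (lborel \<Otimes>\<^sub>M lborel) (\<lambda>(y, x). cmod (decay \<theta> (x - y)) * (cmod (g y))^2)"
  proof (rule lborel_pair.Fubini_integrable)
    show "integrable lborel (\<lambda>y. LBINT x. norm (case (y, x) of (y, x) \<Rightarrow> cmod (decay \<theta> (x - y)) * (cmod (g y))^2))"
      using g decay_translate_bochner(2)[OF \<theta>] by (simp add: L2_fun_def has_bochner_integral_iff)
    show "AE y in lborel. integrable lborel (\<lambda>x. case (y, x) of (y, x) \<Rightarrow> cmod (decay \<theta> (x - y)) * (cmod (g y))^2)"
      using decay_translate_bochner(2)[OF \<theta>] by (simp add: has_bochner_integral_iff)
  qed measurable
  from lborel_pair.integrable_product_swap[OF this]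
  show "integrable (lborel \<Otimes>\<^sub>M lborel) (\<lambda>(x, y). cmod (decay \<theta> (x - y)) * (cmod (g y))^2)"
    by (simp add: case_prod_unfold)
qed

lemma kernel_product_integrable:
  assumes \<theta>: "Re \<theta> > 0" and g: "L2_fun g" and h: "L2_fun h"
  shows "integrable (lborel \<Otimes>\<^sub>M lborel) (\<lambda>(x, y). decay \<theta> (x - y) * g y * h x)"
    (is "integrable _ ?F")
proof -
  have [measurable]: "g \<in> borel_measurable borel" "h \<in> borel_measurable borel"
    using g h by (auto simp: L2_fun_def)
  note G = schur_kernel_integrable(1)[OF \<theta> g h] and H' = schur_kernel_integrable(2)[OF \<theta> g g]
  show ?thesis
  proof (rule Bochner_Integration.integrable_bound)
    show "integrable (lborel \<Otimes>\<^sub>M lborel) (\<lambda>p. (case p of (x, y) \<Rightarrow> cmod (decay \<theta> (x - y)) * (cmod (h x))^2)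
        + (case p of (x, y) \<Rightarrow> cmod (decay \<theta> (x - y)) * (cmod (g y))^2))"
      using G H' by (rule Bochner_Integration.integrable_add)
    have "cmod (decay \<theta> (x - y) * g y * h x)
        \<le> cmod (decay \<theta> (x - y)) * (cmod (h x))^2 + cmod (decay \<theta> (x - y)) * (cmod (g y))^2" for x y
    proof -
      have "cmod (g y) * cmod (h x) \<le> (cmod (h x))^2 + (cmod (g y))^2"
        using sum_squares_bound[of "cmod (g y)" "cmod (h x)"]
          mult_nonneg_nonneg[OF norm_ge_zero[of "g y"] norm_ge_zero[of "h x"]] by linarith
      from mult_left_mono[OF this, of "cmod (decay \<theta> (x - y))"] show ?thesis
        by (simp add: norm_mult distrib_left mult.assoc)
    qed
    then show "AE p in lborel \<Otimes>\<^sub>M lborel. norm (?F p) \<le> norm ((case p of (x, y) \<Rightarrow> cmod (decay \<theta> (x - y)) * (cmod (h x))^2)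
        + (case p of (x, y) \<Rightarrow> cmod (decay \<theta> (x - y)) * (cmod (g y))^2))"
      by (intro AE_I2) (auto split: prod.split intro: order_trans[OF _ abs_ge_self])
  qed measurable
qed

lemma fwd_bwd_adjoint:
  assumes "Re \<theta> > 0" "L2_fun g" "L2_fun h"
  shows "(LBINT x. fwd \<theta> g x * h x) = (LBINT y. g y * bwd \<theta> h y)"
proof -
  have "(LBINT x. fwd \<theta> g x * h x)
      = (LBINT x. LBINT y. (case (x, y) of (x, y) \<Rightarrow> decay \<theta> (x - y) * g y * h x))"
    unfolding fwd_def using integrable_decay_mult(1)[OF assms(1,2)] by simp
  also have "\<dots> = (LBINT y. LBINT x. (case (x, y) of (x, y) \<Rightarrow> decay \<theta> (x - y) * g y * h x))"
    using lborel_pair.Fubini_integral[OF kernel_product_integrable[OF assms]]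
    by simp
  also have "\<dots> = (LBINT y. g y * bwd \<theta> h y)"
  proof (rule Bochner_Integration.integral_cong[OF refl])
    fix y
    have "(\<lambda>x. case (x, y) of (x, y) \<Rightarrow> decay \<theta> (x - y) * g y * h x)
        = (\<lambda>x. g y * (decay \<theta> (x - y) * h x))"
      by (auto simp: mult_ac)
    then show "(LBINT x. (case (x, y) of (x, y) \<Rightarrow> decay \<theta> (x - y) * g y * h x)) = g y * bwd \<theta> h y"
      by (simp add: bwd_def)
  qed
  finally show ?thesis .
qed

text \<open>Schur's test. The Cauchy-Schwarz inequality for the measure with density \<open>\<bar>decay \<theta> (x - y)\<bar>\<close> bounds
  \<open>\<bar>fwd \<theta> g x\<bar>^2\<close> by a function \<open>K * B x\<close>, whose integral is computed by Fubini.\<close>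

lemma fwd_L2:
  assumes \<theta>: "Re \<theta> > 0" and g: "L2_fun g"
  shows "L2_fun (fwd \<theta> g)"
    and "(LBINT x. (cmod (fwd \<theta> g x))^2) \<le> (1 / Re \<theta>)^2 * (LBINT x. (cmod (g x))^2)"
proof -
  have [measurable]: "g \<in> borel_measurable borel"
    using g by (auto simp: L2_fun_def)
  define K where "K = 1 / Re \<theta>"
  have K: "K > 0" using \<theta> by (simp add: K_def)
  define B where "B x = (LBINT y. cmod (decay \<theta> (x - y)) * (cmod (g y))^2)" for x
  have pointwise: "(cmod (fwd \<theta> g x))^2 \<le> K * B x" for x
  proof -
    define A where "A = (LBINT y. cmod (decay \<theta> (x - y)) * cmod (g y))"
    have i1: "integrable lborel (\<lambda>y. cmod (decay \<theta> (x - y)) * cmod (g y))"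
      using integrable_norm[OF integrable_decay_mult(1)[OF \<theta> g]] by (simp add: norm_mult)
    have i2: "integrable lborel (\<lambda>y. cmod (decay \<theta> (x - y)) * (cmod (g y))^2)"
    proof (rule Bochner_Integration.integrable_bound)
      show "integrable lborel (\<lambda>y. (cmod (g y))^2)"
        using g by (simp add: L2_fun_def)
      show "AE y in lborel. norm (cmod (decay \<theta> (x - y)) * (cmod (g y))^2) \<le> norm ((cmod (g y))^2)"
        using \<theta> by (intro AE_I2) (auto simp: cmod_decay intro!: mult_left_le_one_le)
    qed measurable
    have i0: "integrable lborel (\<lambda>y. cmod (decay \<theta> (x - y)))" "(LBINT y. cmod (decay \<theta> (x - y))) = K"
      using decay_translate_bochner(1)[OF \<theta>] by (auto simp: has_bochner_integral_iff K_def)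
    \<comment> \<open>Expanding this square gives \<open>A^2 \<le> K * B x\<close>; \<open>A / K\<close> is the mean value of \<open>\<bar>g\<bar>\<close>.\<close>
    have "0 \<le> (LBINT y. cmod (decay \<theta> (x - y)) * (cmod (g y) - A / K)^2)"
      by (intro Bochner_Integration.integral_nonneg) auto
    also have "\<dots> = (LBINT y. cmod (decay \<theta> (x - y)) * (cmod (g y))^2
        - 2 * (A / K) * (cmod (decay \<theta> (x - y)) * cmod (g y)) + (A / K)^2 * cmod (decay \<theta> (x - y)))"
      by (intro Bochner_Integration.integral_cong) (auto simp: power2_eq_square algebra_simps)
    also have "\<dots> = B x - 2 * (A / K) * A + (A / K)^2 * K"
      using i0 i1 i2 by (simp add: B_def A_def)
    also have "\<dots> = B x - A^2 / K"
      using K by (simp add: power2_eq_square field_simps)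
    finally have "A^2 \<le> K * B x"
      using K by (simp add: field_simps)
    moreover have "cmod (fwd \<theta> g x) \<le> A"
      unfolding fwd_def A_def
      using integral_norm_bound[of lborel "\<lambda>y. decay \<theta> (x - y) * g y"] by (simp add: norm_mult)
    then have "(cmod (fwd \<theta> g x))^2 \<le> A^2"
      by (intro power_mono) auto
    ultimately show ?thesis by linarith
  qed
  have BI: "integrable lborel B"
    using lborel_pair.integrable_fst'[OF schur_kernel_integrable(2)[OF \<theta> g g]] by (simp add: B_def [abs_def])
  have "(LBINT x. B x) = (LBINT y. LBINT x. cmod (decay \<theta> (x - y)) * (cmod (g y))^2)"
    unfolding B_def using lborel_pair.Fubini_integral[OF schur_kernel_integrable(2)[OF \<theta> g g]] by simp
  also have "\<dots> = (LBINT y. K * (cmod (g y))^2)"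
    using decay_translate_bochner(2)[OF \<theta>] by (simp add: has_bochner_integral_iff K_def)
  finally have BV: "(LBINT x. B x) = K * (LBINT x. (cmod (g x))^2)"
    by simp
  have I: "integrable lborel (\<lambda>x. (cmod (fwd \<theta> g x))^2)"
  proof (rule Bochner_Integration.integrable_bound)
    show "integrable lborel (\<lambda>x. K * B x)" using BI by simp
    show "AE x in lborel. norm ((cmod (fwd \<theta> g x))^2) \<le> norm (K * B x)"
      using pointwise by (intro AE_I2) (auto intro: order_trans[OF _ abs_ge_self])
  qed measurable
  then show "L2_fun (fwd \<theta> g)"
    by (simp add: L2_fun_def)
  have "(LBINT x. (cmod (fwd \<theta> g x))^2) \<le> (LBINT x. K * B x)"
    by (intro integral_mono I pointwise) (use BI in simp)
  also have "\<dots> = (1 / Re \<theta>)^2 * (LBINT x. (cmod (g x))^2)"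
    by (simp add: BV K_def power2_eq_square)
  finally show "(LBINT x. (cmod (fwd \<theta> g x))^2) \<le> (1 / Re \<theta>)^2 * (LBINT x. (cmod (g x))^2)" .
qed

lemma bwd_L2:
  assumes \<theta>: "Re \<theta> > 0" and g: "L2_fun g"
  shows "L2_fun (bwd \<theta> g)"
    and "(LBINT x. (cmod (bwd \<theta> g x))^2) \<le> (1 / Re \<theta>)^2 * (LBINT x. (cmod (g x))^2)"
proof -
  note * = fwd_L2[OF \<theta> L2_fun_reflect[OF g]]
  show "L2_fun (bwd \<theta> g)"
    using L2_fun_reflect[OF *(1)] by (simp add: bwd_eq_fwd [abs_def])
  show "(LBINT x. (cmod (bwd \<theta> g x))^2) \<le> (1 / Re \<theta>)^2 * (LBINT x. (cmod (g x))^2)"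
    using *(2) integral_reflect[of "\<lambda>x. (cmod (fwd \<theta> (\<lambda>y. g (- y)) x))^2"] integral_reflect[of "\<lambda>x. (cmod (g x))^2"]
    by (simp add: bwd_eq_fwd)
qed

section \<open>Weak derivatives of scalar functions\<close>

text \<open>The derivative of a test function is supported in the same interval, because a point outside has a
  neighbourhood on which the function vanishes.\<close>

lemma test_function_derivative_zero:
  assumes "test_function \<phi> \<phi>'"
  obtains R where "R > 0" "\<And>x. \<bar>x\<bar> > R \<Longrightarrow> \<phi> x = 0" "\<And>x. \<bar>x\<bar> > R \<Longrightarrow> \<phi>' x = 0"
proof -
  obtain R0 where R0: "\<And>x. \<bar>x\<bar> > R0 \<Longrightarrow> \<phi> x = 0"
    using assms by (auto simp: test_function_def)
  define R where "R = max 1 R0"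
  have R: "\<phi> x = 0" if "\<bar>x\<bar> > R" for x
    using R0 that by (simp add: R_def)
  have "\<phi>' x = 0" if x: "\<bar>x\<bar> > R" for x
  proof -
    have "open {x::real. R < \<bar>x\<bar>}"
      by (intro open_Collect_less continuous_intros)
    then have ev: "\<forall>\<^sub>F y in nhds x. \<phi> y = 0"
      using R x by (auto simp: eventually_nhds)
    have "(\<phi> has_real_derivative \<phi>' x) (at x)"
      using assms by (simp add: test_function_def)
    then have "((\<lambda>y. 0) has_real_derivative \<phi>' x) (at x)"
      using DERIV_cong_ev[OF refl ev refl] by blast
    then show ?thesis
      using DERIV_unique[OF _ DERIV_const] by blast
  qed
  with R show ?thesis
    by (intro that[of R]) (auto simp: R_def)
qed

lemma test_function_continuous:
  assumes "test_function \<phi> \<phi>'"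
  shows "continuous_on UNIV \<phi>" "continuous_on UNIV \<phi>'"
  using assms unfolding test_function_def
  by (auto intro: DERIV_continuous_on[of UNIV \<phi> \<phi>'])

lemma L2_fun_compact_support:
  fixes u :: "real \<Rightarrow> complex"
  assumes cont: "continuous_on UNIV u" and R: "\<And>x. \<bar>x\<bar> > R \<Longrightarrow> u x = 0"
  shows "L2_fun u"
proof -
  have "integrable lborel (\<lambda>x. indicator {- R .. R} x *\<^sub>R (cmod (u x))^2)"
    by (intro borel_integrable_compact continuous_intros continuous_on_subset[OF cont]) auto
  also have "(\<lambda>x. indicator {- R .. R} x *\<^sub>R (cmod (u x))^2) = (\<lambda>x. (cmod (u x))^2)"
  proof
    fix x show "indicator {- R .. R} x *\<^sub>R (cmod (u x))^2 = (cmod (u x))^2"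
      using R[of x] by (cases "\<bar>x\<bar> > R") (auto simp: indicator_def)
  qed
  finally show ?thesis
    using borel_measurable_continuous_onI[OF cont] by (simp add: L2_fun_def)
qed

lemma L2_fun_test_function:
  assumes "test_function \<phi> \<phi>'"
  shows "L2_fun (\<lambda>x. of_real (\<phi> x))" "L2_fun (\<lambda>x. of_real (\<phi>' x))"
proof -
  obtain R where "\<And>x. \<bar>x\<bar> > R \<Longrightarrow> \<phi> x = 0" "\<And>x. \<bar>x\<bar> > R \<Longrightarrow> \<phi>' x = 0"
    using test_function_derivative_zero[OF assms] by metis
  then show "L2_fun (\<lambda>x. of_real (\<phi> x))" "L2_fun (\<lambda>x. of_real (\<phi>' x))"
    by (auto intro!: L2_fun_compact_support[of _ R] continuous_intros test_function_continuous[OF assms])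
qed

text \<open>The scalar counterpart of \<^const>\<open>has_weak_derivative\<close>, on functions instead of equivalence classes.\<close>

definition weak_deriv :: "(real \<Rightarrow> complex) \<Rightarrow> (real \<Rightarrow> complex) \<Rightarrow> bool" where
  "weak_deriv u u' \<longleftrightarrow> L2_fun u \<and> L2_fun u' \<and>
     (\<forall>\<phi> \<phi>'. test_function \<phi> \<phi>' \<longrightarrow>
        (LBINT x. \<phi>' x *\<^sub>R u x) = - (LBINT x. \<phi> x *\<^sub>R u' x))"

lemma integrable_test_function:
  assumes "test_function \<phi> \<phi>'" "L2_fun u"
  shows "integrable lborel (\<lambda>x. \<phi> x *\<^sub>R u x)" "integrable lborel (\<lambda>x. \<phi>' x *\<^sub>R u x)"
  using L2_fun_integrable_mult[OF L2_fun_test_function(1)[OF assms(1)] assms(2)]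
    L2_fun_integrable_mult[OF L2_fun_test_function(2)[OF assms(1)] assms(2)]
  by (simp_all add: scaleR_conv_of_real)

lemma weak_deriv_add:
  "weak_deriv u u' \<Longrightarrow> weak_deriv v v' \<Longrightarrow> weak_deriv (\<lambda>x. u x + v x) (\<lambda>x. u' x + v' x)"
  by (simp add: weak_deriv_def L2_fun_add integrable_test_function scaleR_add_right)

lemma weak_deriv_cmult: "weak_deriv u u' \<Longrightarrow> weak_deriv (\<lambda>x. c * u x) (\<lambda>x. c * u' x)"
  by (simp add: weak_deriv_def L2_fun_cmult flip: mult_scaleR_right)

lemma weak_deriv_minus: "weak_deriv u u' \<Longrightarrow> weak_deriv (\<lambda>x. - u x) (\<lambda>x. - u' x)"
  using weak_deriv_cmult[of u u' "-1"] by simp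

lemma weak_deriv_diff:
  "weak_deriv u u' \<Longrightarrow> weak_deriv v v' \<Longrightarrow> weak_deriv (\<lambda>x. u x - v x) (\<lambda>x. u' x - v' x)"
  using weak_deriv_add[OF _ weak_deriv_minus, of u u' v v'] by simp

lemma test_function_reflect:
  assumes "test_function \<phi> \<phi>'"
  shows "test_function (\<lambda>x. \<phi> (- x)) (\<lambda>x. - \<phi>' (- x))"
proof -
  have "((\<lambda>x. \<phi> (- x)) has_real_derivative - \<phi>' (- x)) (at x)" for x
  proof -
    have "(\<phi> has_real_derivative \<phi>' (- x)) (at (- x))"
      using assms by (simp add: test_function_def)
    then show ?thesis by (simp add: DERIV_mirror)
  qed
  moreover have "continuous_on UNIV (\<lambda>x. - \<phi>' (- x))"
    by (intro continuous_intros continuous_on_compose2[OF test_function_continuous(2)[OF assms]]) auto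
  ultimately show ?thesis
    using assms unfolding test_function_def by (metis abs_minus)
qed

lemma weak_deriv_reflect:
  assumes "weak_deriv u u'"
  shows "weak_deriv (\<lambda>x. u (- x)) (\<lambda>x. - u' (- x))"
  unfolding weak_deriv_def
proof (intro conjI allI impI)
  show "L2_fun (\<lambda>x. u (- x))" "L2_fun (\<lambda>x. - u' (- x))"
    using assms by (auto simp: weak_deriv_def intro: L2_fun_reflect L2_fun_minus)
  fix \<phi> \<phi>' assume "test_function \<phi> \<phi>'"
  from test_function_reflect[OF this] assms
  have "(LBINT x. - \<phi>' (- x) *\<^sub>R u x) = - (LBINT x. \<phi> (- x) *\<^sub>R u' x)"
    unfolding weak_deriv_def by blast
  then show "(LBINT x. \<phi>' x *\<^sub>R u (- x)) = - (LBINT x. \<phi> x *\<^sub>R - u' (- x))"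
    using integral_reflect[of "\<lambda>x. \<phi>' (- x) *\<^sub>R u x"] integral_reflect[of "\<lambda>x. \<phi> (- x) *\<^sub>R u' x"]
    by simp
qed

text \<open>The integrand is the derivative of \<open>y \<mapsto> - exp (- \<theta> (y - x)) \<phi> y\<close>, and the boundary term at the right
  end vanishes since \<open>\<phi>\<close> has compact support.\<close>

lemma bwd_test_function:
  assumes t: "test_function \<phi> \<phi>'" and \<theta>: "Re \<theta> > 0"
  shows "bwd \<theta> (\<lambda>y. \<theta> * of_real (\<phi> y) - of_real (\<phi>' y)) x = of_real (\<phi> x)"
proof -
  obtain R where R: "R > 0" "\<And>x. \<bar>x\<bar> > R \<Longrightarrow> \<phi> x = 0" "\<And>x. \<bar>x\<bar> > R \<Longrightarrow> \<phi>' x = 0"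
    using test_function_derivative_zero[OF t] by metis
  define b where "b = max R \<bar>x\<bar> + 1"
  define D where "D y = exp (- \<theta> * of_real (y - x)) * (\<theta> * of_real (\<phi> y) - of_real (\<phi>' y))" for y
  have b: "x \<le> b" "\<phi> b = 0" "\<And>y. y > b \<Longrightarrow> \<phi> y = 0 \<and> \<phi>' y = 0"
    using R by (auto simp: b_def)
  have der: "((\<lambda>y. - (exp (- \<theta> * of_real (y - x)) * of_real (\<phi> y))) has_vector_derivative D y) (at y within {x..b})" for y
  proof -
    have "(\<phi> has_real_derivative \<phi>' y) (at y)"
      using t by (simp add: test_function_def)
    then have p: "((\<lambda>y. complex_of_real (\<phi> y)) has_vector_derivative of_real (\<phi>' y)) (at y)"
      by (intro has_vector_derivative_of_real) (simp add: has_real_derivative_iff_has_vector_derivative)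
    have e: "((\<lambda>y. exp (- \<theta> * of_real (y - x))) has_vector_derivative (- \<theta> * exp (- \<theta> * of_real (y - x)))) (at y)"
    proof -
      have "((\<lambda>w. exp (- \<theta> * (w - of_real x))) has_field_derivative (- \<theta> * exp (- \<theta> * (of_real y - of_real x)))) (at (of_real y))"
        by (auto intro!: derivative_eq_intros)
      from has_vector_derivative_real_field[OF this] show ?thesis
        by simp
    qed
    have "((\<lambda>y. - (exp (- \<theta> * of_real (y - x)) * of_real (\<phi> y))) has_vector_derivative
        - (exp (- \<theta> * of_real (y - x)) * of_real (\<phi>' y) + - \<theta> * exp (- \<theta> * of_real (y - x)) * of_real (\<phi> y))) (at y)"
      by (intro has_vector_derivative_minus has_vector_derivative_mult e p)
    moreover have "E * (\<theta> * a - b) = - (E * b + - \<theta> * E * a)" for E a b :: complex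
      by (simp add: algebra_simps)
    then have "D y = - (exp (- \<theta> * of_real (y - x)) * of_real (\<phi>' y) + - \<theta> * exp (- \<theta> * of_real (y - x)) * of_real (\<phi> y))"
      unfolding D_def by blast
    ultimately show ?thesis
      by (simp only: has_vector_derivative_at_within)
  qed
  have cont: "continuous_on {x..b} D"
  proof -
    have "continuous_on {x..b} \<phi>" "continuous_on {x..b} \<phi>'"
      using test_function_continuous[OF t] by (auto intro: continuous_on_subset)
    then show ?thesis
      unfolding D_def by (intro continuous_intros)
  qed
  have "bwd \<theta> (\<lambda>y. \<theta> * of_real (\<phi> y) - of_real (\<phi>' y)) x = (LBINT y. indicator {x..b} y *\<^sub>R D y)"
    unfolding bwd_def
  proof (rule Bochner_Integration.integral_cong[OF refl])
    fix y
    consider "y < x" | "y > b" | "x \<le> y" "y \<le> b" by linarith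
    then show "decay \<theta> (y - x) * (\<theta> * of_real (\<phi> y) - of_real (\<phi>' y)) = indicator {x..b} y *\<^sub>R D y"
    proof cases
      case 3
      then have "indicator {x..b} y = (1::real)" "decay \<theta> (y - x) = exp (- \<theta> * of_real (y - x))"
        by (simp_all add: decay_def)
      then show ?thesis by (simp only: D_def scaleR_one)
    qed (use b(3) in \<open>simp_all add: decay_def\<close>)
  qed
  also have "\<dots> = - (exp (- \<theta> * of_real (b - x)) * of_real (\<phi> b)) - (- (exp (- \<theta> * of_real (x - x)) * of_real (\<phi> x)))"
    by (rule integral_FTC_Icc[OF b(1) der cont])
  also have "\<dots> = of_real (\<phi> x)"
    using b by simp
  finally show ?thesis .
qed

lemma bwd_diff_cmult:
  assumes "Re \<theta> > 0" "L2_fun g" "L2_fun h"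
  shows "bwd \<theta> (\<lambda>y. c * g y - h y) x = c * bwd \<theta> g x - bwd \<theta> h x"
proof -
  have "integrable lborel (\<lambda>y. c * (decay \<theta> (y - x) * g y))"
    using integrable_decay_mult(2)[OF assms(1,2)] by simp
  then show ?thesis
    unfolding bwd_def using integrable_decay_mult(2)[OF assms(1,3)]
    by (simp add: right_diff_distrib mult.left_commute[of _ c])
qed

text \<open>By adjointness the derivative passes to the test function, and \<open>bwd \<theta> \<phi>' = \<theta> * bwd \<theta> \<phi> - \<phi>\<close>.\<close>

lemma weak_deriv_fwd:
  assumes \<theta>: "Re \<theta> > 0" and g: "L2_fun g"
  shows "weak_deriv (fwd \<theta> g) (\<lambda>x. g x - \<theta> * fwd \<theta> g x)"
  unfolding weak_deriv_def
proof (intro conjI allI impI)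
  show f: "L2_fun (fwd \<theta> g)" by (rule fwd_L2[OF \<theta> g])
  then show d: "L2_fun (\<lambda>x. g x - \<theta> * fwd \<theta> g x)"
    by (intro L2_fun_diff L2_fun_cmult g)
  fix \<phi> \<phi>' assume t: "test_function \<phi> \<phi>'"
  let ?\<phi> = "\<lambda>x. complex_of_real (\<phi> x)" and ?\<phi>' = "\<lambda>x. complex_of_real (\<phi>' x)"
  note L = L2_fun_test_function[OF t]
  have b: "bwd \<theta> ?\<phi>' x = \<theta> * bwd \<theta> ?\<phi> x - ?\<phi> x" for x
    using bwd_test_function[OF t \<theta>, of x] bwd_diff_cmult[OF \<theta> L, of \<theta> x] by (simp add: algebra_simps)
  have ints: "integrable lborel (\<lambda>x. g x * bwd \<theta> ?\<phi> x)" "integrable lborel (\<lambda>x. g x * ?\<phi> x)"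
    "integrable lborel (\<lambda>x. fwd \<theta> g x * ?\<phi> x)"
    using g f L bwd_L2[OF \<theta> L(1)] by (auto intro: L2_fun_integrable_mult)
  have "(LBINT x. \<phi>' x *\<^sub>R fwd \<theta> g x) = (LBINT x. fwd \<theta> g x * ?\<phi>' x)"
    by (simp add: scaleR_conv_of_real mult.commute)
  also have "\<dots> = (LBINT x. g x * bwd \<theta> ?\<phi>' x)"
    by (rule fwd_bwd_adjoint[OF \<theta> g L(2)])
  also have "\<dots> = (LBINT x. \<theta> * (g x * bwd \<theta> ?\<phi> x) - g x * ?\<phi> x)"
    by (intro Bochner_Integration.integral_cong) (auto simp: b algebra_simps)
  also have "\<dots> = \<theta> * (LBINT x. fwd \<theta> g x * ?\<phi> x) - (LBINT x. g x * ?\<phi> x)"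
    using ints fwd_bwd_adjoint[OF \<theta> g L(1)] by simp
  also have "\<dots> = - (LBINT x. \<phi> x *\<^sub>R (g x - \<theta> * fwd \<theta> g x))"
  proof -
    have "(\<lambda>x. \<phi> x *\<^sub>R (g x - \<theta> * fwd \<theta> g x)) = (\<lambda>x. g x * ?\<phi> x - \<theta> * (fwd \<theta> g x * ?\<phi> x))"
      by (auto simp: scaleR_conv_of_real algebra_simps)
    then show ?thesis using ints by simp
  qed
  finally show "(LBINT x. \<phi>' x *\<^sub>R fwd \<theta> g x) = - (LBINT x. \<phi> x *\<^sub>R (g x - \<theta> * fwd \<theta> g x))" .
qed

lemma weak_deriv_bwd:
  assumes \<theta>: "Re \<theta> > 0" and g: "L2_fun g"
  shows "weak_deriv (bwd \<theta> g) (\<lambda>x. \<theta> * bwd \<theta> g x - g x)"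
  using weak_deriv_reflect[OF weak_deriv_fwd[OF \<theta> L2_fun_reflect[OF g]]]
  by (simp add: bwd_eq_fwd [abs_def])

text \<open>The square of the positive part is continuously differentiable, which makes it a convenient source
  of test functions with prescribed support.\<close>

lemma DERIV_positive_part_square:
  "((\<lambda>t::real. (max 0 t)^2) has_real_derivative 2 * max 0 t) (at t)"
proof -
  consider "t > 0" | "t < 0" | "t = 0" by linarith
  then show ?thesis
  proof cases
    case 1
    have ev: "\<forall>\<^sub>F y in nhds t. (max 0 y)^2 = y^2"
      using eventually_nhds_in_open[of "{0<..}" t] 1 by (auto elim!: eventually_mono)
    have "((\<lambda>t::real. t^2) has_real_derivative 2 * t) (at t)"
      by (auto intro!: derivative_eq_intros)
    with 1 show ?thesis
      using DERIV_cong_ev[OF refl ev refl] by simp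
  next
    case 2
    have ev: "\<forall>\<^sub>F y in nhds t. (max 0 y)^2 = 0"
      using eventually_nhds_in_open[of "{..<0}" t] 2 by (auto elim!: eventually_mono)
    from 2 show ?thesis
      using DERIV_cong_ev[OF refl ev refl] by simp
  next
    case 3
    have "((\<lambda>h. ((max 0 (0 + h))^2 - (max 0 (0::real))^2) / h) \<longlongrightarrow> 0) (at 0)"
    proof (rule Lim_null_comparison)
      show "\<forall>\<^sub>F h in at (0::real). norm (((max 0 (0 + h))^2 - (max 0 0)^2) / h) \<le> \<bar>h\<bar>"
        by (rule always_eventually) (auto simp: max_def power2_eq_square)
      show "((\<lambda>h::real. \<bar>h\<bar>) \<longlongrightarrow> 0) (at 0)"
        by (rule tendsto_rabs_zero) (rule tendsto_ident_at)
    qed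
    with 3 show ?thesis
      by (simp add: DERIV_def)
  qed
qed

text \<open>As \<open>c\<close> tends to \<open>\<infinity>\<close>, these test functions increase to the indicator function of the interval
  from \<open>a\<close> to \<open>b\<close>.\<close>

lemma test_function_interval:
  fixes a b c :: real
  assumes "a < b" "c \<ge> 0"
  defines "q \<equiv> \<lambda>x. (max 0 ((x - a) * (b - x)))^2"
  obtains \<phi>' where "test_function (\<lambda>x. c * q x / (1 + c * q x)) \<phi>'"
proof -
  define q' where "q' x = 2 * max 0 ((x - a) * (b - x)) * (a + b - 2 * x)" for x
  have q: "(q has_real_derivative q' x) (at x)" for x
  proof -
    have "((\<lambda>x. (x - a) * (b - x)) has_real_derivative (a + b - 2 * x)) (at x)"
      by (auto intro!: derivative_eq_intros)
    from DERIV_chain2[OF DERIV_positive_part_square this] show ?thesis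
      unfolding q_def q'_def by simp
  qed
  have pos: "1 + c * q x > 0" for x
    using assms(2) by (simp add: q_def add_pos_nonneg)
  have "((\<lambda>x. c * q x / (1 + c * q x)) has_real_derivative c * q' x / (1 + c * q x)^2) (at x)" for x
    using pos[of x] by (auto intro!: derivative_eq_intros q simp: power2_eq_square field_simps)
  moreover have "continuous_on UNIV (\<lambda>x. c * q' x / (1 + c * q x)^2)"
  proof -
    have "(1 + c * q x)^2 \<noteq> 0" for x using pos[of x] by simp
    then show ?thesis
      unfolding q'_def q_def by (intro continuous_intros ballI) auto
  qed
  moreover have "q x = 0" if "\<bar>x\<bar> > max \<bar>a\<bar> \<bar>b\<bar>" for x
  proof -
    have "x < a \<or> x > b" using that by auto
    then have "(x - a) * (b - x) \<le> 0"
      using assms(1) by (auto simp: mult_le_0_iff)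
    then show ?thesis by (simp add: q_def)
  qed
  ultimately have "test_function (\<lambda>x. c * q x / (1 + c * q x)) (\<lambda>x. c * q' x / (1 + c * q x)^2)"
    unfolding test_function_def by (intro conjI allI exI[of _ "max \<bar>a\<bar> \<bar>b\<bar>"]) auto
  then show ?thesis by (rule that)
qed

lemma L2_fun_indicator:
  fixes a b :: real
  shows "L2_fun (\<lambda>x. indicator {a..b} x)"
proof -
  have "(\<lambda>x. (cmod (indicator {a..b} x))^2) = (\<lambda>x. indicator {a..b} x)"
    by (auto simp: indicator_def)
  then show ?thesis by (simp add: L2_fun_def emeasure_lborel_Icc_eq)
qed

lemma L2_fun_cut:
  assumes "L2_fun u" and [measurable]: "A \<in> sets borel"
  shows "L2_fun (\<lambda>x. indicator A x * u x)"
  using assms(1) by (rule L2_fun_dominated[of u _ 1]) (use assms in \<open>auto simp: L2_fun_def indicator_def norm_mult\<close>)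

text \<open>Approximating indicator functions by test functions shows that all integrals of \<open>u\<close> over bounded
  intervals vanish. Almost every value of \<open>u\<close> is a limit of mean values over shrinking intervals.\<close>

lemma fundamental_lemma:
  assumes u: "L2_fun u"
    and zero: "\<And>\<phi> \<phi>'. test_function \<phi> \<phi>' \<Longrightarrow> (LBINT x. \<phi> x *\<^sub>R u x) = 0"
  shows "AE x in lborel. u x = 0"
proof -
  have [measurable]: "u \<in> borel_measurable borel"
    using u by (simp add: L2_fun_def)
  have loc: "integrable lborel (\<lambda>x. indicator {a..b} x *\<^sub>R u x)" for a b
    using L2_fun_integrable_mult[OF L2_fun_indicator u, of a b]
    by (rule Bochner_Integration.integrable_cong[THEN iffD1, rotated 2]) (auto simp: indicator_def)
  have I0: "(LBINT x. indicator {a..b} x *\<^sub>R u x) = 0" if ab: "a < b" for a b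
  proof -
    define q where "q x = (max 0 ((x - a) * (b - x)))^2" for x
    define \<phi> where "\<phi> n x = real n * q x / (1 + real n * q x)" for n x
    have q0: "q x \<ge> 0" for x by (simp add: q_def)
    have out: "q x = 0 \<longleftrightarrow> x \<notin> {a<..<b}" for x
    proof -
      have "q x = 0 \<longleftrightarrow> \<not> 0 < (x - a) * (b - x)"
        by (auto simp: q_def max_def)
      also have "\<dots> \<longleftrightarrow> x \<notin> {a<..<b}"
        using ab by (auto simp: zero_less_mult_iff)
      finally show ?thesis .
    qed
    have "(\<lambda>n. LBINT x. \<phi> n x *\<^sub>R u x) \<longlonglongrightarrow> (LBINT x. indicator {a<..<b} x *\<^sub>R u x)"
    proof (rule integral_dominated_convergence)
      show "integrable lborel (\<lambda>x. norm (indicator {a..b} x *\<^sub>R u x))"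
        by (rule integrable_norm[OF loc])
      show "(\<lambda>x. \<phi> n x *\<^sub>R u x) \<in> borel_measurable lborel" for n
        unfolding \<phi>_def q_def by measurable
      show "AE x in lborel. (\<lambda>n. \<phi> n x *\<^sub>R u x) \<longlonglongrightarrow> indicator {a<..<b} x *\<^sub>R u x"
      proof (intro AE_I2 tendsto_scaleR tendsto_const)
        fix x
        show "(\<lambda>n. \<phi> n x) \<longlonglongrightarrow> indicator {a<..<b} x"
        proof (cases "q x = 0")
          case True
          then show ?thesis using out[of x] by (auto simp: \<phi>_def)
        next
          case False
          then have "q x > 0" using q0[of x] by simp
          then have "(\<lambda>n. \<phi> n x) \<longlonglongrightarrow> 1"
          proof -
            assume pos: "q x > 0"
            have "(\<lambda>n. 1 - inverse (1 + real n * q x)) \<longlonglongrightarrow> 1 - 0"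
              by (intro tendsto_diff tendsto_const tendsto_inverse_0_at_top
                  filterlim_tendsto_add_at_top[OF tendsto_const]
                  filterlim_at_top_mult_tendsto_pos[OF tendsto_const pos] filterlim_real_sequentially)
            moreover have "\<phi> n x = 1 - inverse (1 + real n * q x)" for n
            proof -
              have "1 + real n * q x \<noteq> 0" using pos by (smt (verit) mult_nonneg_nonneg of_nat_0_le_iff)
              then show ?thesis by (simp add: \<phi>_def field_simps)
            qed
            ultimately show ?thesis by simp
          qed
          then show ?thesis using False out[of x] by auto
        qed
      qed
      show "AE x in lborel. norm (\<phi> n x *\<^sub>R u x) \<le> norm (indicator {a..b} x *\<^sub>R u x)" for n
      proof (rule AE_I2)
        fix x
        have "\<bar>\<phi> n x\<bar> \<le> 1"
          using q0[of x] by (auto simp: \<phi>_def abs_le_iff divide_le_eq_1 intro: add_pos_nonneg)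
        then show "norm (\<phi> n x *\<^sub>R u x) \<le> norm (indicator {a..b} x *\<^sub>R u x)"
          using out[of x] mult_right_mono[of "\<bar>\<phi> n x\<bar>" 1 "cmod (u x)"]
          by (cases "q x = 0") (auto simp: \<phi>_def)
      qed
    qed measurable
    moreover have "(LBINT x. \<phi> n x *\<^sub>R u x) = 0" for n
    proof -
      obtain \<phi>' where "test_function (\<lambda>x. real n * (max 0 ((x - a) * (b - x)))^2
          / (1 + real n * (max 0 ((x - a) * (b - x)))^2)) \<phi>'"
        by (rule test_function_interval[OF ab, of "real n"]) auto
      from zero[OF this] show ?thesis
        unfolding \<phi>_def q_def .
    qed
    ultimately have "(LBINT x. indicator {a<..<b} x *\<^sub>R u x) = 0"
      using LIMSEQ_unique[OF _ tendsto_const[of 0]] by simp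
    also have "(LBINT x. indicator {a<..<b} x *\<^sub>R u x) = (LBINT x. indicator {a..b} x *\<^sub>R u x)"
    proof (rule integral_cong_AE)
      show "AE x in lborel. indicator {a<..<b} x *\<^sub>R u x = indicator {a..b} x *\<^sub>R u x"
        using AE_lborel_singleton[of a] AE_lborel_singleton[of b]
        by eventually_elim (auto simp: indicator_def)
    qed measurable
    finally show ?thesis .
  qed
  have HK: "u integrable_on {a..b}" "integral {a..b} u = (LBINT x. indicator {a..b} x *\<^sub>R u x)" for a b
    using set_borel_integral_eq_integral[of "{a..b}" u] loc
    by (auto simp: set_integrable_def set_lebesgue_integral_def)
  obtain N where N: "negligible N"
    "\<And>x e. \<lbrakk>x \<notin> N; 0 < e\<rbrakk> \<Longrightarrow>
       \<exists>d>0. \<forall>h. 0 < h \<and> h < d \<longrightarrow> norm (integral (cbox x (x + h *\<^sub>R One)) u /\<^sub>R h ^ DIM(real) - u x) < e"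
    using integrable_ccontinuous_explicit[of u] HK(1) by (metis cbox_interval)
  have "u x = 0" if x: "x \<notin> N" for x
  proof (rule ccontr)
    assume "u x \<noteq> 0"
    then obtain d where d: "d > 0"
      "\<And>h. 0 < h \<Longrightarrow> h < d \<Longrightarrow> norm (integral (cbox x (x + h *\<^sub>R One)) u /\<^sub>R h ^ DIM(real) - u x) < norm (u x)"
      using N(2)[OF x, of "norm (u x)"] by auto
    have "integral {x..x + d / 2} u = 0"
      using HK(2) I0 d(1) by simp
    with d(2)[of "d / 2"] d(1) show False
      by simp
  qed
  moreover obtain N' where "N' \<in> null_sets lborel" "N \<subseteq> N'"
    using N(1) by (auto simp: negligible_iff_null_sets null_sets_completion_iff2)
  ultimately show ?thesis
    by (intro AE_I'[of N']) auto
qed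


section \<open>Square-integrable functions with square-integrable derivative\<close>

text \<open>Formally \<open>u\<close> is a multiple of \<open>exp (- x)\<close>, which is not square-integrable at \<open>-\<infinity>\<close>. The proof tests with
  \<open>\<eta> x = exp x * (F x - F (x + n))\<close>, where \<open>F' x = exp (- x) * \<psi> x\<close>: the equation for \<open>u\<close> turns the
  integral of \<open>\<psi> * u\<close> into \<open>exp (- n)\<close> times the integral against \<open>\<psi>\<close> shifted by \<open>n\<close> to the left, and the
  latter remains bounded as \<open>n\<close> tends to \<open>\<infinity>\<close>.\<close>

lemma weak_deriv_negative_self:
  assumes w: "weak_deriv u (\<lambda>x. - u x)"
  shows "AE x in lborel. u x = 0"
proof (rule fundamental_lemma)
  show u: "L2_fun u" using w by (simp add: weak_deriv_def)
  fix \<psi> \<psi>' assume t: "test_function \<psi> \<psi>'"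
  define I where "I = (LBINT x. \<psi> x *\<^sub>R u x)"
  define C where "C = (LBINT x. (cmod (of_real (\<psi> x)))^2) + (LBINT x. (cmod (u x))^2)"
  obtain R where R: "R > 0" "\<And>x. \<bar>x\<bar> > R \<Longrightarrow> \<psi> x = 0"
    using test_function_derivative_zero[OF t] by metis
  define a where "a x = exp (- x) * \<psi> x" for x
  have a_cont: "continuous_on UNIV a"
    unfolding a_def by (intro continuous_intros test_function_continuous(1)[OF t])
  then obtain F where F: "\<And>x. (F has_real_derivative a x) (at x)"
    using einterval_antiderivative[of "-\<infinity>" "\<infinity>" a]
    by (auto simp: continuous_on_eq_continuous_at has_real_derivative_iff_has_vector_derivative)
  have a0: "a x = 0" if "\<bar>x\<bar> > R" for x using R(2)[OF that] by (simp add: a_def)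
  have const_right: "F x = F y" if "R < x" "x < y" for x y
    using DERIV_isconst_end[of x y F] that a0 F
    by (metis DERIV_isCont continuous_at_imp_continuous_on abs_of_pos less_trans R(1))
  have const_left: "F x = F y" if "y < - R" "x < y" for x y
    using DERIV_isconst_end[of x y F] that a0 F
    by (smt (verit) DERIV_isCont continuous_at_imp_continuous_on)
  have shift: "I = exp (- n) *\<^sub>R (LBINT x. \<psi> (x + n) *\<^sub>R u x)" and
    shift_int: "integrable lborel (\<lambda>x. \<psi> (x + n) *\<^sub>R u x)" if n: "n > 0" for n :: real
  proof -
    define \<eta> where "\<eta> x = exp x * (F x - F (x + n))" for x
    define \<eta>' where "\<eta>' x = \<eta> x + \<psi> x - exp (- n) * \<psi> (x + n)" for x
    have "(\<eta> has_real_derivative \<eta>' x) (at x)" for x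
    proof -
      have "((\<lambda>x. F (x + n)) has_real_derivative a (x + n)) (at x)"
        using DERIV_shift[of F "a (x + n)" x n] F by simp
      then have "(\<eta> has_real_derivative exp x * (F x - F (x + n)) + (a x - a (x + n)) * exp x) (at x)"
        unfolding \<eta>_def by (intro DERIV_mult DERIV_diff F DERIV_exp)
      moreover have "exp (- x) * exp x = 1" "exp (- (x + n)) * exp x = exp (- n)"
        by (simp_all flip: exp_add)
      then have "(a x - a (x + n)) * exp x = \<psi> x - exp (- n) * \<psi> (x + n)"
        unfolding a_def by (metis (no_types, opaque_lifting) left_diff_distrib mult.assoc mult.commute mult_1)
      ultimately show ?thesis by (simp add: \<eta>'_def \<eta>_def add_diff_eq)
    qed
    moreover have "continuous_on UNIV \<eta>'"
    proof -
      have "continuous_on UNIV F"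
        using F DERIV_isCont by (blast intro: continuous_at_imp_continuous_on)
      moreover note test_function_continuous(1)[OF t]
      ultimately have "continuous_on UNIV (\<lambda>x. F (x + n))" "continuous_on UNIV (\<lambda>x. \<psi> (x + n))" "continuous_on UNIV F"
        "continuous_on UNIV \<psi>"
        by (auto intro!: continuous_on_compose2[of UNIV _ UNIV "\<lambda>x. x + n"] continuous_intros)
      then show ?thesis
        unfolding \<eta>'_def \<eta>_def by (intro continuous_intros)
    qed
    moreover have "\<eta> x = 0" if "\<bar>x\<bar> > R + n" for x
    proof (cases "x > 0")
      case True
      with that n const_right[of x "x + n"] show ?thesis by (simp add: \<eta>_def)
    next
      case False
      with that n const_left[of "x + n" x] show ?thesis by (simp add: \<eta>_def)
    qed
    ultimately have t\<eta>: "test_function \<eta> \<eta>'"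
      unfolding test_function_def by blast
    note ints = integrable_test_function[OF t\<eta> u] integrable_test_function(1)[OF t u]
    have "(\<lambda>x. \<psi> (x + n) *\<^sub>R u x) = (\<lambda>x. exp n *\<^sub>R (\<eta> x *\<^sub>R u x + \<psi> x *\<^sub>R u x - \<eta>' x *\<^sub>R u x))"
    proof
      fix x
      have "\<psi> (x + n) = exp n * (\<eta> x + \<psi> x - \<eta>' x)"
        by (simp add: \<eta>'_def exp_minus)
      then show "\<psi> (x + n) *\<^sub>R u x = exp n *\<^sub>R (\<eta> x *\<^sub>R u x + \<psi> x *\<^sub>R u x - \<eta>' x *\<^sub>R u x)"
        by (simp only: scaleR_scaleR scaleR_left_distrib[symmetric] scaleR_left_diff_distrib[symmetric])
    qed
    with ints show "integrable lborel (\<lambda>x. \<psi> (x + n) *\<^sub>R u x)"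
      by simp
    have "(LBINT x. \<eta>' x *\<^sub>R u x) = (LBINT x. \<eta> x *\<^sub>R u x)"
      using w t\<eta> by (simp add: weak_deriv_def)
    with ints \<open>(\<lambda>x. \<psi> (x + n) *\<^sub>R u x) = _\<close>
    show "I = exp (- n) *\<^sub>R (LBINT x. \<psi> (x + n) *\<^sub>R u x)"
      by (simp add: I_def exp_minus)
  qed
  \<comment> \<open>\<open>C\<close> bounds the integral with the shifted \<open>\<psi>\<close>, because \<open>2 a b \<le> a^2 + b^2\<close> and shifting preserves integrals.\<close>
  have bound: "norm I \<le> exp (- n) * C" if n: "n > 0" for n :: real
  proof -
    have si: "integrable lborel (\<lambda>x. (cmod (of_real (\<psi> (x + n))))^2)"
      "(LBINT x. (cmod (of_real (\<psi> (x + n))))^2) = (LBINT x. (cmod (of_real (\<psi> x)))^2)"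
      using lborel_integrable_real_affine[of "\<lambda>x. (cmod (of_real (\<psi> x)))^2" 1 n]
        lborel_integral_real_affine[of 1 "\<lambda>x. (cmod (of_real (\<psi> x)))^2" n] L2_fun_test_function(1)[OF t]
      by (simp_all add: L2_fun_def add.commute)
    have "norm (LBINT x. \<psi> (x + n) *\<^sub>R u x) \<le> (LBINT x. norm (\<psi> (x + n) *\<^sub>R u x))"
      by (rule integral_norm_bound)
    also have "\<dots> \<le> (LBINT x. (cmod (of_real (\<psi> (x + n))))^2 + (cmod (u x))^2)"
    proof (rule integral_mono)
      show "integrable lborel (\<lambda>x. norm (\<psi> (x + n) *\<^sub>R u x))"
        using shift_int[OF n] by (rule integrable_norm)
      show "integrable lborel (\<lambda>x. (cmod (of_real (\<psi> (x + n))))^2 + (cmod (u x))^2)"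
        using si u by (simp add: L2_fun_def)
      show "norm (\<psi> (x + n) *\<^sub>R u x) \<le> (cmod (of_real (\<psi> (x + n))))^2 + (cmod (u x))^2" for x
      proof -
        have "\<bar>\<psi> (x + n)\<bar> * cmod (u x) \<le> \<bar>\<psi> (x + n)\<bar>^2 + (cmod (u x))^2"
          using sum_squares_bound[of "\<bar>\<psi> (x + n)\<bar>" "cmod (u x)"]
            mult_nonneg_nonneg[OF abs_ge_zero[of "\<psi> (x + n)"] norm_ge_zero[of "u x"]] by linarith
        then show ?thesis by simp
      qed
    qed
    also have "\<dots> = C"
      using si u by (simp add: C_def L2_fun_def)
    finally show ?thesis
      by (subst shift[OF n]) (simp add: mult_left_mono)
  qed
  have "(\<lambda>k. exp (- real (Suc k)) * C) \<longlonglongrightarrow> 0 * C"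
    by (intro tendsto_mult tendsto_const filterlim_compose[OF exp_at_bot]
        filterlim_compose[OF filterlim_uminus_at_bot_at_top]
        filterlim_compose[OF filterlim_real_sequentially filterlim_Suc])
  then have "norm I \<le> 0 * C"
    by (rule LIMSEQ_le_const) (use bound[of "real (Suc k)" for k] in \<open>auto simp del: of_nat_Suc\<close>)
  then show "(LBINT x. \<psi> x *\<^sub>R u x) = 0"
    by (simp add: I_def)
qed

text \<open>The difference \<open>d\<close> of the two sides satisfies \<open>d' = - d\<close>.\<close>

lemma weak_deriv_eq_fwd:
  assumes w: "weak_deriv u u'"
  shows "AE x in lborel. u x = fwd 1 (\<lambda>x. u x + u' x) x"
proof -
  have g: "L2_fun (\<lambda>x. u x + u' x)"
    using w by (auto simp: weak_deriv_def intro: L2_fun_add)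
  have "weak_deriv (\<lambda>x. u x - fwd 1 (\<lambda>x. u x + u' x) x) (\<lambda>x. u' x - ((u x + u' x) - 1 * fwd 1 (\<lambda>x. u x + u' x) x))"
    by (intro weak_deriv_diff w weak_deriv_fwd g) simp
  then have "weak_deriv (\<lambda>x. u x - fwd 1 (\<lambda>x. u x + u' x) x) (\<lambda>x. - (u x - fwd 1 (\<lambda>x. u x + u' x) x))"
    by (simp add: algebra_simps)
  from weak_deriv_negative_self[OF this] show ?thesis
    by simp
qed

lemma weak_deriv_eq_bwd:
  assumes w: "weak_deriv u u'"
  shows "AE x in lborel. u x = bwd 1 (\<lambda>x. u x - u' x) x"
proof -
  have "AE x in lborel. u (- x) = fwd 1 (\<lambda>x. u (- x) + - u' (- x)) x"
    by (rule weak_deriv_eq_fwd[OF weak_deriv_reflect[OF w]])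
  then have "AE x in distr lborel borel uminus. u (- x) = fwd 1 (\<lambda>x. u (- x) + - u' (- x)) x"
    by (simp only: lborel_distr_uminus)
  then have "AE x in lborel. u (- (- x)) = fwd 1 (\<lambda>x. u (- x) + - u' (- x)) (- x)"
    by (rule AE_distrD[rotated]) simp
  then show ?thesis
    by (simp add: bwd_eq_fwd)
qed

text \<open>With \<open>g = u + u'\<close> and \<open>k = v - v'\<close> the claim is that \<open>u * k\<close> and \<open>g * v\<close> have the same integral, which
  is the adjointness of \<open>fwd 1\<close> and \<open>bwd 1\<close>.\<close>

theorem weak_deriv_parts:
  assumes u: "weak_deriv u u'" and v: "weak_deriv v v'"
  shows "(LBINT x. u' x * v x) = - (LBINT x. u x * v' x)"
proof -
  have L: "L2_fun u" "L2_fun u'" "L2_fun v" "L2_fun v'"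
    using u v by (auto simp: weak_deriv_def)
  define g where "g x = u x + u' x" for x
  define k where "k x = v x - v' x" for x
  have gk: "L2_fun g" "L2_fun k"
    unfolding g_def [abs_def] k_def [abs_def] by (intro L2_fun_add L2_fun_diff L)+
  have [measurable]: "g \<in> borel_measurable borel" "k \<in> borel_measurable borel"
    "u \<in> borel_measurable borel" "v \<in> borel_measurable borel"
    "fwd 1 g \<in> borel_measurable borel" "bwd 1 k \<in> borel_measurable borel"
    using L gk fwd_L2(1)[of 1 g] bwd_L2(1)[of 1 k] by (auto simp: L2_fun_def)
  have "AE x in lborel. u x = fwd 1 g x" "AE x in lborel. v x = bwd 1 k x"
    using weak_deriv_eq_fwd[OF u] weak_deriv_eq_bwd[OF v] by (simp_all add: g_def [abs_def] k_def [abs_def])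
  then have ae: "AE x in lborel. u x * k x = fwd 1 g x * k x" "AE x in lborel. g x * bwd 1 k x = g x * v x"
    by (eventually_elim, simp)+
  have "(LBINT x. u x * k x) = (LBINT x. fwd 1 g x * k x)"
    by (rule integral_cong_AE) (use ae in measurable)
  also have "\<dots> = (LBINT x. g x * bwd 1 k x)"
    by (rule fwd_bwd_adjoint) (use gk in auto)
  also have "\<dots> = (LBINT x. g x * v x)"
    by (rule integral_cong_AE) (use ae in measurable)
  finally have "(LBINT x. u x * v x - u x * v' x) = (LBINT x. u x * v x + u' x * v x)"
    by (simp add: g_def k_def algebra_simps)
  then show ?thesis
    using L2_fun_integrable_mult[OF L(1,3)] L2_fun_integrable_mult[OF L(1,4)] L2_fun_integrable_mult[OF L(2,3)]
    by simp
qed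

lemma weak_deriv_unique:
  assumes "weak_deriv u v" "weak_deriv u w"
  shows "AE x in lborel. v x = w x"
proof -
  have vw: "L2_fun (\<lambda>x. v x - w x)"
    using assms by (auto simp: weak_deriv_def intro: L2_fun_diff)
  have "AE x in lborel. v x - w x = 0"
  proof (rule fundamental_lemma[OF vw])
    fix \<phi> \<phi>' assume t: "test_function \<phi> \<phi>'"
    then have "(LBINT x. \<phi> x *\<^sub>R v x) = (LBINT x. \<phi> x *\<^sub>R w x)"
      using assms by (metis (no_types, lifting) weak_deriv_def neg_equal_iff_equal)
    then show "(LBINT x. \<phi> x *\<^sub>R (v x - w x)) = 0"
      using integrable_test_function(1)[OF t] assms by (simp add: weak_deriv_def scaleR_diff_right)
  qed
  then show ?thesis by simp
qed

section \<open>Solving the equation on the line\<close>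

lemma bwd_at_zero: "bwd \<theta> g 0 = (LBINT y. decay \<theta> y * g y)"
  by (simp add: bwd_def)

lemma fwd_at_zero: "fwd \<theta> g 0 = (LBINT y. decay \<theta> (- y) * g y)"
  by (simp add: fwd_def)

text \<open>The jump of \<open>decay \<theta>\<close> at \<open>0\<close> contributes a Dirac mass to its distributional derivative.\<close>

lemma integral_decay_test_function:
  assumes t: "test_function \<phi> \<phi>'" and \<theta>: "Re \<theta> > 0"
  shows "(LBINT x. \<phi>' x *\<^sub>R decay \<theta> x) = \<theta> * (LBINT x. \<phi> x *\<^sub>R decay \<theta> x) - of_real (\<phi> 0)"
    and "(LBINT x. \<phi>' x *\<^sub>R decay \<theta> (- x)) = of_real (\<phi> 0) - \<theta> * (LBINT x. \<phi> x *\<^sub>R decay \<theta> (- x))"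
proof -
  have *: "(LBINT x. \<psi>' x *\<^sub>R decay \<theta> x) = \<theta> * (LBINT x. \<psi> x *\<^sub>R decay \<theta> x) - of_real (\<psi> 0)"
    if t: "test_function \<psi> \<psi>'" for \<psi> \<psi>'
    using bwd_test_function[OF t \<theta>, of 0] bwd_diff_cmult[OF \<theta> L2_fun_test_function[OF t], of \<theta> 0]
    by (simp add: bwd_at_zero scaleR_conv_of_real mult.commute algebra_simps)
  show "(LBINT x. \<phi>' x *\<^sub>R decay \<theta> x) = \<theta> * (LBINT x. \<phi> x *\<^sub>R decay \<theta> x) - of_real (\<phi> 0)"
    by (rule *[OF t])
  show "(LBINT x. \<phi>' x *\<^sub>R decay \<theta> (- x)) = of_real (\<phi> 0) - \<theta> * (LBINT x. \<phi> x *\<^sub>R decay \<theta> (- x))"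
    using *[OF test_function_reflect[OF t]]
      integral_reflect[of "\<lambda>x. \<phi>' x *\<^sub>R decay \<theta> (- x)"] integral_reflect[of "\<lambda>x. \<phi> x *\<^sub>R decay \<theta> (- x)"]
    by (simp add: algebra_simps)
qed

text \<open>The matching condition is continuity at \<open>0\<close>: it cancels the Dirac masses.
  At the point \<open>0\<close> itself, a null set, the value of the function is the sum of both one-sided limits.\<close>

lemma weak_deriv_exponentials:
  assumes "Re \<alpha>\<^sub>1 > 0" "Re \<alpha>\<^sub>2 > 0" "Re \<beta>\<^sub>1 > 0" "Re \<beta>\<^sub>2 > 0" and match: "a\<^sub>1 + a\<^sub>2 = b\<^sub>1 + b\<^sub>2"
  shows "weak_deriv
    (\<lambda>x. a\<^sub>1 * decay \<alpha>\<^sub>1 x + a\<^sub>2 * decay \<alpha>\<^sub>2 x + (b\<^sub>1 * decay \<beta>\<^sub>1 (- x) + b\<^sub>2 * decay \<beta>\<^sub>2 (- x)))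
    (\<lambda>x. - \<alpha>\<^sub>1 * a\<^sub>1 * decay \<alpha>\<^sub>1 x + - \<alpha>\<^sub>2 * a\<^sub>2 * decay \<alpha>\<^sub>2 x + (\<beta>\<^sub>1 * b\<^sub>1 * decay \<beta>\<^sub>1 (- x) + \<beta>\<^sub>2 * b\<^sub>2 * decay \<beta>\<^sub>2 (- x)))"
proof -
  note L = L2_fun_decay[OF assms(1)] L2_fun_decay[OF assms(2)]
    L2_fun_reflect[OF L2_fun_decay[OF assms(3)]] L2_fun_reflect[OF L2_fun_decay[OF assms(4)]]
  show ?thesis
    unfolding weak_deriv_def
  proof (intro conjI allI impI)
    fix \<phi> \<phi>' assume t: "test_function \<phi> \<phi>'"
    let ?D = "\<lambda>k\<^sub>1 k\<^sub>2 k\<^sub>3 k\<^sub>4 x. k\<^sub>1 * decay \<alpha>\<^sub>1 x + k\<^sub>2 * decay \<alpha>\<^sub>2 x + (k\<^sub>3 * decay \<beta>\<^sub>1 (- x) + k\<^sub>4 * decay \<beta>\<^sub>2 (- x))"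
    note ints = integrable_test_function[OF t L(1)] integrable_test_function[OF t L(2)]
        integrable_test_function[OF t L(3)] integrable_test_function[OF t L(4)]
    have lin: "(LBINT x. \<phi> x *\<^sub>R ?D k\<^sub>1 k\<^sub>2 k\<^sub>3 k\<^sub>4 x)
        = k\<^sub>1 * (LBINT x. \<phi> x *\<^sub>R decay \<alpha>\<^sub>1 x) + k\<^sub>2 * (LBINT x. \<phi> x *\<^sub>R decay \<alpha>\<^sub>2 x)
        + (k\<^sub>3 * (LBINT x. \<phi> x *\<^sub>R decay \<beta>\<^sub>1 (- x)) + k\<^sub>4 * (LBINT x. \<phi> x *\<^sub>R decay \<beta>\<^sub>2 (- x)))"
      "(LBINT x. \<phi>' x *\<^sub>R ?D k\<^sub>1 k\<^sub>2 k\<^sub>3 k\<^sub>4 x)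
        = k\<^sub>1 * (LBINT x. \<phi>' x *\<^sub>R decay \<alpha>\<^sub>1 x) + k\<^sub>2 * (LBINT x. \<phi>' x *\<^sub>R decay \<alpha>\<^sub>2 x)
        + (k\<^sub>3 * (LBINT x. \<phi>' x *\<^sub>R decay \<beta>\<^sub>1 (- x)) + k\<^sub>4 * (LBINT x. \<phi>' x *\<^sub>R decay \<beta>\<^sub>2 (- x)))"
      for k\<^sub>1 k\<^sub>2 k\<^sub>3 k\<^sub>4
      using ints by (simp_all add: scaleR_add_right flip: mult_scaleR_right)
    note J = integral_decay_test_function[OF t]
    have b2: "b\<^sub>2 = a\<^sub>1 + a\<^sub>2 - b\<^sub>1" using match by simp
    show "(LBINT x. \<phi>' x *\<^sub>R ?D a\<^sub>1 a\<^sub>2 b\<^sub>1 b\<^sub>2 x)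
      = - (LBINT x. \<phi> x *\<^sub>R ?D (- \<alpha>\<^sub>1 * a\<^sub>1) (- \<alpha>\<^sub>2 * a\<^sub>2) (\<beta>\<^sub>1 * b\<^sub>1) (\<beta>\<^sub>2 * b\<^sub>2) x)"
      unfolding lin J(1)[OF assms(1)] J(1)[OF assms(2)] J(2)[OF assms(3)] J(2)[OF assms(4)] b2
      by (simp add: algebra_simps)
  qed (intro L2_fun_add L2_fun_cmult L)+
qed

lemma fwd_negative_support:
  assumes "\<And>y. y \<ge> 0 \<Longrightarrow> g y = 0" "x \<ge> 0"
  shows "fwd \<theta> g x = fwd \<theta> g 0 * decay \<theta> x"
proof -
  have "fwd \<theta> g x = (LBINT y. decay \<theta> x * (decay \<theta> (- y) * g y))"
    unfolding fwd_def
  proof (rule Bochner_Integration.integral_cong[OF refl])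
    fix y
    show "decay \<theta> (x - y) * g y = decay \<theta> x * (decay \<theta> (- y) * g y)"
    proof (cases "y \<ge> 0")
      case False
      have "exp (- \<theta> * of_real (x - y)) = exp (- \<theta> * of_real x) * exp (- \<theta> * of_real (- y))"
        unfolding exp_add[symmetric] by (simp add: algebra_simps)
      with False assms(2) show ?thesis by (simp add: decay_def)
    qed (simp add: assms)
  qed
  then show ?thesis by (simp add: fwd_at_zero)
qed

lemma fwd_positive_support:
  assumes "\<And>y. y \<le> 0 \<Longrightarrow> g y = 0" "x \<le> 0"
  shows "fwd \<theta> g x = 0"
proof -
  have "decay \<theta> (x - y) * g y = 0" for y
    using assms by (cases "y \<le> 0") (auto simp: decay_def)
  then have "(\<lambda>y. decay \<theta> (x - y) * g y) = (\<lambda>_. 0)" by blast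
  then show ?thesis by (simp add: fwd_def)
qed

lemma bwd_positive_support:
  assumes "\<And>y. y \<le> 0 \<Longrightarrow> g y = 0" "x \<le> 0"
  shows "bwd \<theta> g x = bwd \<theta> g 0 * decay \<theta> (- x)"
  using fwd_negative_support[of "\<lambda>y. g (- y)" "- x" \<theta>] assms by (simp add: bwd_eq_fwd)

lemma bwd_negative_support:
  assumes "\<And>y. y \<ge> 0 \<Longrightarrow> g y = 0" "x \<ge> 0"
  shows "bwd \<theta> g x = 0"
  using fwd_positive_support[of "\<lambda>y. g (- y)" "- x" \<theta>] assms by (simp add: bwd_eq_fwd)

text \<open>The components of the inhomogeneity \<open>(g2, - g1)\<close> along the modes \<open>exp (\<theta> x) (1, r)\<close> and
  \<open>exp (- \<theta> x) (1, - r)\<close>, restricted to \<open>A\<close>.\<close>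

definition growing_source :: "real set \<Rightarrow> complex \<Rightarrow> (real \<Rightarrow> complex) \<Rightarrow> (real \<Rightarrow> complex) \<Rightarrow> real \<Rightarrow> complex" where
  "growing_source A r g1 g2 y = indicator A y * ((g2 y - g1 y / r) / 2)"

definition decaying_source :: "real set \<Rightarrow> complex \<Rightarrow> (real \<Rightarrow> complex) \<Rightarrow> (real \<Rightarrow> complex) \<Rightarrow> real \<Rightarrow> complex" where
  "decaying_source A r g1 g2 y = indicator A y * ((g2 y + g1 y / r) / 2)"

lemma L2_fun_sources:
  assumes "L2_fun g1" "L2_fun g2" "A \<in> sets borel"
  shows "L2_fun (growing_source A r g1 g2)" "L2_fun (decaying_source A r g1 g2)"
proof -
  have "L2_fun (\<lambda>y. indicator A y * (1/2 * (g2 y - 1 / r * g1 y)))"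
    "L2_fun (\<lambda>y. indicator A y * (1/2 * (g2 y + 1 / r * g1 y)))"
    by (intro L2_fun_cut L2_fun_cmult L2_fun_add L2_fun_diff assms)+
  then show "L2_fun (growing_source A r g1 g2)" "L2_fun (decaying_source A r g1 g2)"
    by (simp_all add: growing_source_def [abs_def] decaying_source_def [abs_def])
qed

text \<open>The parallelogram law.\<close>

lemma source_squares:
  "(cmod (growing_source A r g1 g2 y))^2 + (cmod (decaying_source A r g1 g2 y))^2
     = indicator A y * ((cmod (g2 y))^2 + (cmod (g1 y / r))^2) / 2"
proof -
  have "(cmod ((g2 y - g1 y / r) / 2))^2 + (cmod ((g2 y + g1 y / r) / 2))^2
      = ((cmod (g2 y))^2 + (cmod (g1 y / r))^2) / 2"
    unfolding cmod_power2 by (simp add: power2_eq_square field_simps)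
  then show ?thesis
    by (simp add: growing_source_def decaying_source_def indicator_def)
qed

text \<open>On the right half-line, \<open>(f1, f2) = p (1, - rp) + q (1, rp)\<close> turns the system into
  \<open>p' = - \<theta>p p + Pp\<close> and \<open>q' = \<theta>p q + Qp\<close>, so that \<open>p x = A exp (- \<theta>p x) + fwd \<theta>p Pp x\<close> and
  \<open>q = - bwd \<theta>p Qp\<close>; on the left half-line \<open>p = fwd \<theta>n Pn\<close> and
  \<open>q x = B exp (\<theta>n x) - bwd \<theta>n Qn x\<close>. The formulas for \<open>A\<close> and \<open>B\<close> solve the two equations that express
  continuity at \<open>0\<close>.

  The parts \<open>h1\<close>, \<open>h2\<close> of the solution have norms controlled by Schur's test alone; the amplitudes \<open>A\<close> and
  \<open>B\<close> contain the small denominator \<open>rp + rn\<close>.\<close>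

lemma dirac_solution:
  fixes m wp wn \<theta>p \<theta>n rp rn :: complex
  assumes Re: "Re \<theta>p > 0" "Re \<theta>n > 0" and r: "rp \<noteq> 0" "rn \<noteq> 0" "rp + rn \<noteq> 0"
    and eqp: "rp * (m + wp) = \<theta>p" "m - wp = \<theta>p * rp"
    and eqn: "rn * (m + wn) = \<theta>n" "m - wn = \<theta>n * rn"
    and g: "L2_fun g1" "L2_fun g2"
    and Qp_def: "Qp = growing_source {0<..} rp g1 g2" and Pp_def: "Pp = decaying_source {0<..} rp g1 g2"
    and Qn_def: "Qn = growing_source {..<0} rn g1 g2" and Pn_def: "Pn = decaying_source {..<0} rn g1 g2"
    and c_def: "c = fwd \<theta>n Pn 0" and d_def: "d = bwd \<theta>p Qp 0"
    and A_def: "A = (2 * rn * c - (rp - rn) * d) / (rp + rn)"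
    and B_def: "B = ((rn - rp) * c - 2 * rp * d) / (rp + rn)"
    and h1_def: "\<And>x. h1 x = fwd \<theta>p Pp x - indicator {0<..} x * bwd \<theta>p Qp x + indicator {..<0} x * fwd \<theta>n Pn x - bwd \<theta>n Qn x"
    and h2_def: "\<And>x. h2 x = - rp * fwd \<theta>p Pp x - rp * (indicator {0<..} x * bwd \<theta>p Qp x) - rn * (indicator {..<0} x * fwd \<theta>n Pn x) - rn * bwd \<theta>n Qn x"
  obtains f1 f2 f1' f2' where "weak_deriv f1 f1'" "weak_deriv f2 f2'"
    and "\<And>x. x > 0 \<Longrightarrow> f1' x = (m + wp) * f2 x + g2 x \<and> f2' x = (m - wp) * f1 x - g1 x"
    and "\<And>x. x < 0 \<Longrightarrow> f1' x = (m + wn) * f2 x + g2 x \<and> f2' x = (m - wn) * f1 x - g1 x"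
    and "\<And>x. x \<noteq> 0 \<Longrightarrow> f1 x = (A * decay \<theta>p x + B * decay \<theta>n (- x)) + h1 x"
    and "\<And>x. x \<noteq> 0 \<Longrightarrow> f2 x = (- rp * A * decay \<theta>p x + rn * B * decay \<theta>n (- x)) + h2 x"
proof -
  have src: "L2_fun Pp" "L2_fun Qp" "L2_fun Pn" "L2_fun Qn"
    unfolding Pp_def Qp_def Pn_def Qn_def by (intro L2_fun_sources g; simp)+
  have supp: "Pp y = 0" "Qp y = 0" if "y \<le> 0" for y
    using that by (auto simp: Pp_def Qp_def growing_source_def decaying_source_def)
  have supn: "Pn y = 0" "Qn y = 0" if "y \<ge> 0" for y
    using that by (auto simp: Pn_def Qn_def growing_source_def decaying_source_def)
  have valp: "Pp y + Qp y = g2 y" "rp * (Pp y - Qp y) = g1 y" if "y > 0" for y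
    using that r by (auto simp: Pp_def Qp_def growing_source_def decaying_source_def field_simps)
  have valn: "Pn y + Qn y = g2 y" "rn * (Pn y - Qn y) = g1 y" if "y < 0" for y
    using that r by (auto simp: Pn_def Qn_def growing_source_def decaying_source_def field_simps)
  have right: "fwd \<theta>n Pn x = c * decay \<theta>n x" "bwd \<theta>n Qn x = 0" if "x \<ge> 0" for x
    using fwd_negative_support[of Pn x] bwd_negative_support[of Qn x] supn that by (auto simp: c_def)
  have left: "bwd \<theta>p Qp x = d * decay \<theta>p (- x)" "fwd \<theta>p Pp x = 0" if "x \<le> 0" for x
    using bwd_positive_support[of Qp x] fwd_positive_support[of Pp x] supp that by (auto simp: d_def)
  \<comment> \<open>Piecewise exponentials which add the homogeneous modes and cut off what \<open>fwd\<close> and \<open>bwd\<close> contribute on the opposite half-line.\<close>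
  define e1 where "e1 x = A * decay \<theta>p x + - c * decay \<theta>n x + (B * decay \<theta>n (- x) + d * decay \<theta>p (- x))" for x
  define e1' where "e1' x = - \<theta>p * A * decay \<theta>p x + - \<theta>n * - c * decay \<theta>n x + (\<theta>n * B * decay \<theta>n (- x) + \<theta>p * d * decay \<theta>p (- x))" for x
  define e2 where "e2 x = - rp * A * decay \<theta>p x + rn * c * decay \<theta>n x + (rn * B * decay \<theta>n (- x) + rp * d * decay \<theta>p (- x))" for x
  define e2' where "e2' x = - \<theta>p * (- rp * A) * decay \<theta>p x + - \<theta>n * (rn * c) * decay \<theta>n x + (\<theta>n * (rn * B) * decay \<theta>n (- x) + \<theta>p * (rp * d) * decay \<theta>p (- x))" for x
  have "A * (rp + rn) = 2 * rn * c - (rp - rn) * d" "B * (rp + rn) = (rn - rp) * c - 2 * rp * d"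
    using r by (simp_all add: A_def B_def)
  then have "(A + - c - (B + d)) * (rp + rn) = 0" "(- rp * A + rn * c - (rn * B + rp * d)) * (rp + rn) = 0"
    by algebra+
  then have m1: "A + - c = B + d" and m2: "- rp * A + rn * c = rn * B + rp * d"
    using r by auto
  have we1: "weak_deriv e1 e1'"
    unfolding e1_def [abs_def] e1'_def [abs_def] by (rule weak_deriv_exponentials[OF Re(1,2,2,1) m1])
  have we2: "weak_deriv e2 e2'"
    unfolding e2_def [abs_def] e2'_def [abs_def] by (rule weak_deriv_exponentials[OF Re(1,2,2,1) m2])
  note wf = weak_deriv_fwd[OF Re(1) src(1)] weak_deriv_bwd[OF Re(1) src(2)]
    weak_deriv_fwd[OF Re(2) src(3)] weak_deriv_bwd[OF Re(2) src(4)]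
  define f1 where "f1 x = fwd \<theta>p Pp x - bwd \<theta>p Qp x + fwd \<theta>n Pn x - bwd \<theta>n Qn x + e1 x" for x
  define f1' where "f1' x = (Pp x - \<theta>p * fwd \<theta>p Pp x) - (\<theta>p * bwd \<theta>p Qp x - Qp x)
     + (Pn x - \<theta>n * fwd \<theta>n Pn x) - (\<theta>n * bwd \<theta>n Qn x - Qn x) + e1' x" for x
  define f2 where "f2 x = - rp * fwd \<theta>p Pp x - rp * bwd \<theta>p Qp x - rn * fwd \<theta>n Pn x - rn * bwd \<theta>n Qn x + e2 x" for x
  define f2' where "f2' x = - rp * (Pp x - \<theta>p * fwd \<theta>p Pp x) - rp * (\<theta>p * bwd \<theta>p Qp x - Qp x)
     - rn * (Pn x - \<theta>n * fwd \<theta>n Pn x) - rn * (\<theta>n * bwd \<theta>n Qn x - Qn x) + e2' x" for x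
  have "weak_deriv f1 f1'"
    unfolding f1_def [abs_def] f1'_def [abs_def] by (intro weak_deriv_add weak_deriv_diff wf we1)
  moreover have "weak_deriv f2 f2'"
    unfolding f2_def [abs_def] f2'_def [abs_def] by (intro weak_deriv_add weak_deriv_diff weak_deriv_cmult wf we2)
  moreover have "f1' x = (m + wp) * f2 x + g2 x \<and> f2' x = (m - wp) * f1 x - g1 x" if x: "x > 0" for x
  proof -
    have d0: "decay \<theta> (- x) = 0" for \<theta> using x by (simp add: decay_def)
    define E where "E = fwd \<theta>p Pp x" define F where "F = bwd \<theta>p Qp x"
    have f2: "f2 x = - rp * (E + F + A * decay \<theta>p x)" and f1: "f1 x = E - F + A * decay \<theta>p x"
      using x right[of x] by (simp_all add: f1_def f2_def e1_def e2_def d0 E_def F_def algebra_simps)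
    have f1': "f1' x = (Pp x + Qp x) - \<theta>p * (E + F + A * decay \<theta>p x)"
      using x right[of x] supn[of x] by (simp add: f1'_def e1'_def d0 E_def F_def algebra_simps)
    have f2': "f2' x = - (rp * (Pp x - Qp x)) + \<theta>p * rp * (E - F + A * decay \<theta>p x)"
      using x right[of x] supn[of x] by (simp add: f2'_def e2'_def d0 E_def F_def algebra_simps)
    show ?thesis
      unfolding f1 f2 f1' f2' valp[OF x] eqp(2) eqp(1)[symmetric] by (simp add: algebra_simps)
  qed
  moreover have "f1' x = (m + wn) * f2 x + g2 x \<and> f2' x = (m - wn) * f1 x - g1 x" if x: "x < 0" for x
  proof -
    have d0: "decay \<theta> x = 0" for \<theta> using x by (simp add: decay_def)
    define E where "E = fwd \<theta>n Pn x" define F where "F = bwd \<theta>n Qn x"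
    have f2: "f2 x = rn * (B * decay \<theta>n (- x) - E - F)" and f1: "f1 x = E - F + B * decay \<theta>n (- x)"
      using x left[of x] by (simp_all add: f1_def f2_def e1_def e2_def d0 E_def F_def algebra_simps)
    have f1': "f1' x = (Pn x + Qn x) + \<theta>n * (B * decay \<theta>n (- x) - E - F)"
      using x left[of x] supp[of x] by (simp add: f1'_def e1'_def d0 E_def F_def algebra_simps)
    have f2': "f2' x = - (rn * (Pn x - Qn x)) + \<theta>n * rn * (E - F + B * decay \<theta>n (- x))"
      using x left[of x] supp[of x] by (simp add: f2'_def e2'_def d0 E_def F_def algebra_simps)
    show ?thesis
      unfolding f1 f2 f1' f2' valn[OF x] eqn(2) eqn(1)[symmetric] by (simp add: algebra_simps)
  qed
  moreover have "f1 x = (A * decay \<theta>p x + B * decay \<theta>n (- x)) + h1 x"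
    "f2 x = (- rp * A * decay \<theta>p x + rn * B * decay \<theta>n (- x)) + h2 x" if x: "x \<noteq> 0" for x
  proof -
    consider "x > 0" | "x < 0" using x by linarith
    then have "f1 x = (A * decay \<theta>p x + B * decay \<theta>n (- x)) + h1 x \<and>
      f2 x = (- rp * A * decay \<theta>p x + rn * B * decay \<theta>n (- x)) + h2 x"
    proof cases
      case 1
      then have "decay \<theta> (- x) = 0" for \<theta> by (simp add: decay_def)
      with 1 right[of x] show ?thesis by (simp add: f1_def f2_def e1_def e2_def h1_def h2_def)
    next
      case 2
      then have "decay \<theta> x = 0" for \<theta> by (simp add: decay_def)
      with 2 left[of x] show ?thesis by (simp add: f1_def f2_def e1_def e2_def h1_def h2_def)
    qed
    then show "f1 x = (A * decay \<theta>p x + B * decay \<theta>n (- x)) + h1 x"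
      "f2 x = (- rp * A * decay \<theta>p x + rn * B * decay \<theta>n (- x)) + h2 x" by blast+
  qed
  ultimately show ?thesis by (rule that)
qed

section \<open>Spinors in components\<close>

definition spinor_of :: "(real \<Rightarrow> complex) \<Rightarrow> (real \<Rightarrow> complex) \<Rightarrow> spinor" where
  "spinor_of f1 f2 = abs_spinor (\<lambda>x. vector [f1 x, f2 x])"

lemma spinor_cases:
  obtains f1 f2 where "L2_fun f1" "L2_fun f2" "F = spinor_of f1 f2"
proof -
  define f where "f = rep_spinor F"
  have "square_integrable f" and F: "F = abs_spinor f"
    using Quotient3_rep_reflp[OF Quotient3_spinor, of F] Quotient3_abs_rep[OF Quotient3_spinor, of F]
    by (auto simp: f_def)
  moreover have "(\<lambda>x. vector [f x $ 1, f x $ 2]) = f"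
    by (auto simp: vector_2_eq_iff)
  ultimately show ?thesis
    using that[of "\<lambda>x. f x $ 1" "\<lambda>x. f x $ 2"] square_integrable_component
    by (simp add: spinor_of_def)
qed

lemma spinor_of_cong:
  assumes "L2_fun f1" "L2_fun f2" "L2_fun g1" "L2_fun g2"
    and "AE x in lborel. f1 x = g1 x" "AE x in lborel. f2 x = g2 x"
  shows "spinor_of f1 f2 = spinor_of g1 g2"
  unfolding spinor_of_def
  using assms(5,6) square_integrable_vector[OF assms(1,2)] square_integrable_vector[OF assms(3,4)]
  by (intro Quotient3_rel_abs[OF Quotient3_spinor]) (auto elim: eventually_elim2)

lemma spinor_of_eqD:
  assumes "spinor_of f1 f2 = spinor_of g1 g2" "L2_fun f1" "L2_fun f2" "L2_fun g1" "L2_fun g2"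
  shows "AE x in lborel. f1 x = g1 x" "AE x in lborel. f2 x = g2 x"
proof -
  have "AE x in lborel. (vector [f1 x, f2 x] :: complex ^ 2) = vector [g1 x, g2 x]"
    using Quotient3_rel[OF Quotient3_spinor, of "\<lambda>x. vector [f1 x, f2 x]" "\<lambda>x. vector [g1 x, g2 x]"]
      square_integrable_vector[OF assms(2,3)] square_integrable_vector[OF assms(4,5)] assms(1)
    by (auto simp: spinor_of_def)
  then show "AE x in lborel. f1 x = g1 x" "AE x in lborel. f2 x = g2 x"
    by (auto simp: vector_2_eq_iff elim!: eventually_mono)
qed

lemma spinor_of_add:
  assumes "L2_fun f1" "L2_fun f2" "L2_fun g1" "L2_fun g2"
  shows "spinor_of f1 f2 + spinor_of g1 g2 = spinor_of (\<lambda>x. f1 x + g1 x) (\<lambda>x. f2 x + g2 x)"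
  unfolding spinor_of_def
  by (subst plus_spinor.abs_eq)
    (auto simp: square_integrable_vector assms vector_2_eq_iff intro!: arg_cong[where f = abs_spinor])

lemma spinor_of_diff:
  assumes "L2_fun f1" "L2_fun f2" "L2_fun g1" "L2_fun g2"
  shows "spinor_of f1 f2 - spinor_of g1 g2 = spinor_of (\<lambda>x. f1 x - g1 x) (\<lambda>x. f2 x - g2 x)"
  unfolding spinor_of_def
  by (subst minus_spinor.abs_eq)
    (auto simp: square_integrable_vector assms vector_2_eq_iff intro!: arg_cong[where f = abs_spinor])

lemma scaleC_spinor_of:
  assumes "L2_fun f1" "L2_fun f2"
  shows "scaleC z (spinor_of f1 f2) = spinor_of (\<lambda>x. z * f1 x) (\<lambda>x. z * f2 x)"
  unfolding spinor_of_def
  by (subst scaleC.abs_eq)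
    (auto simp: square_integrable_vector assms vector_2_eq_iff intro!: arg_cong[where f = abs_spinor])

lemma scaleR_spinor_of:
  assumes "L2_fun f1" "L2_fun f2"
  shows "r *\<^sub>R spinor_of f1 f2 = spinor_of (\<lambda>x. of_real r * f1 x) (\<lambda>x. of_real r * f2 x)"
  unfolding spinor_of_def
  by (subst scaleR_spinor.abs_eq)
    (auto simp: square_integrable_vector assms vector_2_eq_iff scaleR_conv_of_real[where 'a = complex] intro!: arg_cong[where f = abs_spinor])

lemma zero_spinor_of: "(0 :: spinor) = spinor_of (\<lambda>x. 0) (\<lambda>x. 0)"
  unfolding spinor_of_def zero_spinor.abs_eq by (rule arg_cong[where f = abs_spinor]) (auto simp: vector_2_eq_iff)

lemma inner_spinor_of:
  assumes "L2_fun f1" "L2_fun f2" "L2_fun g1" "L2_fun g2"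
  shows "spinor_of f1 f2 \<bullet> spinor_of g1 g2 = Re (LBINT x. f1 x * cnj (g1 x) + f2 x * cnj (g2 x))"
proof -
  have "integrable lborel (\<lambda>x. f1 x * cnj (g1 x) + f2 x * cnj (g2 x))"
    by (intro Bochner_Integration.integrable_add L2_fun_integrable_mult L2_fun_cnj assms)
  moreover have "(vector [f1 x, f2 x] :: complex ^ 2) \<bullet> vector [g1 x, g2 x] = Re (f1 x * cnj (g1 x) + f2 x * cnj (g2 x))" for x
    by (simp add: inner_vec_def sum_2 inner_complex_def)
  ultimately have "Re (LBINT x. f1 x * cnj (g1 x) + f2 x * cnj (g2 x))
      = (LBINT x. (vector [f1 x, f2 x] :: complex ^ 2) \<bullet> vector [g1 x, g2 x])"
    by (simp only: integral_Re)
  then show ?thesis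
    unfolding spinor_of_def
    by (subst inner_spinor.abs_eq) (simp_all only: square_integrable_vector assms, auto)
qed

lemma norm_spinor_of:
  assumes "L2_fun f1" "L2_fun f2"
  shows "(norm (spinor_of f1 f2))^2 = (LBINT x. (cmod (f1 x))^2) + (LBINT x. (cmod (f2 x))^2)"
proof -
  have "(norm (spinor_of f1 f2))^2 = (LBINT x. (norm (vector [f1 x, f2 x] :: complex ^ 2))^2)"
    unfolding power2_norm_eq_inner spinor_of_def
    by (subst inner_spinor.abs_eq) (auto simp: square_integrable_vector assms power2_norm_eq_inner)
  then show ?thesis
    using assms by (simp add: norm_vector_2 L2_fun_def)
qed

lemma integral_vector_component:
  fixes f :: "real \<Rightarrow> complex ^ 2"
  assumes "integrable lborel f"
  shows "(LBINT x. f x) $ i = (LBINT x. f x $ i)"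
  using integral_bounded_linear[OF bounded_linear_vec_nth assms] by simp

lemma has_weak_derivative_spinor_of:
  assumes "L2_fun f1" "L2_fun f2" "L2_fun g1" "L2_fun g2"
  shows "has_weak_derivative (spinor_of f1 f2) (spinor_of g1 g2) \<longleftrightarrow> weak_deriv f1 g1 \<and> weak_deriv f2 g2"
proof -
  let ?f = "\<lambda>x. vector [f1 x, f2 x] :: complex ^ 2" and ?g = "\<lambda>x. vector [g1 x, g2 x] :: complex ^ 2"
  have int: "integrable lborel (\<lambda>x. \<psi> x *\<^sub>R h x)"
    if "L2_fun (\<lambda>x. of_real (\<psi> x))" "square_integrable h" for \<psi> :: "real \<Rightarrow> real" and h :: "real \<Rightarrow> complex ^ 2"
  proof (rule Bochner_Integration.integrable_bound)
    have [measurable]: "h \<in> borel_measurable borel" "(\<lambda>x. complex_of_real (\<psi> x)) \<in> borel_measurable borel"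
      using that by (auto simp: L2_fun_def square_integrable_def)
    have "(\<lambda>x. Re (complex_of_real (\<psi> x))) \<in> borel_measurable borel" by measurable
    then have [measurable]: "\<psi> \<in> borel_measurable borel" by simp
    show "integrable lborel (\<lambda>x. (cmod (of_real (\<psi> x)))^2 + (norm (h x))^2)"
      using that by (simp add: L2_fun_def square_integrable_def)
    show "(\<lambda>x. \<psi> x *\<^sub>R h x) \<in> borel_measurable lborel" by measurable
    have "\<bar>\<psi> x\<bar> * norm (h x) \<le> \<bar>\<psi> x\<bar>^2 + (norm (h x))^2" for x
      using sum_squares_bound[of "\<bar>\<psi> x\<bar>" "norm (h x)"] mult_nonneg_nonneg[OF abs_ge_zero[of "\<psi> x"] norm_ge_zero[of "h x"]]
      by linarith
    then show "AE x in lborel. norm (\<psi> x *\<^sub>R h x) \<le> norm ((cmod (of_real (\<psi> x)))^2 + (norm (h x))^2)"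
      by (intro AE_I2) simp
  qed
  have "(LBINT x. \<phi>' x *\<^sub>R ?f x) = - (LBINT x. \<phi> x *\<^sub>R ?g x) \<longleftrightarrow>
     (LBINT x. \<phi>' x *\<^sub>R f1 x) = - (LBINT x. \<phi> x *\<^sub>R g1 x) \<and>
     (LBINT x. \<phi>' x *\<^sub>R f2 x) = - (LBINT x. \<phi> x *\<^sub>R g2 x)" if t: "test_function \<phi> \<phi>'" for \<phi> \<phi>'
  proof -
    have "integrable lborel (\<lambda>x. \<phi>' x *\<^sub>R ?f x)" "integrable lborel (\<lambda>x. \<phi> x *\<^sub>R ?g x)"
      using L2_fun_test_function[OF t] square_integrable_vector assms by (auto intro!: int)
    then show ?thesis
      by (simp add: vector_2_eq_iff integral_vector_component)
  qed
  then show ?thesis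
    unfolding spinor_of_def
    by (subst has_weak_derivative.abs_eq)
      (auto simp: square_integrable_vector assms weak_deriv_def)
qed

lemma weak_derivative_spinor_of:
  assumes "weak_deriv f1 g1" "weak_deriv f2 g2"
  shows "spinor_of f1 f2 \<in> H1" "weak_derivative (spinor_of f1 f2) = spinor_of g1 g2"
proof -
  have L: "L2_fun f1" "L2_fun g1" "L2_fun f2" "L2_fun g2"
    using assms by (auto simp: weak_deriv_def)
  have w: "has_weak_derivative (spinor_of f1 f2) (spinor_of g1 g2)"
    using has_weak_derivative_spinor_of[OF L(1,3,2,4)] assms by simp
  then show "spinor_of f1 f2 \<in> H1"
    by (auto simp: H1_def)
  show "weak_derivative (spinor_of f1 f2) = spinor_of g1 g2"
    unfolding weak_derivative_def
  proof (rule the_equality[where P = "has_weak_derivative (spinor_of f1 f2)", OF w])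
    fix G assume G: "has_weak_derivative (spinor_of f1 f2) G"
    obtain k1 k2 where k: "L2_fun k1" "L2_fun k2" "G = spinor_of k1 k2"
      by (rule spinor_cases)
    with G L have "weak_deriv f1 k1" "weak_deriv f2 k2"
      using has_weak_derivative_spinor_of[OF L(1,3) k(1,2)] by auto
    then show "G = spinor_of g1 g2"
      unfolding k(3) using assms by (intro spinor_of_cong L k weak_deriv_unique)
  qed
qed

lemma H1_cases:
  assumes "F \<in> H1"
  obtains f1 f2 f1' f2' where "weak_deriv f1 f1'" "weak_deriv f2 f2'" "F = spinor_of f1 f2"
proof -
  obtain G where G: "has_weak_derivative F G" using assms by (auto simp: H1_def)
  obtain f1 f2 where f: "L2_fun f1" "L2_fun f2" "F = spinor_of f1 f2" by (rule spinor_cases)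
  obtain g1 g2 where g: "L2_fun g1" "L2_fun g2" "G = spinor_of g1 g2" by (rule spinor_cases)
  show ?thesis
    using that[of f1 g1 f2 g2] G f g has_weak_derivative_spinor_of by auto
qed

definition dirac_shift :: "real \<Rightarrow> complex \<Rightarrow> spinor \<Rightarrow> spinor" where
  "dirac_shift m z f = dirac m f - scaleC z f"

lemma L2_fun_sgn: "L2_fun u \<Longrightarrow> L2_fun (\<lambda>x. \<i> * of_real (sgn x) * u x)"
  by (rule L2_fun_dominated[of u _ 1]) (auto simp: L2_fun_def norm_mult sgn_if sgn_real_def)

lemma dirac_shift_spinor_of:
  assumes w: "weak_deriv f1 f1'" "weak_deriv f2 f2'"
  shows "dirac_shift m z (spinor_of f1 f2) = spinor_of
     (\<lambda>x. of_real m * f1 x - f2' x + \<i> * of_real (sgn x) * f1 x - z * f1 x)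
     (\<lambda>x. f1' x - of_real m * f2 x + \<i> * of_real (sgn x) * f2 x - z * f2 x)"
proof -
  have L: "L2_fun f1" "L2_fun f1'" "L2_fun f2" "L2_fun f2'"
    using w by (auto simp: weak_deriv_def)
  have "dirac m (spinor_of f1 f2) = abs_spinor (dirac_fun m (\<lambda>x. vector [f1 x, f2 x]) (\<lambda>x. vector [f1' x, f2' x]))"
    unfolding dirac_def weak_derivative_spinor_of[OF w] unfolding spinor_of_def
    by (subst dirac_expression.abs_eq) (auto simp: square_integrable_vector L)
  also have "dirac_fun m (\<lambda>x. vector [f1 x, f2 x]) (\<lambda>x. vector [f1' x, f2' x]) = (\<lambda>x. vector
     [of_real m * f1 x - f2' x + \<i> * of_real (sgn x) * f1 x, f1' x - of_real m * f2 x + \<i> * of_real (sgn x) * f2 x])"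
    by (auto simp: dirac_fun_def vector_2_eq_iff)
  finally have "dirac m (spinor_of f1 f2) = spinor_of
     (\<lambda>x. of_real m * f1 x - f2' x + \<i> * of_real (sgn x) * f1 x)
     (\<lambda>x. f1' x - of_real m * f2 x + \<i> * of_real (sgn x) * f2 x)"
    by (simp only: spinor_of_def)
  then show ?thesis
    unfolding dirac_shift_def scaleC_spinor_of[OF L(1,3)]
    by (simp only:, subst spinor_of_diff) (auto intro!: L2_fun_add L2_fun_diff L2_fun_cmult L2_fun_sgn L)
qed

section \<open>The shifted Dirac operator\<close>

lemma weak_deriv_cnj:
  assumes w: "weak_deriv u u'"
  shows "weak_deriv (\<lambda>x. cnj (u x)) (\<lambda>x. cnj (u' x))"
  unfolding weak_deriv_def
proof (intro conjI allI impI)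
  show "L2_fun (\<lambda>x. cnj (u x))" "L2_fun (\<lambda>x. cnj (u' x))"
    using w by (auto simp: weak_deriv_def intro: L2_fun_cnj)
  fix \<phi> \<phi>' assume t: "test_function \<phi> \<phi>'"
  have "(LBINT x. \<phi>' x *\<^sub>R u x) = - (LBINT x. \<phi> x *\<^sub>R u' x)"
    using w t by (simp add: weak_deriv_def)
  then show "(LBINT x. \<phi>' x *\<^sub>R cnj (u x)) = - (LBINT x. \<phi> x *\<^sub>R cnj (u' x))"
    using Bochner_Integration.integral_cnj[of lborel "\<lambda>x. \<phi>' x *\<^sub>R u x"] Bochner_Integration.integral_cnj[of lborel "\<lambda>x. \<phi> x *\<^sub>R u' x"] by simp
qed

lemma L2_fun_mult_sgn: "L2_fun u \<Longrightarrow> L2_fun (\<lambda>x. u x * of_real (sgn x))"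
  by (rule L2_fun_dominated[of u _ 1]) (auto simp: L2_fun_def norm_mult sgn_if sgn_real_def)

lemma H1_add: "F \<in> H1 \<Longrightarrow> G \<in> H1 \<Longrightarrow> F + G \<in> H1 \<and> dirac_shift m z (F + G) = dirac_shift m z F + dirac_shift m z G"
proof -
  assume "F \<in> H1" "G \<in> H1"
  obtain f1 f2 f1' f2' where f: "weak_deriv f1 f1'" "weak_deriv f2 f2'" "F = spinor_of f1 f2"
    using \<open>F \<in> H1\<close> by (rule H1_cases)
  obtain g1 g2 g1' g2' where g: "weak_deriv g1 g1'" "weak_deriv g2 g2'" "G = spinor_of g1 g2"
    using \<open>G \<in> H1\<close> by (rule H1_cases)
  note w = weak_deriv_add[OF f(1) g(1)] weak_deriv_add[OF f(2) g(2)]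
  have L: "L2_fun f1" "L2_fun f2" "L2_fun g1" "L2_fun g2" "L2_fun f1'" "L2_fun f2'" "L2_fun g1'" "L2_fun g2'"
    using f g by (auto simp: weak_deriv_def)
  have s: "F + G = spinor_of (\<lambda>x. f1 x + g1 x) (\<lambda>x. f2 x + g2 x)"
    by (simp add: f g spinor_of_add L)
  show ?thesis
    unfolding s dirac_shift_spinor_of[OF w] unfolding f(3) g(3) dirac_shift_spinor_of[OF f(1,2)] dirac_shift_spinor_of[OF g(1,2)]
    by (subst spinor_of_add)
      (auto intro!: weak_derivative_spinor_of[OF w] L2_fun_add L2_fun_diff L2_fun_cmult L2_fun_sgn L2_fun_mult_sgn L
        arg_cong2[where f = spinor_of] simp: algebra_simps)
qed

lemma H1_scaleR: "F \<in> H1 \<Longrightarrow> r *\<^sub>R F \<in> H1 \<and> dirac_shift m z (r *\<^sub>R F) = r *\<^sub>R dirac_shift m z F"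
proof -
  assume "F \<in> H1"
  obtain f1 f2 f1' f2' where f: "weak_deriv f1 f1'" "weak_deriv f2 f2'" "F = spinor_of f1 f2"
    using \<open>F \<in> H1\<close> by (rule H1_cases)
  note w = weak_deriv_cmult[OF f(1), of "of_real r"] weak_deriv_cmult[OF f(2), of "of_real r"]
  have L: "L2_fun f1" "L2_fun f2" "L2_fun f1'" "L2_fun f2'"
    using f by (auto simp: weak_deriv_def)
  have s: "r *\<^sub>R F = spinor_of (\<lambda>x. of_real r * f1 x) (\<lambda>x. of_real r * f2 x)"
    by (simp add: f scaleR_spinor_of L)
  show ?thesis
    unfolding s dirac_shift_spinor_of[OF w] unfolding f(3) dirac_shift_spinor_of[OF f(1,2)]
    by (subst scaleR_spinor_of)
      (auto intro!: weak_derivative_spinor_of[OF w] L2_fun_add L2_fun_diff L2_fun_cmult L2_fun_sgn L2_fun_mult_sgn L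
        arg_cong2[where f = spinor_of] simp: algebra_simps)
qed

lemma H1_diff: "F \<in> H1 \<Longrightarrow> G \<in> H1 \<Longrightarrow> F - G \<in> H1 \<and> dirac_shift m z (F - G) = dirac_shift m z F - dirac_shift m z G"
  using H1_add[of F "(-1) *\<^sub>R G" m z] H1_scaleR[of G "-1" m z] by simp

lemma dirac_shift_eqI:
  assumes w: "weak_deriv f1 f1'" "weak_deriv f2 f2'" and g: "L2_fun g1" "L2_fun g2"
    and pos: "\<And>x. x > 0 \<Longrightarrow> f1' x = (of_real m + (z - \<i>)) * f2 x + g2 x \<and> f2' x = (of_real m - (z - \<i>)) * f1 x - g1 x"
    and neg: "\<And>x. x < 0 \<Longrightarrow> f1' x = (of_real m + (z + \<i>)) * f2 x + g2 x \<and> f2' x = (of_real m - (z + \<i>)) * f1 x - g1 x"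
  shows "dirac_shift m z (spinor_of f1 f2) = spinor_of g1 g2"
proof -
  have L: "L2_fun f1" "L2_fun f1'" "L2_fun f2" "L2_fun f2'"
    using w by (auto simp: weak_deriv_def)
  have eq: "of_real m * f1 x - f2' x + \<i> * of_real (sgn x) * f1 x - z * f1 x = g1 x"
    "f1' x - of_real m * f2 x + \<i> * of_real (sgn x) * f2 x - z * f2 x = g2 x" if "x \<noteq> 0" for x
    using that pos[of x] neg[of x] by (cases "x > 0"; simp add: algebra_simps)+
  have ae: "AE x in lborel. x \<noteq> (0::real)"
    by (rule AE_lborel_singleton)
  show ?thesis
    unfolding dirac_shift_spinor_of[OF w]
    by (rule spinor_of_cong)
      (use ae in \<open>auto intro!: L2_fun_add L2_fun_diff L2_fun_cmult L2_fun_sgn L g elim!: eventually_mono simp: eq\<close>)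
qed

text \<open>The real part of the Hermitian product of \<open>(L - z) f\<close> and \<open>\<i> f\<close> is the integral of
  \<open>(sgn x - Im z) \<bar>f x\<bar>^2\<close>, because the remaining part of the operator is symmetric: by integration by
  parts its quadratic form is real. The modulus of this integral is at least
  \<open>(\<bar>Im z\<bar> - 1) \<parallel>f\<parallel>^2\<close>.\<close>

lemma numerical_range_bound:
  assumes "F \<in> H1"
  shows "(\<bar>Im z\<bar> - 1) * norm F \<le> norm (dirac_shift m z F)"
proof -
  obtain f1 f2 f1' f2' where f: "weak_deriv f1 f1'" "weak_deriv f2 f2'" and F: "F = spinor_of f1 f2"
    using assms by (rule H1_cases)
  have L: "L2_fun f1" "L2_fun f1'" "L2_fun f2" "L2_fun f2'"
    using f by (auto simp: weak_deriv_def)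
  define t1 where "t1 x = of_real m * f1 x - f2' x + \<i> * of_real (sgn x) * f1 x - z * f1 x" for x
  define t2 where "t2 x = f1' x - of_real m * f2 x + \<i> * of_real (sgn x) * f2 x - z * f2 x" for x
  have Lt: "L2_fun t1" "L2_fun t2"
    unfolding t1_def [abs_def] t2_def [abs_def] by (intro L2_fun_add L2_fun_diff L2_fun_cmult L2_fun_sgn L)+
  have T: "dirac_shift m z F = spinor_of t1 t2"
    unfolding F dirac_shift_spinor_of[OF f] by (simp add: t1_def [abs_def] t2_def [abs_def])
  have iF: "scaleC \<i> F = spinor_of (\<lambda>x. \<i> * f1 x) (\<lambda>x. \<i> * f2 x)"
    by (simp add: F scaleC_spinor_of L)
  have "(norm (scaleC \<i> F))^2 = (norm F)^2"
    unfolding iF unfolding F by (simp add: norm_spinor_of L L2_fun_cmult norm_mult)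
  then have nF: "norm (scaleC \<i> F) = norm F"
    by (simp add: power2_eq_iff_nonneg)
  let ?N = "\<lambda>x. (cmod (f1 x))^2 + (cmod (f2 x))^2"
  let ?W = "\<lambda>x. f1' x * cnj (f2 x) + f1 x * cnj (f2' x)"
  have iN: "integrable lborel ?N"
    using L by (simp add: L2_fun_def)
  have iW: "integrable lborel ?W"
    by (intro Bochner_Integration.integrable_add L2_fun_integrable_mult L2_fun_cnj L)
  have iT: "integrable lborel (\<lambda>x. t1 x * cnj (\<i> * f1 x) + t2 x * cnj (\<i> * f2 x))"
    by (intro Bochner_Integration.integrable_add L2_fun_integrable_mult L2_fun_cnj L2_fun_cmult L Lt)
  have W0: "(LBINT x. ?W x) = 0"
    using weak_deriv_parts[OF f(1) weak_deriv_cnj[OF f(2)]] L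
    by (simp add: L2_fun_integrable_mult L2_fun_cnj)
  have pt: "Re (t1 x * cnj (\<i> * f1 x) + t2 x * cnj (\<i> * f2 x)) = (sgn x - Im z) * ?N x + Im (?W x)" for x
    unfolding t1_def t2_def cmod_power2 by (simp add: power2_eq_square algebra_simps)
  have nN: "(norm F)^2 = (LBINT x. ?N x)"
    unfolding F norm_spinor_of[OF L(1,3)] using L by (simp add: L2_fun_def)
  \<comment> \<open>The sign that makes \<open>s * (sgn x - Im z)\<close> at least \<open>\<bar>Im z\<bar> - 1\<close> for all \<open>x\<close>.\<close>
  define s where "s = (if Im z \<ge> 0 then - 1 else (1 :: real))"
  have "(\<bar>Im z\<bar> - 1) * (norm F)^2 = (LBINT x. (\<bar>Im z\<bar> - 1) * ?N x + s * Im (?W x))"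
  proof -
    have "(LBINT x. Im (?W x)) = 0"
      using W0 iW by (simp only: integral_Im) simp
    then show ?thesis
      using integrable_Im[OF iW] L2_fun_integrable_square[OF L(1)] L2_fun_integrable_square[OF L(3)] by (simp add: nN)
  qed
  also have "\<dots> \<le> (LBINT x. s * Re (t1 x * cnj (\<i> * f1 x) + t2 x * cnj (\<i> * f2 x)))"
  proof (rule integral_mono)
    show "integrable lborel (\<lambda>x. (\<bar>Im z\<bar> - 1) * ?N x + s * Im (?W x))"
      by (rule Bochner_Integration.integrable_add[OF integrable_mult_right[OF iN] integrable_mult_right[OF integrable_Im[OF iW]]])
    show "integrable lborel (\<lambda>x. s * Re (t1 x * cnj (\<i> * f1 x) + t2 x * cnj (\<i> * f2 x)))"
      by (intro integrable_mult_right integrable_Re iT)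
    fix x
    have "(\<bar>Im z\<bar> - 1) \<le> s * (sgn x - Im z)"
      by (auto simp: s_def sgn_real_def)
    then have "(\<bar>Im z\<bar> - 1) * ?N x \<le> s * (sgn x - Im z) * ?N x"
      by (rule mult_right_mono) simp
    then show "(\<bar>Im z\<bar> - 1) * ?N x + s * Im (?W x) \<le> s * Re (t1 x * cnj (\<i> * f1 x) + t2 x * cnj (\<i> * f2 x))"
      unfolding pt by (simp only: distrib_left mult.assoc)
  qed
  also have "\<dots> = s * (dirac_shift m z F \<bullet> scaleC \<i> F)"
    unfolding T iF inner_spinor_of[OF Lt L2_fun_cmult[OF L(1)] L2_fun_cmult[OF L(3)]]
    using integral_Re[OF iT] by simp
  also have "\<dots> \<le> \<bar>dirac_shift m z F \<bullet> scaleC \<i> F\<bar>"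
    by (auto simp: s_def)
  also have "\<dots> \<le> norm (dirac_shift m z F) * norm F"
    using Cauchy_Schwarz_ineq2[of "dirac_shift m z F" "scaleC \<i> F"] by (simp add: nF)
  finally show ?thesis
    by (cases "norm F = 0") (auto simp: power2_eq_square mult.assoc[symmetric] mult_le_cancel_right)
qed

text \<open>The operator is symmetric for the bilinear pairing \<open>(f, h) \<mapsto> \<integral> f1 h1 + f2 h2\<close>, without complex
  conjugation. So an element of the kernel annihilates the range, and one may take \<open>h\<close> with
  \<open>(L - z) h = cnj f\<close>.\<close>

lemma dirac_shift_injective:
  assumes surj: "\<And>G. \<exists>H\<in>H1. dirac_shift m z H = G"
    and F: "F \<in> H1" "dirac_shift m z F = 0"
  shows "F = 0"
proof -
  obtain f1 f2 f1' f2' where f: "weak_deriv f1 f1'" "weak_deriv f2 f2'" and Feq: "F = spinor_of f1 f2"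
    using F(1) by (rule H1_cases)
  obtain H where H: "H \<in> H1" "dirac_shift m z H = spinor_of (\<lambda>x. cnj (f1 x)) (\<lambda>x. cnj (f2 x))"
    using surj by blast
  obtain h1 h2 h1' h2' where h: "weak_deriv h1 h1'" "weak_deriv h2 h2'" and Heq: "H = spinor_of h1 h2"
    using H(1) by (rule H1_cases)
  have L: "L2_fun f1" "L2_fun f1'" "L2_fun f2" "L2_fun f2'" "L2_fun h1" "L2_fun h1'" "L2_fun h2" "L2_fun h2'"
    using f h by (auto simp: weak_deriv_def)
  define t1 where "t1 x = of_real m * f1 x - f2' x + \<i> * of_real (sgn x) * f1 x - z * f1 x" for x
  define t2 where "t2 x = f1' x - of_real m * f2 x + \<i> * of_real (sgn x) * f2 x - z * f2 x" for x
  define k1 where "k1 x = of_real m * h1 x - h2' x + \<i> * of_real (sgn x) * h1 x - z * h1 x" for x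
  define k2 where "k2 x = h1' x - of_real m * h2 x + \<i> * of_real (sgn x) * h2 x - z * h2 x" for x
  have Lt: "L2_fun t1" "L2_fun t2" "L2_fun k1" "L2_fun k2"
    unfolding t1_def [abs_def] t2_def [abs_def] k1_def [abs_def] k2_def [abs_def]
    by (intro L2_fun_add L2_fun_diff L2_fun_cmult L2_fun_sgn L)+
  have "spinor_of t1 t2 = spinor_of (\<lambda>x. 0) (\<lambda>x. 0)"
    using F(2) unfolding Feq dirac_shift_spinor_of[OF f] zero_spinor_of by (simp add: t1_def [abs_def] t2_def [abs_def])
  note t0 = spinor_of_eqD[OF this Lt(1,2) L2_fun_zero L2_fun_zero]
  have "spinor_of k1 k2 = spinor_of (\<lambda>x. cnj (f1 x)) (\<lambda>x. cnj (f2 x))"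
    using H(2) unfolding Heq dirac_shift_spinor_of[OF h] by (simp add: k1_def [abs_def] k2_def [abs_def])
  note kf = spinor_of_eqD[OF this Lt(3,4) L2_fun_cnj[OF L(1)] L2_fun_cnj[OF L(3)]]
  note ints = L2_fun_integrable_mult
  have "(LBINT x. (f1 x * k1 x + f2 x * k2 x) - (t1 x * h1 x + t2 x * h2 x))
      = (LBINT x. (f2' x * h1 x + f2 x * h1' x) - (f1' x * h2 x + f1 x * h2' x))"
    by (intro Bochner_Integration.integral_cong refl) (simp add: t1_def t2_def k1_def k2_def algebra_simps)
  also have "\<dots> = 0"
    using weak_deriv_parts[OF f(2) h(1)] weak_deriv_parts[OF f(1) h(2)] by (simp add: ints L)
  finally have "(LBINT x. f1 x * k1 x + f2 x * k2 x) = (LBINT x. t1 x * h1 x + t2 x * h2 x)"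
    by (simp add: ints L Lt)
  also have "\<dots> = 0"
    by (rule integral_eq_zero_AE) (use t0 in eventually_elim, simp)
  finally have z: "(LBINT x. f1 x * k1 x + f2 x * k2 x) = 0" .
  have "(LBINT x. f1 x * k1 x + f2 x * k2 x) = (LBINT x. f1 x * cnj (f1 x) + f2 x * cnj (f2 x))"
  proof (rule integral_cong_AE)
    show "AE x in lborel. f1 x * k1 x + f2 x * k2 x = f1 x * cnj (f1 x) + f2 x * cnj (f2 x)"
      using kf by eventually_elim simp
  qed (use L Lt L2_fun_cnj[OF L(1)] L2_fun_cnj[OF L(3)] in \<open>auto simp: L2_fun_def\<close>)
  then have "F \<bullet> F = 0"
    using z unfolding Feq inner_spinor_of[OF L(1,3,1,3)] by simp
  then show ?thesis by simp
qed

text \<open>Solvability with an estimate suffices: injectivity follows from surjectivity by symmetry.\<close>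

lemma resolvent_setI:
  assumes K: "K \<ge> 0" and sol: "\<And>G. \<exists>F\<in>H1. dirac_shift m z F = G \<and> norm F \<le> K * norm G"
  shows "z \<in> resolvent_set H1 (dirac m)" "onorm (resolvent H1 (dirac m) z) \<le> K"
proof -
  let ?R = "resolvent H1 (dirac m) z"
  have surj: "\<And>G. \<exists>F\<in>H1. dirac_shift m z F = G"
    using sol by blast
  have inj: "inj_on (dirac_shift m z) H1"
  proof (rule inj_onI)
    fix F G assume FG: "F \<in> H1" "G \<in> H1" "dirac_shift m z F = dirac_shift m z G"
    then have "F - G = 0"
      using H1_diff[of F G m z] by (intro dirac_shift_injective[OF surj, of "F - G"]) auto
    then show "F = G" by simp
  qed
  have R: "?R = the_inv_into H1 (dirac_shift m z)"
    by (simp add: resolvent_def dirac_shift_def [abs_def])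
  have RT: "?R (dirac_shift m z F) = F" if "F \<in> H1" for F
    unfolding R by (rule the_inv_into_f_f[OF inj that])
  have RG: "\<exists>F\<in>H1. dirac_shift m z F = G \<and> norm F \<le> K * norm G \<and> ?R G = F" for G
    using sol[of G] RT by blast
  have "bounded_linear ?R"
  proof (rule bounded_linear_intro)
    fix G G' :: spinor and r :: real
    obtain F F' where F: "F \<in> H1" "dirac_shift m z F = G" "?R G = F" and F': "F' \<in> H1" "dirac_shift m z F' = G'" "?R G' = F'"
      using RG by metis
    show "?R (G + G') = ?R G + ?R G'"
      using RT[of "F + F'"] H1_add[OF F(1) F'(1), of m z] F F' by simp
    show "?R (r *\<^sub>R G) = r *\<^sub>R ?R G"
      using RT[of "r *\<^sub>R F"] H1_scaleR[OF F(1), of r m z] F by simp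
    show "norm (?R G) \<le> norm G * K"
      using RG[of G] by (auto simp: mult.commute)
  qed
  moreover have "bij_betw (dirac_shift m z) H1 UNIV"
    using inj surj by (auto simp: bij_betw_def image_iff) metis
  ultimately show "z \<in> resolvent_set H1 (dirac m)"
    by (simp add: resolvent_set_def dirac_shift_def [abs_def])
  show "onorm ?R \<le> K"
    by (rule onorm_bound[OF K]) (use RG in blast)
qed

lemma resolvent_bound:
  assumes z: "z \<in> resolvent_set H1 (dirac m)" and F: "F \<in> H1"
  shows "norm F \<le> onorm (resolvent H1 (dirac m) z) * norm (dirac_shift m z F)"
proof -
  have "inj_on (dirac_shift m z) H1" and bl: "bounded_linear (resolvent H1 (dirac m) z)"
    using z by (auto simp: resolvent_set_def dirac_shift_def [abs_def] bij_betw_def)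
  then have "resolvent H1 (dirac m) z (dirac_shift m z F) = F"
    using the_inv_into_f_f[of "dirac_shift m z" H1 F] F by (simp add: resolvent_def dirac_shift_def [abs_def])
  with onorm[OF bl, of "dirac_shift m z F"] show ?thesis by simp
qed

section \<open>Two-sided exponentials\<close>

definition two_sided :: "complex \<Rightarrow> complex \<Rightarrow> complex \<Rightarrow> complex \<Rightarrow> real \<Rightarrow> complex" where
  "two_sided \<alpha> \<beta> a b x = a * decay \<alpha> x + b * decay \<beta> (- x)"

lemma L2_fun_two_sided:
  assumes "Re \<alpha> > 0" "Re \<beta> > 0"
  shows "L2_fun (two_sided \<alpha> \<beta> a b)"
  unfolding two_sided_def [abs_def]
  by (intro L2_fun_add L2_fun_cmult L2_fun_decay L2_fun_reflect[of "decay \<beta>"] assms)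

lemma integral_two_sided_mult_cnj:
  assumes "Re \<alpha> > 0" "Re \<beta> > 0"
  shows "(LBINT x. two_sided \<alpha> \<beta> a b x * cnj (two_sided \<alpha> \<beta> a' b' x))
    = a * cnj a' / of_real (2 * Re \<alpha>) + b * cnj b' / of_real (2 * Re \<beta>)"
proof -
  have [measurable]: "two_sided \<alpha> \<beta> k l \<in> borel_measurable borel" for k l
    using L2_fun_two_sided[OF assms] by (simp add: L2_fun_def)
  have [measurable]: "(\<lambda>x. cnj (two_sided \<alpha> \<beta> a' b' x)) \<in> borel_measurable borel"
    using L2_fun_cnj[OF L2_fun_two_sided[OF assms]] by (simp add: L2_fun_def)
  have "(LBINT x. two_sided \<alpha> \<beta> a b x * cnj (two_sided \<alpha> \<beta> a' b' x))
    = (LBINT x. a * cnj a' * of_real ((cmod (decay \<alpha> x))^2) + b * cnj b' * of_real ((cmod (decay \<beta> (- x)))^2))"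
  proof (rule integral_cong_AE)
    have "AE x in lborel. x \<noteq> (0::real)"
      by (rule AE_lborel_singleton)
    then show "AE x in lborel. two_sided \<alpha> \<beta> a b x * cnj (two_sided \<alpha> \<beta> a' b' x)
        = a * cnj a' * of_real ((cmod (decay \<alpha> x))^2) + b * cnj b' * of_real ((cmod (decay \<beta> (- x)))^2)"
    proof eventually_elim
      fix x :: real assume "x \<noteq> 0"
      then have "decay \<alpha> x = 0 \<or> decay \<beta> (- x) = 0"
        by (auto simp: decay_def)
      then show "two_sided \<alpha> \<beta> a b x * cnj (two_sided \<alpha> \<beta> a' b' x)
        = a * cnj a' * of_real ((cmod (decay \<alpha> x))^2) + b * cnj b' * of_real ((cmod (decay \<beta> (- x)))^2)"
        unfolding complex_norm_square by (auto simp: two_sided_def)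
    qed
  qed measurable
  also have "\<dots> = a * cnj a' / of_real (2 * Re \<alpha>) + b * cnj b' / of_real (2 * Re \<beta>)"
  proof -
    have "has_bochner_integral lborel (\<lambda>x. complex_of_real ((cmod (decay \<alpha> x))^2)) (of_real (1 / (2 * Re \<alpha>)))"
      "has_bochner_integral lborel (\<lambda>x. complex_of_real ((cmod (decay \<beta> (- x)))^2)) (of_real (1 / (2 * Re \<beta>)))"
      using decay_square_bochner(1)[OF assms(1)] decay_square_bochner(2)[OF assms(2)]
      by (auto simp only: has_bochner_integral_of_real)
    then show ?thesis
      by (simp add: has_bochner_integral_iff del: of_real_power)
  qed
  finally show ?thesis .
qed

lemma integral_two_sided:
  assumes "Re \<alpha> > 0" "Re \<beta> > 0"
  shows "(LBINT x. (cmod (two_sided \<alpha> \<beta> a b x))^2) = (cmod a)^2 / (2 * Re \<alpha>) + (cmod b)^2 / (2 * Re \<beta>)"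
proof -
  have "complex_of_real (LBINT x. (cmod (two_sided \<alpha> \<beta> a b x))^2)
      = (LBINT x. two_sided \<alpha> \<beta> a b x * cnj (two_sided \<alpha> \<beta> a b x))"
    by (simp only: complex_norm_square[symmetric] integral_complex_of_real)
  also have "\<dots> = of_real ((cmod a)^2 / (2 * Re \<alpha>) + (cmod b)^2 / (2 * Re \<beta>))"
    unfolding integral_two_sided_mult_cnj[OF assms] by (simp only: complex_norm_square[symmetric] of_real_add of_real_divide)
  finally show ?thesis
    by (simp only: of_real_eq_iff)
qed

lemma norm_two_sided:
  assumes "Re \<alpha> > 0" "Re \<beta> > 0"
  shows "(norm (spinor_of (two_sided \<alpha> \<beta> a b) (two_sided \<alpha> \<beta> a' b')))^2
    = ((cmod a)^2 + (cmod a')^2) / (2 * Re \<alpha>) + ((cmod b)^2 + (cmod b')^2) / (2 * Re \<beta>)"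
  using assms by (simp add: norm_spinor_of L2_fun_two_sided integral_two_sided add_divide_distrib)

text \<open>All eigenfunctions and approximate eigenfunctions below have this form; \<open>(1, - \<i> s)\<close> is the common
  direction on both half-lines.\<close>

lemma dirac_shift_two_sided:
  fixes s :: complex
  assumes "Re \<alpha> > 0" "Re \<beta> > 0"
  defines "F \<equiv> spinor_of (two_sided \<alpha> \<beta> 1 1) (two_sided \<alpha> \<beta> (- \<i> * s) (- \<i> * s))"
  shows "F \<in> H1"
    and "dirac_shift m z F = spinor_of
      (two_sided \<alpha> \<beta> (of_real m - (z - \<i>) - \<i> * s * \<alpha>) (of_real m - (z + \<i>) + \<i> * s * \<beta>))
      (two_sided \<alpha> \<beta> (- \<alpha> + \<i> * s * (of_real m + (z - \<i>))) (\<beta> + \<i> * s * (of_real m + (z + \<i>))))"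
proof -
  have w: "weak_deriv (two_sided \<alpha> \<beta> a a) (two_sided \<alpha> \<beta> (- \<alpha> * a) (\<beta> * a))" for a
    using weak_deriv_exponentials[of \<alpha> \<alpha> \<beta> \<beta> a 0 a 0] assms by (simp add: two_sided_def [abs_def])
  show "F \<in> H1"
    unfolding F_def by (rule weak_derivative_spinor_of[OF w w])
  show "dirac_shift m z F = spinor_of
      (two_sided \<alpha> \<beta> (of_real m - (z - \<i>) - \<i> * s * \<alpha>) (of_real m - (z + \<i>) + \<i> * s * \<beta>))
      (two_sided \<alpha> \<beta> (- \<alpha> + \<i> * s * (of_real m + (z - \<i>))) (\<beta> + \<i> * s * (of_real m + (z + \<i>))))"
    unfolding F_def
    by (rule dirac_shift_eqI[OF w w])
      (auto intro!: L2_fun_two_sided assms(1,2) simp: two_sided_def decay_def[of _ "- x" for x]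
        decay_def[of _ x for x] algebra_simps)
qed

section \<open>Existence and size of solutions\<close>

text \<open>The inner product of spinors is only the real part of the Hermitian one; multiplication of the
  kernel by a phase \<open>u\<close> makes the integral real.\<close>

lemma cmod_integral_le_norm_spinor:
  assumes "L2_fun k1" "L2_fun k2" "L2_fun g1" "L2_fun g2"
  shows "cmod (LBINT x. k1 x * g1 x + k2 x * g2 x) \<le> norm (spinor_of k1 k2) * norm (spinor_of g1 g2)"
proof -
  define I where "I = (LBINT x. k1 x * g1 x + k2 x * g2 x)"
  define u where "u = (if I = 0 then 1 else cnj (sgn I))"
  have u: "cmod u = 1"
    by (simp add: u_def norm_sgn)
  have uI: "u * I = of_real (cmod I)"
    by (simp add: u_def sgn_eq mult.commute[of "cnj I"] flip: complex_norm_square) (simp add: power2_eq_square)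
  have Lc: "L2_fun (\<lambda>x. cnj (u * k1 x))" "L2_fun (\<lambda>x. cnj (u * k2 x))"
    by (intro L2_fun_cnj L2_fun_cmult assms)+
  have "spinor_of g1 g2 \<bullet> spinor_of (\<lambda>x. cnj (u * k1 x)) (\<lambda>x. cnj (u * k2 x))
      = Re (LBINT x. u * (k1 x * g1 x + k2 x * g2 x))"
    unfolding inner_spinor_of[OF assms(3,4) Lc] by (simp add: algebra_simps)
  also have "\<dots> = cmod I"
    using uI by (simp add: I_def)
  finally have "cmod I \<le> norm (spinor_of g1 g2) * norm (spinor_of (\<lambda>x. cnj (u * k1 x)) (\<lambda>x. cnj (u * k2 x)))"
    using norm_cauchy_schwarz[of "spinor_of g1 g2" "spinor_of (\<lambda>x. cnj (u * k1 x)) (\<lambda>x. cnj (u * k2 x))"] by simp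
  also have "(norm (spinor_of (\<lambda>x. cnj (u * k1 x)) (\<lambda>x. cnj (u * k2 x))))^2 = (norm (spinor_of k1 k2))^2"
    unfolding norm_spinor_of[OF Lc] norm_spinor_of[OF assms(1,2)] by (simp add: norm_mult u)
  then have "norm (spinor_of (\<lambda>x. cnj (u * k1 x)) (\<lambda>x. cnj (u * k2 x))) = norm (spinor_of k1 k2)"
    by (simp add: power2_eq_iff_nonneg)
  finally show ?thesis by (simp add: I_def mult.commute)
qed

lemma norm_sum4_square:
  "(cmod (a + b + c + d))^2 \<le> 4 * ((cmod a)^2 + (cmod b)^2 + (cmod c)^2 + (cmod d)^2)"
proof -
  have "(cmod (a + b + c + d))^2 \<le> (cmod a + cmod b + cmod c + cmod d)^2"
    by (intro power_mono) (auto intro!: norm_triangle_le norm_triangle_ineq add_mono order_trans[OF norm_triangle_ineq])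
  also have "\<dots> \<le> 4 * ((cmod a)^2 + (cmod b)^2 + (cmod c)^2 + (cmod d)^2)"
    using sum_squares_bound[of "cmod a" "cmod b"] sum_squares_bound[of "cmod a" "cmod c"] sum_squares_bound[of "cmod a" "cmod d"]
      sum_squares_bound[of "cmod b" "cmod c"] sum_squares_bound[of "cmod b" "cmod d"] sum_squares_bound[of "cmod c" "cmod d"]
    by (simp add: power2_eq_square algebra_simps)
  finally show ?thesis .
qed

lemma fwd_bwd_source_bound:
  assumes Re: "Re \<theta> > 0" and g: "L2_fun g1" "L2_fun g2" and A: "A \<in> sets borel" and r: "r \<noteq> 0"
  shows "(LBINT x. (cmod (fwd \<theta> (decaying_source A r g1 g2) x))^2) + (LBINT x. (cmod (bwd \<theta> (growing_source A r g1 g2) x))^2)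
     \<le> (1 / Re \<theta>)^2 * ((1 + 1 / (cmod r)^2) / 2) * (LBINT x. indicator A x * ((cmod (g1 x))^2 + (cmod (g2 x))^2))"
proof -
  note L = L2_fun_sources[OF g A, of r]
  let ?G = "\<lambda>x. (cmod (g1 x))^2 + (cmod (g2 x))^2"
  have iG: "integrable lborel (\<lambda>x. indicator A x * ?G x)"
    using g A by (intro integrable_real_mult_indicator[of A lborel ?G, unfolded mult.commute[of "?G _"]]) (auto simp: L2_fun_def)
  have "(LBINT x. (cmod (growing_source A r g1 g2 x))^2) + (LBINT x. (cmod (decaying_source A r g1 g2 x))^2)
      = (LBINT x. indicator A x * ((cmod (g2 x))^2 + (cmod (g1 x / r))^2) / 2)"
    using L by (subst Bochner_Integration.integral_add[symmetric]) (auto simp: L2_fun_def source_squares)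
  also have "\<dots> \<le> (LBINT x. ((1 + 1 / (cmod r)^2) / 2) * (indicator A x * ?G x))"
  proof (rule integral_mono)
    have "integrable lborel (\<lambda>x. (cmod (growing_source A r g1 g2 x))^2 + (cmod (decaying_source A r g1 g2 x))^2)"
      using L by (simp add: L2_fun_def)
    then show "integrable lborel (\<lambda>x. indicator A x * ((cmod (g2 x))^2 + (cmod (g1 x / r))^2) / 2)"
      by (simp only: source_squares)
    show "integrable lborel (\<lambda>x. ((1 + 1 / (cmod r)^2) / 2) * (indicator A x * ?G x))"
      using iG by (rule integrable_mult_right)
    fix x
    have "(cmod (g2 x))^2 + (cmod (g1 x / r))^2 \<le> (1 + 1 / (cmod r)^2) * ?G x"
      by (simp add: norm_divide power_divide algebra_simps)
    then show "indicator A x * ((cmod (g2 x))^2 + (cmod (g1 x / r))^2) / 2 \<le> ((1 + 1 / (cmod r)^2) / 2) * (indicator A x * ?G x)"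
      by (simp add: indicator_def)
  qed
  also have "\<dots> = ((1 + 1 / (cmod r)^2) / 2) * (LBINT x. indicator A x * ?G x)"
    by simp
  finally have S: "(LBINT x. (cmod (growing_source A r g1 g2 x))^2) + (LBINT x. (cmod (decaying_source A r g1 g2 x))^2)
     \<le> ((1 + 1 / (cmod r)^2) / 2) * (LBINT x. indicator A x * ?G x)" .
  show ?thesis
    using mult_left_mono[OF S zero_le_power2, of "1 / Re \<theta>"] fwd_L2(2)[OF Re L(2)] bwd_L2(2)[OF Re L(1)]
    unfolding distrib_left[of "(1 / Re \<theta>)^2"] mult.assoc by linarith
qed

text \<open>The solution of \<open>dirac_solution\<close> split into its main part, carried by the two decaying modes, and the
  rest \<open>R\<close>. The amplitudes are written as pairings of \<open>g\<close> with two-sided exponentials; in the regime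
  \<open>rn \<approx> - rp\<close> both \<open>q\<close> and \<open>q'\<close> are close to \<open>1\<close>, so that all four exponentials are almost the main part
  with \<open>A = B = 1\<close>.\<close>

lemma dirac_shift_solution:
  fixes m :: real and z \<theta>p \<theta>n rp rn :: complex
  assumes Re: "Re \<theta>p > 0" "Re \<theta>n > 0" and r: "rp \<noteq> 0" "rn \<noteq> 0" "rp + rn \<noteq> 0"
    and eqp: "rp * (of_real m + (z - \<i>)) = \<theta>p" "of_real m - (z - \<i>) = \<theta>p * rp"
    and eqn: "rn * (of_real m + (z + \<i>)) = \<theta>n" "of_real m - (z + \<i>) = \<theta>n * rn"
    and g: "L2_fun g1" "L2_fun g2"
    and C: "2 * (1 + (cmod rp)^2) * (1 + 1 / (cmod rp)^2) * (1 / Re \<theta>p)^2 \<le> C"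
      "2 * (1 + (cmod rn)^2) * (1 + 1 / (cmod rn)^2) * (1 / Re \<theta>n)^2 \<le> C"
  defines "q \<equiv> (rp - rn) / (2 * rp)" and "q' \<equiv> (rn - rp) / (2 * rn)"
  obtains F A B R where "F \<in> H1" "dirac_shift m z F = spinor_of g1 g2"
    and "F = spinor_of (two_sided \<theta>p \<theta>n A B) (two_sided \<theta>p \<theta>n (- rp * A) (rn * B)) + R"
    and "A * (rp + rn) = (LBINT x. two_sided \<theta>p \<theta>n q 1 x * g1 x + two_sided \<theta>p \<theta>n (- rp * q) rn x * g2 x)"
    and "B * (rp + rn) = (LBINT x. two_sided \<theta>p \<theta>n 1 q' x * g1 x + two_sided \<theta>p \<theta>n (- rp) (rn * q') x * g2 x)"
    and "(norm R)^2 \<le> C * (norm (spinor_of g1 g2))^2"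
proof -
  define Qp where "Qp = growing_source {0<..} rp g1 g2"
  define Pp where "Pp = decaying_source {0<..} rp g1 g2"
  define Qn where "Qn = growing_source {..<0} rn g1 g2"
  define Pn where "Pn = decaying_source {..<0} rn g1 g2"
  have src: "L2_fun Pp" "L2_fun Qp" "L2_fun Pn" "L2_fun Qn"
    unfolding Pp_def Qp_def Pn_def Qn_def by (intro L2_fun_sources g; simp)+
  define c where "c = fwd \<theta>n Pn 0"
  define d where "d = bwd \<theta>p Qp 0"
  define A where "A = (2 * rn * c - (rp - rn) * d) / (rp + rn)"
  define B where "B = ((rn - rp) * c - 2 * rp * d) / (rp + rn)"
  define h1 where "h1 x = fwd \<theta>p Pp x - indicator {0<..} x * bwd \<theta>p Qp x + indicator {..<0} x * fwd \<theta>n Pn x - bwd \<theta>n Qn x" for x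
  define h2 where "h2 x = - rp * fwd \<theta>p Pp x - rp * (indicator {0<..} x * bwd \<theta>p Qp x) - rn * (indicator {..<0} x * fwd \<theta>n Pn x) - rn * bwd \<theta>n Qn x" for x
  obtain f1 f2 f1' f2' where w: "weak_deriv f1 f1'" "weak_deriv f2 f2'"
    and pos: "\<And>x. x > 0 \<Longrightarrow> f1' x = (of_real m + (z - \<i>)) * f2 x + g2 x \<and> f2' x = (of_real m - (z - \<i>)) * f1 x - g1 x"
    and neg: "\<And>x. x < 0 \<Longrightarrow> f1' x = (of_real m + (z + \<i>)) * f2 x + g2 x \<and> f2' x = (of_real m - (z + \<i>)) * f1 x - g1 x"
    and f1: "\<And>x. x \<noteq> 0 \<Longrightarrow> f1 x = (A * decay \<theta>p x + B * decay \<theta>n (- x)) + h1 x"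
    and f2: "\<And>x. x \<noteq> 0 \<Longrightarrow> f2 x = (- rp * A * decay \<theta>p x + rn * B * decay \<theta>n (- x)) + h2 x"
    by (rule dirac_solution[OF Re r eqp eqn g Qp_def Pp_def Qn_def Pn_def c_def d_def A_def B_def h1_def h2_def]) (rule that, assumption+)
  have Lf: "L2_fun f1" "L2_fun f2" using w by (auto simp: weak_deriv_def)
  note Lfb = fwd_L2(1)[OF Re(1) src(1)] bwd_L2(1)[OF Re(1) src(2)] fwd_L2(1)[OF Re(2) src(3)] bwd_L2(1)[OF Re(2) src(4)]
  have Lh: "L2_fun h1" "L2_fun h2"
    unfolding h1_def [abs_def] h2_def [abs_def]
    by (intro L2_fun_add L2_fun_diff L2_fun_cmult L2_fun_cut Lfb; simp)+
  note Lt = L2_fun_two_sided[OF Re]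
  define F where "F = spinor_of f1 f2"
  define R where "R = spinor_of h1 h2"
  have nz: "AE x in lborel. x \<noteq> (0::real)"
    by (rule AE_lborel_singleton)
  have "F \<in> H1"
    unfolding F_def by (rule weak_derivative_spinor_of[OF w])
  moreover have "dirac_shift m z F = spinor_of g1 g2"
    unfolding F_def by (rule dirac_shift_eqI[OF w g pos neg])
  moreover have "F = spinor_of (two_sided \<theta>p \<theta>n A B) (two_sided \<theta>p \<theta>n (- rp * A) (rn * B)) + R"
    unfolding F_def R_def spinor_of_add[OF Lt Lt Lh]
  proof (rule spinor_of_cong[OF Lf L2_fun_add[OF Lt Lh(1)] L2_fun_add[OF Lt Lh(2)]])
    show "AE x in lborel. f1 x = two_sided \<theta>p \<theta>n A B x + h1 x"
      using nz by eventually_elim (simp add: f1 two_sided_def)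
    show "AE x in lborel. f2 x = two_sided \<theta>p \<theta>n (- rp * A) (rn * B) x + h2 x"
      using nz by eventually_elim (simp add: f2 two_sided_def)
  qed
  moreover have
    AB: "A * (rp + rn) = (LBINT x. two_sided \<theta>p \<theta>n q 1 x * g1 x + two_sided \<theta>p \<theta>n (- rp * q) rn x * g2 x)"
      "B * (rp + rn) = (LBINT x. two_sided \<theta>p \<theta>n 1 q' x * g1 x + two_sided \<theta>p \<theta>n (- rp) (rn * q') x * g2 x)"
  proof -
    have Lr: "L2_fun (\<lambda>x. decay \<theta>n (- x))"
      using L2_fun_reflect[OF L2_fun_decay[OF Re(2)]] .
    have ic: "integrable lborel (\<lambda>y. decay \<theta>n (- y) * Pn y)" and id: "integrable lborel (\<lambda>y. decay \<theta>p y * Qp y)"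
      by (intro L2_fun_integrable_mult src Lr L2_fun_decay Re)+
    have [measurable]: "Pn \<in> borel_measurable borel" "Qp \<in> borel_measurable borel" "g1 \<in> borel_measurable borel" "g2 \<in> borel_measurable borel"
      "two_sided \<theta>p \<theta>n k l \<in> borel_measurable borel" for k l
      using src g Lt by (auto simp: L2_fun_def)
    have amplitude: "a * c - b * d = (LBINT x. two_sided \<theta>p \<theta>n (b / (2 * rp)) (a / (2 * rn)) x * g1 x
        + two_sided \<theta>p \<theta>n (- rp * (b / (2 * rp))) (rn * (a / (2 * rn))) x * g2 x)" for a b
    proof -
      have "a * c - b * d = (LBINT y. a * (decay \<theta>n (- y) * Pn y) - b * (decay \<theta>p y * Qp y))"
        using ic id by (simp add: c_def d_def fwd_at_zero bwd_at_zero)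
      also have "\<dots> = (LBINT x. two_sided \<theta>p \<theta>n (b / (2 * rp)) (a / (2 * rn)) x * g1 x
          + two_sided \<theta>p \<theta>n (- rp * (b / (2 * rp))) (rn * (a / (2 * rn))) x * g2 x)"
      proof (rule integral_cong_AE)
        show "AE y in lborel. a * (decay \<theta>n (- y) * Pn y) - b * (decay \<theta>p y * Qp y)
            = two_sided \<theta>p \<theta>n (b / (2 * rp)) (a / (2 * rn)) y * g1 y
              + two_sided \<theta>p \<theta>n (- rp * (b / (2 * rp))) (rn * (a / (2 * rn))) y * g2 y"
          using nz
        proof eventually_elim
          fix y :: real assume "y \<noteq> 0"
          then consider "y > 0" "decay \<theta>n (- y) = 0" | "y < 0" "decay \<theta>p y = 0"
            by (cases "y > 0") (auto simp: decay_def)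
          then show "a * (decay \<theta>n (- y) * Pn y) - b * (decay \<theta>p y * Qp y)
            = two_sided \<theta>p \<theta>n (b / (2 * rp)) (a / (2 * rn)) y * g1 y
              + two_sided \<theta>p \<theta>n (- rp * (b / (2 * rp))) (rn * (a / (2 * rn))) y * g2 y"
            using r by cases (simp_all add: Pn_def Qp_def decaying_source_def growing_source_def two_sided_def field_simps)
        qed
      qed measurable
      finally show ?thesis .
    qed
    show "A * (rp + rn) = (LBINT x. two_sided \<theta>p \<theta>n q 1 x * g1 x + two_sided \<theta>p \<theta>n (- rp * q) rn x * g2 x)"
      using amplitude[of "2 * rn" "rp - rn"] r by (simp add: A_def q_def)
    show "B * (rp + rn) = (LBINT x. two_sided \<theta>p \<theta>n 1 q' x * g1 x + two_sided \<theta>p \<theta>n (- rp) (rn * q') x * g2 x)"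
      using amplitude[of "rn - rp" "2 * rp"] r by (simp add: B_def q'_def)
  qed
  moreover have "(norm R)^2 \<le> C * (norm (spinor_of g1 g2))^2"
  proof -
    let ?G = "\<lambda>x. (cmod (g1 x))^2 + (cmod (g2 x))^2"
    have iG: "integrable lborel (\<lambda>x. indicator A x * ?G x)" if "A \<in> sets borel" for A :: "real set"
      using g that by (intro integrable_real_mult_indicator[of A lborel ?G, unfolded mult.commute[of "?G _"]]) (auto simp: L2_fun_def)
    define Ip where "Ip = (LBINT x. indicator {0<..} x * ?G x)"
    define In where "In = (LBINT x. indicator {..<0} x * ?G x)"
    have I0: "Ip \<ge> 0" "In \<ge> 0" unfolding Ip_def In_def by (intro Bochner_Integration.integral_nonneg; simp)+
    have II: "Ip + In \<le> (norm (spinor_of g1 g2))^2"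
    proof -
      have "Ip + In = (LBINT x. indicator {0<..} x * ?G x + indicator {..<0} x * ?G x)"
        unfolding Ip_def In_def by (rule Bochner_Integration.integral_add[symmetric]) (intro iG; simp)+
      also have "\<dots> \<le> (LBINT x. ?G x)"
      proof (rule integral_mono)
        show "integrable lborel (\<lambda>x. indicator {0<..} x * ?G x + indicator {..<0} x * ?G x)"
          by (intro Bochner_Integration.integrable_add iG; simp)
        show "integrable lborel ?G" using g by (simp add: L2_fun_def)
      qed (auto simp: indicator_def)
      finally show ?thesis using g by (simp add: norm_spinor_of L2_fun_def)
    qed
    have Bp: "(LBINT x. (cmod (fwd \<theta>p Pp x))^2) + (LBINT x. (cmod (bwd \<theta>p Qp x))^2)
       \<le> (1 / Re \<theta>p)^2 * ((1 + 1 / (cmod rp)^2) / 2) * Ip"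
      unfolding Pp_def Qp_def Ip_def by (rule fwd_bwd_source_bound[OF Re(1) g _ r(1)]) simp
    have Bn: "(LBINT x. (cmod (fwd \<theta>n Pn x))^2) + (LBINT x. (cmod (bwd \<theta>n Qn x))^2)
       \<le> (1 / Re \<theta>n)^2 * ((1 + 1 / (cmod rn)^2) / 2) * In"
      unfolding Pn_def Qn_def In_def by (rule fwd_bwd_source_bound[OF Re(2) g _ r(2)]) simp
    let ?V = "\<lambda>x. 4 * (1 + (cmod rp)^2) * ((cmod (fwd \<theta>p Pp x))^2 + (cmod (bwd \<theta>p Qp x))^2)
        + 4 * (1 + (cmod rn)^2) * ((cmod (fwd \<theta>n Pn x))^2 + (cmod (bwd \<theta>n Qn x))^2)"
    have sq: "integrable lborel (\<lambda>x. (cmod (fwd \<theta>p Pp x))^2)" "integrable lborel (\<lambda>x. (cmod (bwd \<theta>p Qp x))^2)"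
      "integrable lborel (\<lambda>x. (cmod (fwd \<theta>n Pn x))^2)" "integrable lborel (\<lambda>x. (cmod (bwd \<theta>n Qn x))^2)"
      using Lfb by (auto simp: L2_fun_def)
    have pt: "(cmod (h1 x))^2 + (cmod (h2 x))^2 \<le> ?V x" for x
    proof -
      define a b e k where abek: "a = fwd \<theta>p Pp x" "b = indicator {0<..} x * bwd \<theta>p Qp x"
        "e = indicator {..<0} x * fwd \<theta>n Pn x" "k = bwd \<theta>n Qn x"
      have "(cmod (h1 x))^2 \<le> 4 * ((cmod a)^2 + (cmod b)^2 + (cmod e)^2 + (cmod k)^2)"
        using norm_sum4_square[of a "- b" e "- k"] by (simp add: h1_def abek)
      moreover have "(cmod (h2 x))^2 \<le> 4 * ((cmod rp)^2 * (cmod a)^2 + (cmod rp)^2 * (cmod b)^2 + (cmod rn)^2 * (cmod e)^2 + (cmod rn)^2 * (cmod k)^2)"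
        using norm_sum4_square[of "- rp * a" "- rp * b" "- rn * e" "- rn * k"]
        by (simp add: h2_def abek norm_mult power_mult_distrib)
      ultimately have "(cmod (h1 x))^2 + (cmod (h2 x))^2 \<le> 4 * (1 + (cmod rp)^2) * ((cmod a)^2 + (cmod b)^2)
        + 4 * (1 + (cmod rn)^2) * ((cmod e)^2 + (cmod k)^2)"
        by (simp add: algebra_simps)
      also have "\<dots> \<le> ?V x"
        unfolding abek by (intro add_mono mult_left_mono order_refl) (auto simp: indicator_def)
      finally show ?thesis .
    qed
    have "(norm R)^2 = (LBINT x. (cmod (h1 x))^2 + (cmod (h2 x))^2)"
      using Lh by (simp add: R_def norm_spinor_of L2_fun_def)
    also have "\<dots> \<le> (LBINT x. ?V x)"
      by (rule integral_mono[OF _ _ pt]) (use Lh sq in \<open>auto simp: L2_fun_def\<close>)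
    also have "\<dots> = 4 * (1 + (cmod rp)^2) * ((LBINT x. (cmod (fwd \<theta>p Pp x))^2) + (LBINT x. (cmod (bwd \<theta>p Qp x))^2))
        + 4 * (1 + (cmod rn)^2) * ((LBINT x. (cmod (fwd \<theta>n Pn x))^2) + (LBINT x. (cmod (bwd \<theta>n Qn x))^2))"
      using sq by simp
    also have "\<dots> \<le> 4 * (1 + (cmod rp)^2) * ((1 / Re \<theta>p)^2 * ((1 + 1 / (cmod rp)^2) / 2) * Ip)
        + 4 * (1 + (cmod rn)^2) * ((1 / Re \<theta>n)^2 * ((1 + 1 / (cmod rn)^2) / 2) * In)"
      by (intro add_mono mult_left_mono Bp Bn) auto
    also have "\<dots> = (2 * (1 + (cmod rp)^2) * (1 + 1 / (cmod rp)^2) * (1 / Re \<theta>p)^2) * Ip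
        + (2 * (1 + (cmod rn)^2) * (1 + 1 / (cmod rn)^2) * (1 / Re \<theta>n)^2) * In"
    proof -
      have "4 * a * (b * (c / 2) * I) = (2 * a * c * b) * I" for a b c I :: real
        by simp
      then show ?thesis by (simp only:)
    qed
    also have "\<dots> \<le> C * Ip + C * In"
      by (intro add_mono mult_right_mono C I0)
    also have "\<dots> \<le> C * (norm (spinor_of g1 g2))^2"
    proof -
      have "0 \<le> 2 * (1 + (cmod rp)^2) * (1 + 1 / (cmod rp)^2) * (1 / Re \<theta>p)^2" by simp
      then have "C \<ge> 0" using C(1) by linarith
      from mult_left_mono[OF II this] show ?thesis by (simp add: distrib_left)
    qed
    finally show ?thesis .
  qed
  ultimately show ?thesis by (rule that)
qed

section \<open>The decaying modes\<close>

text \<open>The decay rate \<open>\<theta>\<close> with \<open>\<theta>^2 = m^2 - w^2\<close> is written as \<open>\<plusminus> \<i> s (w + m)\<close>, where \<open>s\<close> is a square root of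
  \<open>(w - m) / (w + m)\<close>. The principal root tends to \<open>1\<close> as \<open>w\<close> tends to infinity in either direction of a
  horizontal strip. The sign in \<open>mode_ratio\<close> is the one for which \<open>Re \<theta> > 0\<close>.\<close>

definition mode_sqrt :: "real \<Rightarrow> complex \<Rightarrow> complex" where
  "mode_sqrt m w = csqrt ((w - of_real m) / (w + of_real m))"

definition mode_ratio :: "real \<Rightarrow> complex \<Rightarrow> complex" where
  "mode_ratio m w = (if Im w > 0 then - \<i> else \<i>) * mode_sqrt m w"

text \<open>Put \<open>k = s (w + m)\<close>. Since \<open>k^2 = w^2 - m^2\<close>, the products \<open>Re k * Im k\<close> and \<open>Re w * Im w\<close> agree. As
  \<open>Re s > 0\<close> means that \<open>k\<close> has a positive inner product with \<open>w + m\<close> in the plane, and \<open>Re w + m\<close> has the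
  sign of \<open>Re w\<close> for \<open>\<bar>Re w\<bar> > m\<close>, both \<open>Re k * Re w\<close> and \<open>Im k * Im w\<close> must be positive. For \<open>m = 0\<close> the root is \<open>1\<close>.\<close>

lemma mode_sqrt:
  assumes m: "m \<ge> 0" and w: "Im w \<noteq> 0" and cond: "m = 0 \<or> \<bar>Re w\<bar> > m"
  shows "w + of_real m \<noteq> 0" "(mode_sqrt m w)^2 * (w + of_real m) = w - of_real m" "Re (mode_sqrt m w) > 0"
    and "Im (mode_sqrt m w * (w + of_real m)) * Im w > 0"
    and "Re (mode_sqrt m w * (w + of_real m)) * Im (mode_sqrt m w * (w + of_real m)) = Re w * Im w"
proof -
  define s where "s = mode_sqrt m w"
  show nz: "w + of_real m \<noteq> 0"
    using w by (auto simp: complex_eq_iff)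
  show sq: "(mode_sqrt m w)^2 * (w + of_real m) = w - of_real m"
    using nz by (simp add: mode_sqrt_def)
  then have sq': "s^2 * (w + of_real m) = w - of_real m"
    by (simp add: s_def)
  have "Re s \<noteq> 0"
  proof
    assume "Re s = 0"
    then have "s^2 = of_real (- ((Im s)^2))"
      by (simp add: complex_eq_iff power2_eq_square)
    with sq' have "Im (of_real (- ((Im s)^2)) * (w + of_real m)) = Im (w - of_real m)"
      by (simp only:)
    then have "(1 + (Im s)^2) * Im w = 0"
      by (simp add: algebra_simps)
    then have "1 + (Im s)^2 = 0" using w by simp
    moreover have "0 \<le> (Im s)^2" by simp
    ultimately show False by linarith
  qed
  moreover have "Re s \<ge> 0"
    unfolding s_def mode_sqrt_def using csqrt_principal[of "(w - of_real m) / (w + of_real m)"] by auto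
  ultimately have Res: "Re s > 0" by simp
  then show "Re (mode_sqrt m w) > 0" by (simp add: s_def)
  define k where "k = s * (w + of_real m)"
  have k2: "k^2 = w^2 - (of_real m)^2"
  proof -
    have "k^2 = (s^2 * (w + of_real m)) * (w + of_real m)"
      by (simp add: k_def power2_eq_square)
    also have "\<dots> = w^2 - (of_real m)^2"
      unfolding sq' by (simp add: power2_eq_square algebra_simps)
    finally show ?thesis .
  qed
  have cd: "Re k * Im k = Re w * Im w"
    using arg_cong[OF k2, of Im] by (simp add: power2_eq_square mult.commute flip: of_real_power)
  then show "Re (mode_sqrt m w * (w + of_real m)) * Im (mode_sqrt m w * (w + of_real m)) = Re w * Im w"
    by (simp only: k_def s_def)
  have pos: "Re k * (Re w + m) + Im k * Im w > 0"
  proof -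
    have "k * cnj (w + of_real m) = s * of_real ((cmod (w + of_real m))^2)"
      by (simp only: k_def mult.assoc complex_norm_square)
    then have "Re (k * cnj (w + of_real m)) = Re s * (cmod (w + of_real m))^2"
      by simp
    moreover have "(cmod (w + of_real m))^2 > 0" using nz by simp
    ultimately have "Re (k * cnj (w + of_real m)) > 0" using Res by simp
    then show ?thesis by simp
  qed
  have "Im k * Im w > 0"
  proof (rule ccontr)
    assume neg: "\<not> Im k * Im w > 0"
    show False
    proof (cases "m = 0")
      case True
      then have "w * (s^2 - 1) = 0" using sq' by (simp add: algebra_simps)
      then have "s^2 = 1" using w by auto
      then have "s = 1" using Res by (auto simp: power2_eq_1_iff)
      then have "k = w" using True by (simp add: k_def)
      with neg w show False by (simp add: zero_less_mult_iff)
    next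
      case False
      with cond m have t: "\<bar>Re w\<bar> > m" "m > 0" by auto
      then have "Re w * Im w \<noteq> 0" using w by auto
      then have k0: "Re k \<noteq> 0" "Im k \<noteq> 0" using cd by auto
      have lt: "Im k * Im w < 0" using neg k0 w by (meson linorder_neqE_linordered_idom mult_eq_0_iff)
      then have "Re k * (Re w + m) > 0" using pos by linarith
      moreover have "(Re k * Re w) * (Im k * Im w) = (Re w * Im w)^2"
        using cd by (simp add: power2_eq_square)
      then have "(Re k * Re w) * (Im k * Im w) > 0"
        using \<open>Re w * Im w \<noteq> 0\<close> by simp
      then have "Re k * Re w < 0"
        using lt mult_nonneg_nonpos[of "Re k * Re w" "Im k * Im w"] by linarith
      ultimately show False
        using t unfolding zero_less_mult_iff mult_less_0_iff by linarith
    qed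
  qed
  then show "Im (mode_sqrt m w * (w + of_real m)) * Im w > 0"
    by (simp add: k_def s_def)
qed

lemma mode_ratio:
  assumes "m \<ge> 0" "Im w \<noteq> 0" "m = 0 \<or> \<bar>Re w\<bar> > m"
  shows "mode_ratio m w \<noteq> 0" "Re (mode_ratio m w * (of_real m + w)) > 0"
    "of_real m - w = mode_ratio m w * (of_real m + w) * mode_ratio m w"
proof -
  note s = mode_sqrt[OF assms]
  show "mode_ratio m w \<noteq> 0"
    using s(3) by (auto simp: mode_ratio_def)
  have "Re (mode_ratio m w * (of_real m + w)) = (if Im w > 0 then 1 else - 1) * Im (mode_sqrt m w * (w + of_real m))"
    by (simp add: mode_ratio_def algebra_simps)
  then show "Re (mode_ratio m w * (of_real m + w)) > 0"
    using s(4) assms(2) by (auto simp: zero_less_mult_iff)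
  have "(mode_ratio m w)^2 = - ((mode_sqrt m w)^2)"
    by (simp add: mode_ratio_def power_mult_distrib)
  then have "mode_ratio m w * (of_real m + w) * mode_ratio m w = - ((mode_sqrt m w)^2 * (w + of_real m))"
    by (simp add: power2_eq_square algebra_simps)
  then show "of_real m - w = mode_ratio m w * (of_real m + w) * mode_ratio m w"
    using s(2) by simp
qed

text \<open>For \<open>\<bar>Im z\<bar> > 1\<close> the signs on the two sides agree and the real parts of the roots add up. For
  \<open>\<bar>Im z\<bar> < 1\<close> a vanishing sum means equal roots, hence \<open>(w - m) / (w + m)\<close> would be equal for
  \<open>w = z - \<i>\<close> and \<open>w = z + \<i>\<close>, which is impossible for \<open>m > 0\<close>.\<close>

lemma mode_ratio_sum_nonzero:
  assumes m: "m \<ge> 0" and z: "\<bar>Im z\<bar> \<noteq> 1" "m = 0 \<longrightarrow> \<bar>Im z\<bar> > 1" "m > 0 \<longrightarrow> \<bar>Re z\<bar> > m"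
  shows "mode_ratio m (z - \<i>) + mode_ratio m (z + \<i>) \<noteq> 0"
proof -
  have p: "Im (z - \<i>) \<noteq> 0" "m = 0 \<or> \<bar>Re (z - \<i>)\<bar> > m" "Im (z + \<i>) \<noteq> 0" "m = 0 \<or> \<bar>Re (z + \<i>)\<bar> > m"
    using z m by auto
  note sp = mode_sqrt[OF m p(1,2)] and sn = mode_sqrt[OF m p(3,4)]
  show ?thesis
  proof (cases "\<bar>Im z\<bar> > 1")
    case True
    then have "(Im (z - \<i>) > 0) = (Im (z + \<i>) > 0)" by auto
    moreover have "mode_sqrt m (z - \<i>) + mode_sqrt m (z + \<i>) \<noteq> 0"
      using sp(3) sn(3) by (metis add_pos_pos order_less_irrefl plus_complex.sel(1) zero_complex.sel(1))
    ultimately show ?thesis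
      by (simp add: mode_ratio_def distrib_left[symmetric])
  next
    case False
    with z m have mp: "m > 0" "\<bar>Im z\<bar> < 1" by auto
    show ?thesis
    proof
      assume "mode_ratio m (z - \<i>) + mode_ratio m (z + \<i>) = 0"
      then have "mode_sqrt m (z - \<i>) = mode_sqrt m (z + \<i>)"
        using mp by (simp add: mode_ratio_def abs_less_iff)
      then have "(mode_sqrt m (z + \<i>))^2 * (z - \<i> + of_real m) = z - \<i> - of_real m"
        "(mode_sqrt m (z + \<i>))^2 * (z + \<i> + of_real m) = z + \<i> - of_real m"
        using sp(2) sn(2) by simp_all
      then have "(z - \<i> - of_real m) * (z + \<i> + of_real m) = (z + \<i> - of_real m) * (z - \<i> + of_real m)"
        by algebra
      then have "\<i> * of_real m = 0" by (simp add: algebra_simps)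
      then show False using mp by simp
    qed
  qed
qed

lemma dirac_shift_surjective:
  assumes m: "m \<ge> 0" and z: "\<bar>Im z\<bar> \<noteq> 1" "m = 0 \<longrightarrow> \<bar>Im z\<bar> > 1" "m > 0 \<longrightarrow> \<bar>Re z\<bar> > m"
  shows "\<exists>F\<in>H1. dirac_shift m z F = G"
proof -
  obtain g1 g2 where g: "L2_fun g1" "L2_fun g2" "G = spinor_of g1 g2"
    by (rule spinor_cases)
  have p: "Im (z - \<i>) \<noteq> 0" "m = 0 \<or> \<bar>Re (z - \<i>)\<bar> > m" "Im (z + \<i>) \<noteq> 0" "m = 0 \<or> \<bar>Re (z + \<i>)\<bar> > m"
    using z m by auto
  note rp = mode_ratio[OF m p(1,2)] and rn = mode_ratio[OF m p(3,4)]
  obtain f1 f2 f1' f2' where w: "weak_deriv f1 f1'" "weak_deriv f2 f2'"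
    and pos: "\<And>x. x > 0 \<Longrightarrow> f1' x = (of_real m + (z - \<i>)) * f2 x + g2 x \<and> f2' x = (of_real m - (z - \<i>)) * f1 x - g1 x"
    and neg: "\<And>x. x < 0 \<Longrightarrow> f1' x = (of_real m + (z + \<i>)) * f2 x + g2 x \<and> f2' x = (of_real m - (z + \<i>)) * f1 x - g1 x"
    by (rule dirac_solution[OF rp(2) rn(2) rp(1) rn(1) mode_ratio_sum_nonzero[OF m z] refl rp(3) refl rn(3) g(1,2)
          refl refl refl refl refl refl refl refl refl refl]) (rule that, assumption+)
  have "dirac_shift m z (spinor_of f1 f2) = G"
    unfolding g(3) by (rule dirac_shift_eqI[OF w g(1,2) pos neg])
  then show ?thesis
    using weak_derivative_spinor_of(1)[OF w] by blast
qed

lemma resolvent_outside_strip: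
  assumes m: "m \<ge> 0" and z: "\<bar>Im z\<bar> > 1" "m > 0 \<longrightarrow> \<bar>Re z\<bar> > m"
  shows "z \<in> resolvent_set H1 (dirac m)" "onorm (resolvent H1 (dirac m) z) \<le> 1 / (\<bar>Im z\<bar> - 1)"
proof -
  have K: "0 \<le> 1 / (\<bar>Im z\<bar> - 1)" using z by simp
  have sol: "\<exists>F\<in>H1. dirac_shift m z F = G \<and> norm F \<le> 1 / (\<bar>Im z\<bar> - 1) * norm G" for G
  proof -
    have "\<bar>Im z\<bar> \<noteq> 1" "m = 0 \<longrightarrow> \<bar>Im z\<bar> > 1" using z by auto
    then obtain F where "F \<in> H1" "dirac_shift m z F = G"
      using dirac_shift_surjective[OF m _ _ z(2)] by blast
    moreover from this have "norm F \<le> 1 / (\<bar>Im z\<bar> - 1) * norm G"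
      using numerical_range_bound[of F z m] z by (simp add: field_simps)
    ultimately show ?thesis by blast
  qed
  show "z \<in> resolvent_set H1 (dirac m)" "onorm (resolvent H1 (dirac m) z) \<le> 1 / (\<bar>Im z\<bar> - 1)"
    by (rule resolvent_setI[OF K sol])+
qed

section \<open>The resolvent inside the strip, far from the imaginary axis\<close>

text \<open>The exact relations behind the asymptotics: up to factors \<open>sp\<close>, \<open>sn\<close>, \<open>gp\<close>, \<open>gn\<close>, all of which tend
  to \<open>1\<close>, the decay rates are \<open>1 - Im z\<close> and \<open>1 + Im z\<close>, and the determinant is \<open>2 m / (Re z)^2\<close>. The last
  equation follows from \<open>sp^2 - sn^2 = (sp + sn) (sp - sn)\<close>.\<close>

lemma strip_parameters:
  fixes m :: real and z :: complex
  assumes m: "m > 0" and z: "\<bar>Im z\<bar> < 1" "\<bar>Re z\<bar> > m"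
  defines "sp \<equiv> mode_sqrt m (z - \<i>)" and "sn \<equiv> mode_sqrt m (z + \<i>)"
    and "gp \<equiv> (z - \<i> + of_real m) / of_real (Re z)" and "gn \<equiv> (z + \<i> + of_real m) / of_real (Re z)"
  shows "mode_ratio m (z - \<i>) = \<i> * sp" "mode_ratio m (z + \<i>) = - \<i> * sn"
    and "Re (mode_ratio m (z - \<i>) * (of_real m + (z - \<i>))) * Re (sp * gp) = 1 - Im z"
    and "Re (mode_ratio m (z + \<i>) * (of_real m + (z + \<i>))) * Re (sn * gn) = 1 + Im z"
    and "(mode_ratio m (z - \<i>) + mode_ratio m (z + \<i>)) * ((sp + sn) * gp * gn) * of_real ((Re z)^2) = of_real (4 * m)"
proof -
  define t where "t = Re z"
  have t0: "t \<noteq> 0" using z m by (auto simp: t_def)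
  have p: "Im (z - \<i>) \<noteq> 0" "m = 0 \<or> \<bar>Re (z - \<i>)\<bar> > m" "Im (z + \<i>) \<noteq> 0" "m = 0 \<or> \<bar>Re (z + \<i>)\<bar> > m"
    using z m by auto
  have m0: "m \<ge> 0" using m by simp
  note SP = mode_sqrt[OF m0 p(1,2), folded sp_def] and SN = mode_sqrt[OF m0 p(3,4), folded sn_def]
  show rp: "mode_ratio m (z - \<i>) = \<i> * sp" and rn: "mode_ratio m (z + \<i>) = - \<i> * sn"
    using z by (auto simp: mode_ratio_def sp_def sn_def)
  have gp: "z - \<i> + of_real m = of_real t * gp" and gn: "z + \<i> + of_real m = of_real t * gn"
    using t0 by (simp_all add: gp_def gn_def t_def)
  have "Re (sp * (of_real t * gp)) = t * Re (sp * gp)" "Re (sn * (of_real t * gn)) = t * Re (sn * gn)"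
    by (simp_all add: algebra_simps)
  then have "t * Re (sp * gp) * Im (sp * (of_real t * gp)) = t * (Im z - 1)"
    "t * Re (sn * gn) * Im (sn * (of_real t * gn)) = t * (Im z + 1)"
    using SP(5) SN(5) unfolding gp gn by (simp_all add: t_def)
  then have A: "Re (sp * gp) * Im (sp * (of_real t * gp)) = Im z - 1" "Re (sn * gn) * Im (sn * (of_real t * gn)) = Im z + 1"
    using t0 by (simp_all only: mult.assoc mult_cancel_left simp_thms)
  have B: "Re (mode_ratio m (z - \<i>) * (of_real m + (z - \<i>))) = - Im (sp * (of_real t * gp))"
    "Re (mode_ratio m (z + \<i>) * (of_real m + (z + \<i>))) = Im (sn * (of_real t * gn))"
    unfolding rp rn gp[symmetric] gn[symmetric] by (simp_all add: algebra_simps)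
  show "Re (mode_ratio m (z - \<i>) * (of_real m + (z - \<i>))) * Re (sp * gp) = 1 - Im z"
    unfolding B
  proof -
    have "- y * x = 1 - d" if "x * y = d - 1" for x y d :: real
      using that by algebra
    from this[OF A(1)] show "- Im (sp * (of_real t * gp)) * Re (sp * gp) = 1 - Im z" .
  qed
  show "Re (mode_ratio m (z + \<i>) * (of_real m + (z + \<i>))) * Re (sn * gn) = 1 + Im z"
    unfolding B using A(2) by (simp only: mult.commute add.commute)
  have "(\<i> * sp + - \<i> * sn) * ((sp + sn) * (z - \<i> + of_real m) * (z + \<i> + of_real m)) = of_real (4 * m)"
  proof -
    have "(\<i> * sp + - \<i> * sn) * ((sp + sn) * (z - \<i> + of_real m) * (z + \<i> + of_real m))
      = \<i> * ((sp^2 * (z - \<i> + of_real m)) * (z + \<i> + of_real m) - (sn^2 * (z + \<i> + of_real m)) * (z - \<i> + of_real m))"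
      by (simp add: power2_eq_square algebra_simps)
    also have "\<dots> = of_real (4 * m)"
      unfolding SP(2) SN(2) by (simp add: algebra_simps)
    finally show ?thesis .
  qed
  then show "(mode_ratio m (z - \<i>) + mode_ratio m (z + \<i>)) * ((sp + sn) * gp * gn) * of_real ((Re z)^2) = of_real (4 * m)"
    unfolding rp rn gp gn t_def[symmetric] by (simp add: power2_eq_square mult_ac)
qed

text \<open>The filter of \<open>\<bar>Re z\<bar> \<rightarrow> \<infinity>\<close> inside the open strip. Convergence along it is uniform in \<open>Im z\<close>.\<close>

definition strip_infinity :: "complex filter" where
  "strip_infinity = inf (filtercomap (\<lambda>z. \<bar>Re z\<bar>) at_top) (principal {z. \<bar>Im z\<bar> < 1})"

lemma eventually_strip_infinity:
  "eventually P strip_infinity \<longleftrightarrow> (\<exists>M. \<forall>z. M < \<bar>Re z\<bar> \<and> \<bar>Im z\<bar> < 1 \<longrightarrow> P z)"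
  by (auto simp: strip_infinity_def eventually_inf_principal eventually_filtercomap_at_top_dense)

lemma inverse_Re_strip_infinity: "((\<lambda>z. c / \<bar>Re z\<bar>) \<longlongrightarrow> 0) strip_infinity"
proof -
  have "filterlim (\<lambda>z. \<bar>Re z\<bar>) at_top strip_infinity"
    unfolding strip_infinity_def by (rule filterlim_mono[OF filterlim_filtercomap order_refl inf_le1])
  then show ?thesis
    by (rule real_tendsto_divide_at_top[OF tendsto_const])
qed

text \<open>The quotient and the radicand in \<open>mode_sqrt\<close> differ from \<open>1\<close> by terms of order \<open>1 / \<bar>Re z\<bar>\<close>.\<close>

lemma strip_limits:
  fixes m :: real and c :: complex
  assumes m: "m > 0" and c: "Re c = 0" "\<bar>Im c\<bar> \<le> 1"
  shows "((\<lambda>z. (z + c + of_real m) / of_real (Re z)) \<longlongrightarrow> 1) strip_infinity"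
    and "((\<lambda>z. mode_sqrt m (z + c)) \<longlongrightarrow> 1) strip_infinity"
proof -
  have ev: "\<forall>\<^sub>F z in strip_infinity. \<bar>Re z\<bar> > m \<and> \<bar>Im z\<bar> < 1"
    by (auto simp: eventually_strip_infinity)
  show g: "((\<lambda>z. (z + c + of_real m) / of_real (Re z)) \<longlongrightarrow> 1) strip_infinity"
  proof (rule LIM_zero_cancel, rule Lim_null_comparison[OF _ inverse_Re_strip_infinity])
    show "\<forall>\<^sub>F z in strip_infinity. norm ((z + c + of_real m) / of_real (Re z) - 1) \<le> (2 + m) / \<bar>Re z\<bar>"
      using ev
    proof eventually_elim
      fix z :: complex assume z: "\<bar>Re z\<bar> > m \<and> \<bar>Im z\<bar> < 1"
      then have nz: "Re z \<noteq> 0" using m by auto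
      have "(z + c + of_real m) - of_real (Re z) = of_real m + \<i> * of_real (Im z + Im c)"
        using c by (simp add: complex_eq_iff)
      then have "(z + c + of_real m) / of_real (Re z) - 1 = (of_real m + \<i> * of_real (Im z + Im c)) / of_real (Re z)"
        using nz by (simp add: field_simps)
      moreover have "cmod (of_real m + \<i> * of_real (Im z + Im c)) \<le> 2 + m"
      proof -
        have "\<bar>Im z + Im c\<bar> \<le> 2" using z c(2) by linarith
        then show ?thesis
          using norm_triangle_ineq[of "complex_of_real m" "\<i> * of_real (Im z + Im c)"] m
          by (simp add: norm_mult del: of_real_add)
      qed
      ultimately show "norm ((z + c + of_real m) / of_real (Re z) - 1) \<le> (2 + m) / \<bar>Re z\<bar>"
        by (simp add: norm_divide divide_right_mono)
    qed
  qed
  have "((\<lambda>z. 1 - of_real (2 * m) / of_real (Re z) / ((z + c + of_real m) / of_real (Re z))) \<longlongrightarrow> 1 - 0 / 1) strip_infinity"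
  proof (intro tendsto_intros g)
    show "((\<lambda>z. complex_of_real (2 * m) / of_real (Re z)) \<longlongrightarrow> 0) strip_infinity"
    proof (rule tendsto_norm_zero_cancel)
      show "((\<lambda>z. norm (complex_of_real (2 * m) / of_real (Re z))) \<longlongrightarrow> 0) strip_infinity"
        using inverse_Re_strip_infinity[of "2 * m"] m by (simp add: norm_divide norm_mult)
    qed
  qed simp
  moreover have "\<forall>\<^sub>F z in strip_infinity. 1 - of_real (2 * m) / of_real (Re z) / ((z + c + of_real m) / of_real (Re z))
      = (z + c - of_real m) / (z + c + of_real m)"
    using ev
  proof eventually_elim
    fix z :: complex assume z: "\<bar>Re z\<bar> > m \<and> \<bar>Im z\<bar> < 1"
    then have "Re (z + c + of_real m) \<noteq> 0" using c m by auto
    then have "z + c + of_real m \<noteq> 0" "Re z \<noteq> 0" using z m by (auto simp: complex_eq_iff)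
    then show "1 - of_real (2 * m) / of_real (Re z) / ((z + c + of_real m) / of_real (Re z))
      = (z + c - of_real m) / (z + c + of_real m)"
      by (simp add: field_simps)
  qed
  ultimately have "((\<lambda>z. (z + c - of_real m) / (z + c + of_real m)) \<longlongrightarrow> 1) strip_infinity"
    by (simp add: tendsto_cong)
  then have "((\<lambda>z. csqrt ((z + c - of_real m) / (z + c + of_real m))) \<longlongrightarrow> csqrt 1) strip_infinity"
    by (intro isCont_tendsto_compose[of _ csqrt] continuous_at_csqrt) auto
  then show "((\<lambda>z. mode_sqrt m (z + c)) \<longlongrightarrow> 1) strip_infinity"
    by (simp add: mode_sqrt_def)
qed

text \<open>The limiting profile of the resolvent norm inside the strip.\<close>

definition strip_scale :: "real \<Rightarrow> complex \<Rightarrow> real" where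
  "strip_scale m z = (Re z)^2 / (m * (1 - (Im z)^2))"

definition resolvent_norm_near :: "real \<Rightarrow> real \<Rightarrow> complex \<Rightarrow> bool" where
  "resolvent_norm_near m \<alpha> z \<longleftrightarrow> z \<in> resolvent_set H1 (dirac m) \<and>
     (1 - \<alpha>) * strip_scale m z < onorm (resolvent H1 (dirac m) z) \<and>
     onorm (resolvent H1 (dirac m) z) \<le> (1 + \<alpha>) * strip_scale m z"

text \<open>\<open>Np\<close> and \<open>Nn\<close> are the squared norms of the two halves of the almost-eigenfunction and \<open>S\<close> is the
  determinant. By the Cauchy-Schwarz inequality \<open>\<bar>A S\<bar>\<close> and \<open>\<bar>B S\<bar>\<close> are at most about
  \<open>sqrt N * \<parallel>g\<parallel>\<close> with \<open>N = Np + Nn\<close>, so the main part has norm at most about \<open>N / \<bar>S\<bar> * \<parallel>g\<parallel>\<close>, and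
  \<open>N / \<bar>S\<bar>\<close> is about \<open>T\<close>. Equality almost holds for the \<open>g\<close> used in the lower bound. The rest of the
  solution has norm at most \<open>15 / (1 - \<bar>Im z\<bar>) * \<parallel>g\<parallel>\<close>, which is negligible against \<open>T * \<parallel>g\<parallel>\<close> for large
  \<open>Re z\<close>, uniformly up to the boundary of the strip.\<close>

lemma strip_resolvent_bounds:
  fixes m \<eta> :: real and z :: complex
  assumes m: "m > 0" and z: "\<bar>Im z\<bar> < 1" "\<bar>Re z\<bar> > m" and \<eta>: "0 < \<eta>" "\<eta> < 1"
  defines "sp \<equiv> mode_sqrt m (z - \<i>)" and "sn \<equiv> mode_sqrt m (z + \<i>)"
    and "gp \<equiv> (z - \<i> + of_real m) / of_real (Re z)" and "gn \<equiv> (z + \<i> + of_real m) / of_real (Re z)"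
  assumes q: "cmod ((sp + sn) / (2 * sp) - 1) \<le> \<eta>" "cmod ((sp + sn) / (2 * sn) - 1) \<le> \<eta>"
    and vp: "1 - \<eta> \<le> (1 + (cmod sp)^2) * Re (sp * gp) / 2" "(1 + (cmod sp)^2) * Re (sp * gp) / 2 \<le> 1 + \<eta>"
    and vn: "1 - \<eta> \<le> (1 + (cmod sn)^2) * Re (sn * gn) / 2" "(1 + (cmod sn)^2) * Re (sn * gn) / 2 \<le> 1 + \<eta>"
    and t: "1 - \<eta> \<le> cmod ((sp + sn) * gp * gn) / 2" "cmod ((sp + sn) * gp * gn) / 2 \<le> 1 + \<eta>"
    and u: "0 < Re (sp * gp)" "Re (sp * gp) \<le> 2" "0 < Re (sn * gn)" "Re (sn * gn) \<le> 2"
    and s: "1 / 2 \<le> cmod sp" "cmod sp \<le> 2" "1 / 2 \<le> cmod sn" "cmod sn \<le> 2"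
    and large: "30 * m \<le> \<eta> * (Re z)^2"
  defines "T \<equiv> strip_scale m z"
  shows "z \<in> resolvent_set H1 (dirac m)"
    and "onorm (resolvent H1 (dirac m) z) \<le> ((1 + \<eta>) ^ 3 + \<eta>) * T"
    and "((1 - \<eta>) ^ 3 - \<eta>) * T \<le> onorm (resolvent H1 (dirac m) z)"
proof -
  define \<delta> where "\<delta> = Im z"
  define \<tau> where "\<tau> = Re z"
  have \<delta>: "\<bar>\<delta>\<bar> < 1" and \<tau>: "\<tau> \<noteq> 0" "\<tau>^2 > 0" using z m by (auto simp: \<delta>_def \<tau>_def)
  have \<delta>2: "1 - \<delta>^2 > 0" using \<delta> by (simp add: abs_square_less_1)
  have Tpos: "T > 0" using \<tau> \<delta>2 m by (simp add: T_def strip_scale_def \<delta>_def[symmetric] \<tau>_def[symmetric])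
  have p: "Im (z - \<i>) \<noteq> 0" "m = 0 \<or> \<bar>Re (z - \<i>)\<bar> > m" "Im (z + \<i>) \<noteq> 0" "m = 0 \<or> \<bar>Re (z + \<i>)\<bar> > m"
    using z m by auto
  have m0: "m \<ge> 0" using m by simp
  define rp where "rp = mode_ratio m (z - \<i>)"
  define rn where "rn = mode_ratio m (z + \<i>)"
  define \<theta>p where "\<theta>p = rp * (of_real m + (z - \<i>))"
  define \<theta>n where "\<theta>n = rn * (of_real m + (z + \<i>))"
  define S where "S = rp + rn"
  note P = strip_parameters[OF m z, folded sp_def sn_def gp_def gn_def rp_def rn_def, folded \<theta>p_def \<theta>n_def S_def \<delta>_def \<tau>_def]
  note RP = mode_ratio[OF m0 p(1,2), folded rp_def, folded \<theta>p_def] and RN = mode_ratio[OF m0 p(3,4), folded rn_def, folded \<theta>n_def]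
  have "\<bar>Im z\<bar> \<noteq> 1" "m = 0 \<longrightarrow> \<bar>Im z\<bar> > 1" "m > 0 \<longrightarrow> \<bar>Re z\<bar> > m" using z m by auto
  then have S0: "rp + rn \<noteq> 0" "S \<noteq> 0"
    unfolding S_def rp_def rn_def using mode_ratio_sum_nonzero[OF m0] by auto
  have cr: "cmod rp = cmod sp" "cmod rn = cmod sn"
    by (simp_all add: P norm_mult)
  have s0: "sp \<noteq> 0" "sn \<noteq> 0" using s by auto
  have q_eq: "(rp - rn) / (2 * rp) = (sp + sn) / (2 * sp)" "(rn - rp) / (2 * rn) = (sp + sn) / (2 * sn)"
    using s0 by (simp_all add: P field_simps)
  define q1 where "q1 = (rp - rn) / (2 * rp)"
  define q2 where "q2 = (rn - rp) / (2 * rn)"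
  have q12: "cmod (q1 - 1) \<le> \<eta>" "cmod (q2 - 1) \<le> \<eta>"
    using q by (simp_all add: q1_def q2_def q_eq)
  have nq: "cmod q1 \<le> 1 + \<eta>" "cmod q2 \<le> 1 + \<eta>"
    using norm_triangle_ineq[of "q1 - 1" 1] norm_triangle_ineq[of "q2 - 1" 1] q12 by simp_all
  define Np where "Np = (1 + (cmod rp)^2) / (2 * Re \<theta>p)"
  define Nn where "Nn = (1 + (cmod rn)^2) / (2 * Re \<theta>n)"
  have \<theta>p_inv: "1 / Re \<theta>p = Re (sp * gp) / (1 - \<delta>)" and \<theta>n_inv: "1 / Re \<theta>n = Re (sn * gn) / (1 + \<delta>)"
  proof -
    have "1 / a = b / c" if "a * b = c" "a > 0" "c > 0" for a b c :: real
      using that by (auto simp: field_simps)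
    moreover have "1 - \<delta> > 0" "1 + \<delta> > 0" using \<delta> by auto
    ultimately show "1 / Re \<theta>p = Re (sp * gp) / (1 - \<delta>)" "1 / Re \<theta>n = Re (sn * gn) / (1 + \<delta>)"
      using P(3,4) RP(2) RN(2) by blast+
  qed
  have Np_eq: "Np = ((1 + (cmod sp)^2) * Re (sp * gp) / 2) * (1 / (1 - \<delta>))"
  proof -
    have "Np = (1 + (cmod sp)^2) / 2 * (1 / Re \<theta>p)" by (simp add: Np_def cr)
    then show ?thesis unfolding \<theta>p_inv by simp
  qed
  have Nn_eq: "Nn = ((1 + (cmod sn)^2) * Re (sn * gn) / 2) * (1 / (1 + \<delta>))"
  proof -
    have "Nn = (1 + (cmod sn)^2) / 2 * (1 / Re \<theta>n)" by (simp add: Nn_def cr)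
    then show ?thesis unfolding \<theta>n_inv by simp
  qed
  have Npos: "Np > 0" "Nn > 0"
    using RP(2) RN(2) by (simp_all add: Np_def Nn_def add_pos_nonneg)
  define N where "N = Np + Nn"
  define D where "D = 1 / (1 - \<delta>) + 1 / (1 + \<delta>)"
  have i\<delta>: "1 / (1 - \<delta>) > 0" "1 / (1 + \<delta>) > 0" using \<delta> by (simp_all add: abs_less_iff)
  have N_low: "(1 - \<eta>) * D \<le> N" and N_up: "N \<le> (1 + \<eta>) * D"
    unfolding N_def D_def Np_eq Nn_eq distrib_left
    by (intro add_mono mult_right_mono vp vn; use i\<delta> in simp)+
  define t' where "t' = cmod ((sp + sn) * gp * gn) / 2"
  have "1 - \<eta> \<le> t'" "t' \<le> 1 + \<eta>" using t by (simp_all only: t'_def)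
  then have t': "1 - \<eta> \<le> t'" "t' \<le> 1 + \<eta>" "t' > 0" using \<eta> by linarith+
  have "cmod (S * ((sp + sn) * gp * gn) * of_real (\<tau>^2)) = cmod (of_real (4 * m))"
    by (simp only: P(5))
  then have "cmod S * (2 * t') * \<tau>^2 = 4 * m"
    using m by (simp add: norm_mult norm_power t'_def mult.assoc)
  then have S_inv: "1 / cmod S = t' * \<tau>^2 / (2 * m)"
    using S0 m by (simp add: field_simps)
  have DT: "D * (\<tau>^2 / (2 * m)) = T"
  proof -
    have "1 - \<delta> \<noteq> 0" "1 + \<delta> \<noteq> 0" using \<delta> by auto
    then have "D = 2 / (1 - \<delta>^2)"
      by (simp add: D_def field_simps power2_eq_square)
    then show ?thesis
      by (simp add: T_def strip_scale_def \<delta>_def \<tau>_def)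
  qed
  have NS_up: "N / cmod S \<le> (1 + \<eta>)^2 * T"
  proof -
    have "N / cmod S = N * (1 / cmod S)" by simp
    also have "\<dots> = (N * t') * (\<tau>^2 / (2 * m))" unfolding S_inv by simp
    also have "\<dots> \<le> (((1 + \<eta>) * D) * (1 + \<eta>)) * (\<tau>^2 / (2 * m))"
      by (intro mult_right_mono mult_mono N_up t') (use \<eta> t' i\<delta> m in \<open>auto simp: D_def intro!: mult_nonneg_nonneg add_nonneg_nonneg\<close>)
    also have "\<dots> = (1 + \<eta>)^2 * T" by (simp add: DT[symmetric] power2_eq_square)
    finally show ?thesis .
  qed
  have NS_low: "(1 - \<eta>)^2 * T \<le> N / cmod S"
  proof -
    have "(1 - \<eta>)^2 * T = (((1 - \<eta>) * D) * (1 - \<eta>)) * (\<tau>^2 / (2 * m))" by (simp add: DT[symmetric] power2_eq_square)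
    also have "\<dots> \<le> (N * t') * (\<tau>^2 / (2 * m))"
      by (intro mult_right_mono mult_mono N_low t') (use \<eta> t' Npos m in \<open>auto simp: N_def\<close>)
    also have "\<dots> = N * (1 / cmod S)" unfolding S_inv by simp
    finally show ?thesis by simp
  qed
  have rest_small: "15 / (1 - \<bar>\<delta>\<bar>) \<le> \<eta> * T"
  proof -
    have "1 - \<delta>^2 = (1 - \<bar>\<delta>\<bar>) * (1 + \<bar>\<delta>\<bar>)" by (simp add: power2_eq_square algebra_simps)
    also have "\<dots> \<le> (1 - \<bar>\<delta>\<bar>) * 2" using \<delta> by (intro mult_left_mono) auto
    finally have "15 * (1 - \<delta>^2) \<le> 30 * (1 - \<bar>\<delta>\<bar>)" by simp
    then have "15 / (1 - \<bar>\<delta>\<bar>) \<le> 30 / (1 - \<delta>^2)" using \<delta> \<delta>2 by (simp add: field_simps)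
    also have "\<dots> = 30 * m / (m * (1 - \<delta>^2))" using m by simp
    also have "\<dots> \<le> \<eta> * \<tau>^2 / (m * (1 - \<delta>^2))"
      using large m \<delta>2 by (intro divide_right_mono) (auto simp: \<tau>_def)
    finally show ?thesis by (simp add: T_def strip_scale_def \<delta>_def \<tau>_def)
  qed
  have C: "2 * (1 + (cmod r)^2) * (1 + 1 / (cmod r)^2) * x^2 \<le> (\<eta> * T)^2"
    if r: "1 / 2 \<le> cmod r" "cmod r \<le> 2" and x: "0 \<le> x" "x \<le> 2 / (1 - \<bar>\<delta>\<bar>)" for r :: complex and x
  proof -
    have "(cmod r)^2 \<le> 2^2" "(1 / 2)^2 \<le> (cmod r)^2"
      using r by (intro power_mono; simp)+
    then have "1 + (cmod r)^2 \<le> 5" "1 + 1 / (cmod r)^2 \<le> 5"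
      by (auto simp: field_simps power2_eq_square)
    then have "2 * (1 + (cmod r)^2) * (1 + 1 / (cmod r)^2) * x^2 \<le> 2 * 5 * 5 * (2 / (1 - \<bar>\<delta>\<bar>))^2"
      using x by (intro mult_mono power_mono) auto
    also have "\<dots> \<le> (15 / (1 - \<bar>\<delta>\<bar>))^2"
      by (simp add: power_divide divide_right_mono)
    also have "\<dots> \<le> (\<eta> * T)^2"
      using rest_small \<delta> by (intro power_mono) auto
    finally show ?thesis .
  qed
  have Cp: "2 * (1 + (cmod rp)^2) * (1 + 1 / (cmod rp)^2) * (1 / Re \<theta>p)^2 \<le> (\<eta> * T)^2"
  proof (rule C)
    show "1 / 2 \<le> cmod rp" "cmod rp \<le> 2" using s by (simp_all add: cr)
    show "0 \<le> 1 / Re \<theta>p" using RP(2) by simp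
    show "1 / Re \<theta>p \<le> 2 / (1 - \<bar>\<delta>\<bar>)"
      unfolding \<theta>p_inv using u \<delta> by (intro frac_le) auto
  qed
  have Cn: "2 * (1 + (cmod rn)^2) * (1 + 1 / (cmod rn)^2) * (1 / Re \<theta>n)^2 \<le> (\<eta> * T)^2"
  proof (rule C)
    show "1 / 2 \<le> cmod rn" "cmod rn \<le> 2" using s by (simp_all add: cr)
    show "0 \<le> 1 / Re \<theta>n" using RN(2) by simp
    show "1 / Re \<theta>n \<le> 2 / (1 - \<bar>\<delta>\<bar>)"
      unfolding \<theta>n_inv using u \<delta> by (intro frac_le) auto
  qed
  let ?E = "two_sided \<theta>p \<theta>n"
  have sol: "\<exists>F A B R. F \<in> H1 \<and> dirac_shift m z F = spinor_of g1 g2 \<and>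
      F = spinor_of (?E A B) (?E (- rp * A) (rn * B)) + R \<and>
      A * S = (LBINT x. ?E q1 1 x * g1 x + ?E (- rp * q1) rn x * g2 x) \<and>
      B * S = (LBINT x. ?E 1 q2 x * g1 x + ?E (- rp) (rn * q2) x * g2 x) \<and>
      norm R \<le> \<eta> * T * norm (spinor_of g1 g2)" if g: "L2_fun g1" "L2_fun g2" for g1 g2
  proof -
    have pw: "norm R \<le> \<eta> * T * k" if "(norm R)^2 \<le> (\<eta> * T)^2 * k^2" "k \<ge> 0" for R :: spinor and k
      using that \<eta> Tpos by (intro power2_le_imp_le[of "norm R"]) (auto simp: power_mult_distrib)
    show ?thesis
      by (rule dirac_shift_solution[OF RP(2) RN(2) RP(1) RN(1) S0(1) \<theta>p_def[symmetric] RP(3) \<theta>n_def[symmetric] RN(3) g Cp Cn])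
        (unfold S_def q1_def q2_def, blast intro: pw norm_ge_zero)
  qed
  have normM: "(norm (spinor_of (?E a b) (?E (- rp * a) (rn * b))))^2
      = (cmod a)^2 * Np + (cmod b)^2 * Nn" for a b
    unfolding norm_two_sided[OF RP(2) RN(2)] Np_def Nn_def by (simp add: norm_mult power_mult_distrib algebra_simps)
  have upper: "\<exists>F\<in>H1. dirac_shift m z F = G \<and> norm F \<le> (((1 + \<eta>) ^ 3 + \<eta>) * T) * norm G" for G
  proof -
    obtain g1 g2 where g: "L2_fun g1" "L2_fun g2" and G: "G = spinor_of g1 g2"
      by (rule spinor_cases)
    obtain F A B R where F: "F \<in> H1" "dirac_shift m z F = spinor_of g1 g2"
      "F = spinor_of (?E A B) (?E (- rp * A) (rn * B)) + R"
      and A: "A * S = (LBINT x. ?E q1 1 x * g1 x + ?E (- rp * q1) rn x * g2 x)"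
      and B: "B * S = (LBINT x. ?E 1 q2 x * g1 x + ?E (- rp) (rn * q2) x * g2 x)"
      and R: "norm R \<le> \<eta> * T * norm (spinor_of g1 g2)"
      using sol[OF g] by blast
    define M where "M = spinor_of (?E A B) (?E (- rp * A) (rn * B))"
    note Lt = L2_fun_two_sided[OF RP(2) RN(2)]
    have pairing_le: "(cmod (LBINT x. ?E a b x * g1 x + ?E (- rp * a) (rn * b) x * g2 x))^2 \<le> ((1 + \<eta>)^2 * N) * (norm G)^2"
      if "cmod a \<le> 1 + \<eta>" "cmod b \<le> 1 + \<eta>" for a b
    proof -
      have "(cmod (LBINT x. ?E a b x * g1 x + ?E (- rp * a) (rn * b) x * g2 x))^2
          \<le> (norm (spinor_of (?E a b) (?E (- rp * a) (rn * b))) * norm G)^2"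
        unfolding G by (intro power_mono cmod_integral_le_norm_spinor Lt g norm_ge_zero)
      also have "\<dots> = ((cmod a)^2 * Np + (cmod b)^2 * Nn) * (norm G)^2"
        unfolding power_mult_distrib normM by simp
      also have "\<dots> \<le> ((1 + \<eta>)^2 * N) * (norm G)^2"
        unfolding N_def distrib_left using that Npos
        by (intro mult_right_mono add_mono power_mono) auto
      finally show ?thesis .
    qed
    have one: "cmod 1 \<le> 1 + \<eta>" using \<eta> by simp
    have A2: "(cmod (A * S))^2 \<le> ((1 + \<eta>)^2 * N) * (norm G)^2"
      using pairing_le[OF nq(1) one] by (simp add: A)
    have B2: "(cmod (B * S))^2 \<le> ((1 + \<eta>)^2 * N) * (norm G)^2"
      using pairing_le[OF one nq(2)] by (simp add: B)
    have "(norm M * cmod S)^2 = (cmod (A * S))^2 * Np + (cmod (B * S))^2 * Nn"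
      unfolding power_mult_distrib M_def normM by (simp add: norm_mult power_mult_distrib algebra_simps)
    also have "\<dots> \<le> (((1 + \<eta>)^2 * N) * (norm G)^2) * Np + (((1 + \<eta>)^2 * N) * (norm G)^2) * Nn"
      using Npos by (intro add_mono mult_right_mono A2 B2) auto
    also have "\<dots> = ((1 + \<eta>) * N * norm G)^2"
      by (simp add: N_def power2_eq_square algebra_simps)
    finally have "norm M * cmod S \<le> (1 + \<eta>) * N * norm G"
      using \<eta> Npos by (intro power2_le_imp_le[of "norm M * cmod S"]) (auto simp: N_def)
    then have "norm M \<le> (1 + \<eta>) * (N / cmod S) * norm G"
      using S0 by (simp add: field_simps)
    also have "\<dots> \<le> (1 + \<eta>) * ((1 + \<eta>)^2 * T) * norm G"
      using \<eta> by (intro mult_right_mono mult_left_mono NS_up) auto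
    finally have "norm M \<le> (1 + \<eta>) ^ 3 * T * norm G"
      by (simp add: power2_eq_square power3_eq_cube mult.assoc)
    moreover have "norm F \<le> norm M + norm R"
      unfolding F(3) M_def by (rule norm_triangle_ineq)
    ultimately have "norm F \<le> (((1 + \<eta>) ^ 3 + \<eta>) * T) * norm G"
      using R unfolding G[symmetric] distrib_right by linarith
    with F G show ?thesis by blast
  qed
  have "0 \<le> ((1 + \<eta>) ^ 3 + \<eta>) * T"
    using \<eta> Tpos by simp
  from resolvent_setI[OF this upper]
  show res: "z \<in> resolvent_set H1 (dirac m)" and "onorm (resolvent H1 (dirac m) z) \<le> ((1 + \<eta>) ^ 3 + \<eta>) * T"
    by blast+
  show "((1 - \<eta>) ^ 3 - \<eta>) * T \<le> onorm (resolvent H1 (dirac m) z)"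
  proof -
    note Lt = L2_fun_two_sided[OF RP(2) RN(2)]
    \<comment> \<open>The complex conjugate of the kernels of both pairings, up to the factors \<open>q1\<close>, \<open>q2\<close> close to \<open>1\<close>.\<close>
    define g1 where "g1 x = cnj (?E 1 1 x)" for x
    define g2 where "g2 x = cnj (?E (- rp) rn x)" for x
    have g: "L2_fun g1" "L2_fun g2"
      unfolding g1_def [abs_def] g2_def [abs_def] by (intro L2_fun_cnj Lt)+
    have "(norm (spinor_of g1 g2))^2 = (norm (spinor_of (?E 1 1) (?E (- rp * 1) (rn * 1))))^2"
      unfolding norm_spinor_of[OF g] norm_spinor_of[OF Lt Lt] by (simp add: g1_def g2_def)
    also have "\<dots> = N"
      unfolding normM by (simp add: N_def)
    finally have ng: "(norm (spinor_of g1 g2))^2 = N" .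
    obtain F A B R where F: "F \<in> H1" "dirac_shift m z F = spinor_of g1 g2"
      "F = spinor_of (?E A B) (?E (- rp * A) (rn * B)) + R"
      and A: "A * S = (LBINT x. ?E q1 1 x * g1 x + ?E (- rp * q1) rn x * g2 x)"
      and B: "B * S = (LBINT x. ?E 1 q2 x * g1 x + ?E (- rp) (rn * q2) x * g2 x)"
      and R: "norm R \<le> \<eta> * T * norm (spinor_of g1 g2)"
      using sol[OF g] by blast
    have pairing: "(LBINT x. ?E a b x * g1 x + ?E (- rp * a) (rn * b) x * g2 x)
        = a * of_real Np + b * of_real Nn" for a b
    proof -
      have "(LBINT x. ?E a b x * g1 x + ?E (- rp * a) (rn * b) x * g2 x)
        = (a * cnj 1 / of_real (2 * Re \<theta>p) + b * cnj 1 / of_real (2 * Re \<theta>n))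
          + (- rp * a * cnj (- rp) / of_real (2 * Re \<theta>p) + rn * b * cnj rn / of_real (2 * Re \<theta>n))"
        unfolding integral_two_sided_mult_cnj[OF RP(2) RN(2), symmetric] g1_def g2_def
        by (intro Bochner_Integration.integral_add L2_fun_integrable_mult L2_fun_cnj Lt)
      also have "\<dots> = a * ((1 + rp * cnj rp) / of_real (2 * Re \<theta>p)) + b * ((1 + rn * cnj rn) / of_real (2 * Re \<theta>n))"
        by (simp add: add_divide_distrib algebra_simps)
      also have "\<dots> = a * of_real Np + b * of_real Nn"
        unfolding complex_norm_square[symmetric] Np_def Nn_def by simp
      finally show ?thesis .
    qed
    have AS: "A * S = q1 * of_real Np + of_real Nn" and BS: "B * S = of_real Np + q2 * of_real Nn"
      using pairing[of q1 1] pairing[of 1 q2] A B by simp_all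
    define M where "M = spinor_of (?E A B) (?E (- rp * A) (rn * B))"
    have low: "(1 - \<eta>) * N \<le> cmod (a * of_real Np + b * of_real Nn)"
      if "cmod (a - 1) \<le> \<eta>" "cmod (b - 1) \<le> \<eta>" for a b
    proof -
      have "a * of_real Np + b * of_real Nn = of_real N + ((a - 1) * of_real Np + (b - 1) * of_real Nn)"
        by (simp add: N_def algebra_simps)
      then have "N - cmod ((a - 1) * of_real Np + (b - 1) * of_real Nn) \<le> cmod (a * of_real Np + b * of_real Nn)"
        using norm_diff_ineq[of "of_real N" "(a - 1) * of_real Np + (b - 1) * of_real Nn"] Npos by (simp add: N_def del: of_real_add)
      moreover have "cmod ((a - 1) * of_real Np + (b - 1) * of_real Nn) \<le> \<eta> * Np + \<eta> * Nn"
        by (rule norm_triangle_le) (use that Npos in \<open>auto simp: norm_mult intro!: add_mono mult_right_mono\<close>)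
      ultimately show ?thesis by (simp add: N_def algebra_simps)
    qed
    have lowA: "(1 - \<eta>) * N \<le> cmod (A * S)" and lowB: "(1 - \<eta>) * N \<le> cmod (B * S)"
      using low[of q1 1] low[of 1 q2] q12 \<eta> by (simp_all add: AS BS)
    have N0: "N > 0" using Npos by (simp add: N_def)
    have "((1 - \<eta>) * N * norm (spinor_of g1 g2))^2 = ((1 - \<eta>) * N)^2 * Np + ((1 - \<eta>) * N)^2 * Nn"
      by (simp only: power_mult_distrib[of _ "norm (spinor_of g1 g2)"] ng) (simp add: N_def distrib_left)
    also have "\<dots> \<le> (cmod (A * S))^2 * Np + (cmod (B * S))^2 * Nn"
      using Npos \<eta> N0 by (intro add_mono mult_right_mono power_mono lowA lowB) auto
    also have "\<dots> = (norm M * cmod S)^2"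
      unfolding power_mult_distrib M_def normM by (simp add: norm_mult power_mult_distrib algebra_simps)
    finally have "(1 - \<eta>) * N * norm (spinor_of g1 g2) \<le> norm M * cmod S"
      by (rule power2_le_imp_le) simp
    then have "(1 - \<eta>) * (N / cmod S) * norm (spinor_of g1 g2) \<le> norm M"
      using S0 by (simp add: field_simps)
    moreover have "(1 - \<eta>) * ((1 - \<eta>)^2 * T) * norm (spinor_of g1 g2) \<le> (1 - \<eta>) * (N / cmod S) * norm (spinor_of g1 g2)"
      using \<eta> by (intro mult_right_mono mult_left_mono NS_low) auto
    moreover have "norm M \<le> norm F + norm R"
      using norm_triangle_ineq4[of F R] by (simp add: F(3) M_def)
    moreover have "((1 - \<eta>) ^ 3 - \<eta>) * T * norm (spinor_of g1 g2)
        = (1 - \<eta>) * ((1 - \<eta>)^2 * T) * norm (spinor_of g1 g2) - \<eta> * T * norm (spinor_of g1 g2)"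
      by (simp add: power2_eq_square power3_eq_cube algebra_simps)
    ultimately have "((1 - \<eta>) ^ 3 - \<eta>) * T * norm (spinor_of g1 g2) \<le> norm F"
      using R by linarith
    also have "\<dots> \<le> onorm (resolvent H1 (dirac m) z) * norm (spinor_of g1 g2)"
      using resolvent_bound[OF res F(1)] by (simp add: F(2))
    finally show ?thesis
      using ng N0 by (auto simp: mult_le_cancel_right)
  qed
qed

theorem strip_resolvent_asymptotics:
  fixes m \<alpha> :: real
  assumes m: "m > 0" and \<alpha>: "0 < \<alpha>" "\<alpha> < 1"
  obtains M where "M \<ge> m" "\<And>z. M < \<bar>Re z\<bar> \<Longrightarrow> \<bar>Im z\<bar> < 1 \<Longrightarrow> resolvent_norm_near m \<alpha> z"
proof -
  \<comment> \<open>For \<open>\<eta> < 1\<close>, \<open>(1 + \<eta>)^3 + \<eta> \<le> 1 + 8 \<eta>\<close> and \<open>(1 - \<eta>)^3 - \<eta> > 1 - 8 \<eta>\<close>.\<close>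
  define \<eta> where "\<eta> = \<alpha> / 8"
  have \<eta>: "0 < \<eta>" "\<eta> < 1 / 8" using \<alpha> by (auto simp: \<eta>_def)
  let ?sp = "\<lambda>z. mode_sqrt m (z - \<i>)" and ?sn = "\<lambda>z. mode_sqrt m (z + \<i>)"
  let ?gp = "\<lambda>z. (z - \<i> + of_real m) / of_real (Re z)" and ?gn = "\<lambda>z. (z + \<i> + of_real m) / of_real (Re z)"
  have L: "(?gp \<longlongrightarrow> 1) strip_infinity" "(?sp \<longlongrightarrow> 1) strip_infinity"
    "(?gn \<longlongrightarrow> 1) strip_infinity" "(?sn \<longlongrightarrow> 1) strip_infinity"
    using strip_limits[OF m, of "- \<i>"] strip_limits[OF m, of "\<i>"] by simp_all
  have q: "((\<lambda>z. (?sp z + ?sn z) / (2 * ?sp z)) \<longlongrightarrow> (1 + 1) / (2 * 1)) strip_infinity"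
    "((\<lambda>z. (?sp z + ?sn z) / (2 * ?sn z)) \<longlongrightarrow> (1 + 1) / (2 * 1)) strip_infinity"
    by (intro tendsto_intros L; simp)+
  have u: "((\<lambda>z. Re (?sp z * ?gp z)) \<longlongrightarrow> Re (1 * 1)) strip_infinity" "((\<lambda>z. Re (?sn z * ?gn z)) \<longlongrightarrow> Re (1 * 1)) strip_infinity"
    by (intro tendsto_intros L)+
  have v: "((\<lambda>z. (1 + (cmod (?sp z))^2) * Re (?sp z * ?gp z) / 2) \<longlongrightarrow> (1 + (cmod 1)^2) * Re (1 * 1) / 2) strip_infinity"
    "((\<lambda>z. (1 + (cmod (?sn z))^2) * Re (?sn z * ?gn z) / 2) \<longlongrightarrow> (1 + (cmod 1)^2) * Re (1 * 1) / 2) strip_infinity"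
    by (intro tendsto_intros L; simp)+
  have t: "((\<lambda>z. cmod ((?sp z + ?sn z) * ?gp z * ?gn z) / 2) \<longlongrightarrow> cmod ((1 + 1) * 1 * 1) / 2) strip_infinity"
    by (intro tendsto_intros L; simp)
  have s: "((\<lambda>z. cmod (?sp z)) \<longlongrightarrow> cmod 1) strip_infinity" "((\<lambda>z. cmod (?sn z)) \<longlongrightarrow> cmod 1) strip_infinity"
    by (intro tendsto_intros L)+
  have ev: "\<forall>\<^sub>F z in strip_infinity. dist (f z) l < e" if "(f \<longlongrightarrow> l) strip_infinity" "e > 0" for f :: "complex \<Rightarrow> 'a::metric_space" and l e
    using that by (rule tendstoD)
  have half: "(0::real) < 1 / 2" by simp
  have limit_values: "(1 + 1) / (2 * 1) = (1::complex)" "Re (1 * 1) = 1" "(1 + (cmod 1)^2) * Re (1 * 1) / 2 = 1"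
    "cmod ((1 + 1) * 1 * 1) / 2 = 1" "cmod 1 = 1"
    by simp_all
  note q = q[THEN tendsto_eq_rhs, OF limit_values(1)] and u = u[THEN tendsto_eq_rhs, OF limit_values(2)]
    and v = v[THEN tendsto_eq_rhs, OF limit_values(3)] and t = t[THEN tendsto_eq_rhs, OF limit_values(4)]
    and s = s[THEN tendsto_eq_rhs, OF limit_values(5)]
  have "\<forall>\<^sub>F z in strip_infinity. m < \<bar>Re z\<bar> \<and> \<bar>Im z\<bar> < 1"
    by (auto simp: eventually_strip_infinity)
  moreover have "\<forall>\<^sub>F z in strip_infinity. 30 * m \<le> \<eta> * (Re z)^2"
    unfolding eventually_strip_infinity
  proof (intro exI[of _ "30 * m / \<eta> + 1"] allI impI)
    fix z :: complex assume "30 * m / \<eta> + 1 < \<bar>Re z\<bar> \<and> \<bar>Im z\<bar> < 1"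
    then have large: "30 * m / \<eta> + 1 < \<bar>Re z\<bar>" by simp
    have pos: "30 * m / \<eta> > 0" using m \<eta> by simp
    have "30 * m / \<eta> * 1 \<le> \<bar>Re z\<bar> * \<bar>Re z\<bar>"
      using large pos by (intro mult_mono) auto
    then show "30 * m \<le> \<eta> * (Re z)^2"
      using \<eta> by (simp add: field_simps power2_eq_square)
  qed
  ultimately have "\<forall>\<^sub>F z in strip_infinity. resolvent_norm_near m \<alpha> z"
    using ev[OF q(1) \<eta>(1)] ev[OF q(2) \<eta>(1)] ev[OF v(1) \<eta>(1)] ev[OF v(2) \<eta>(1)] ev[OF t \<eta>(1)]
      ev[OF u(1) half] ev[OF u(2) half] ev[OF s(1) half] ev[OF s(2) half]
  proof eventually_elim
    case (elim z)
    define T where "T = strip_scale m z"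
    have zs: "\<bar>Im z\<bar> < 1" "\<bar>Re z\<bar> > m" using elim by auto
    have "Re z \<noteq> 0" using zs m by auto
    moreover have "(Im z)^2 < 1" using zs by (simp add: abs_square_less_1)
    ultimately have T: "T > 0" using m by (simp add: T_def strip_scale_def)
    have "\<eta> < 1" using \<eta> by simp
    note bounds = strip_resolvent_bounds[OF m zs \<eta>(1) this, folded T_def]
    have R: "z \<in> resolvent_set H1 (dirac m)" "onorm (resolvent H1 (dirac m) z) \<le> ((1 + \<eta>) ^ 3 + \<eta>) * T"
      "((1 - \<eta>) ^ 3 - \<eta>) * T \<le> onorm (resolvent H1 (dirac m) z)"
    proof -
      have real: "l - e \<le> a" "a \<le> l + e" "l - e < a" if "dist a l < e" for a l e :: real
        using that by (auto simp: dist_real_def)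
      have "cmod ((?sp z + ?sn z) / (2 * ?sp z) - 1) \<le> \<eta>" "cmod ((?sp z + ?sn z) / (2 * ?sn z) - 1) \<le> \<eta>"
        using elim(3,4) unfolding dist_norm by simp_all
      note b = bounds[OF this real(1,2)[OF elim(5)] real(1,2)[OF elim(6)] real(1,2)[OF elim(7)]]
      have half_bounds: "0 < a" "a \<le> 2" "1 / 2 \<le> a" if "dist a 1 < 1 / 2" for a :: real
        using real[OF that] by simp_all
      note b' = b[OF half_bounds(1,2)[OF elim(8)] half_bounds(1,2)[OF elim(9)]
          half_bounds(3,2)[OF elim(10)] half_bounds(3,2)[OF elim(11)] elim(2)]
      show "z \<in> resolvent_set H1 (dirac m)" "onorm (resolvent H1 (dirac m) z) \<le> ((1 + \<eta>) ^ 3 + \<eta>) * T"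
        "((1 - \<eta>) ^ 3 - \<eta>) * T \<le> onorm (resolvent H1 (dirac m) z)"
        by (rule b')+
    qed
    have "\<eta>^2 \<le> \<eta>" "\<eta> ^ 3 \<le> \<eta>" "0 \<le> \<eta>^2"
      using \<eta> power_decreasing[of 1 2 \<eta>] power_decreasing[of 1 3 \<eta>] by auto
    moreover have "(1 + \<eta>) ^ 3 = 1 + 3 * \<eta> + 3 * \<eta>^2 + \<eta> ^ 3" "(1 - \<eta>) ^ 3 = 1 - 3 * \<eta> + 3 * \<eta>^2 - \<eta> ^ 3"
      by (simp_all add: power2_eq_square power3_eq_cube algebra_simps)
    ultimately have "(1 + \<eta>) ^ 3 + \<eta> \<le> 1 + \<alpha>" "1 - \<alpha> < (1 - \<eta>) ^ 3 - \<eta>"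
    proof -
      assume "\<eta>^2 \<le> \<eta>" "\<eta> ^ 3 \<le> \<eta>" "0 \<le> \<eta>^2"
        "(1 + \<eta>) ^ 3 = 1 + 3 * \<eta> + 3 * \<eta>^2 + \<eta> ^ 3" "(1 - \<eta>) ^ 3 = 1 - 3 * \<eta> + 3 * \<eta>^2 - \<eta> ^ 3"
      moreover have "\<alpha> = 8 * \<eta>" by (simp add: \<eta>_def)
      ultimately show "(1 + \<eta>) ^ 3 + \<eta> \<le> 1 + \<alpha>" "1 - \<alpha> < (1 - \<eta>) ^ 3 - \<eta>"
        using \<eta>(1) by linarith+
    qed
    then have "((1 + \<eta>) ^ 3 + \<eta>) * T \<le> (1 + \<alpha>) * T" "(1 - \<alpha>) * T < ((1 - \<eta>) ^ 3 - \<eta>) * T"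
      using T by simp_all
    with R show ?case unfolding resolvent_norm_near_def T_def by linarith
  qed
  then obtain M where M: "\<And>z. M < \<bar>Re z\<bar> \<Longrightarrow> \<bar>Im z\<bar> < 1 \<Longrightarrow> resolvent_norm_near m \<alpha> z"
    by (auto simp: eventually_strip_infinity)
  show ?thesis
    by (rule that[of "max m M"]) (use M in auto)
qed

section \<open>Approximate eigenfunctions\<close>

lemma norm_scaleC: "norm (scaleC z F) = cmod z * norm F"
proof -
  obtain f1 f2 where f: "L2_fun f1" "L2_fun f2" "F = spinor_of f1 f2" by (rule spinor_cases)
  have "(norm (scaleC z F))^2 = (cmod z * norm F)^2"
    using f by (simp add: scaleC_spinor_of norm_spinor_of L2_fun_cmult norm_mult power_mult_distrib distrib_left)
  then show ?thesis by (simp add: power2_eq_iff_nonneg)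
qed

lemma dirac_shift_change: "dirac_shift m z F = dirac_shift m w F + scaleC (w - z) F"
proof -
  obtain f1 f2 where f: "L2_fun f1" "L2_fun f2" "F = spinor_of f1 f2" by (rule spinor_cases)
  have "scaleC (w - z) F = scaleC w F - scaleC z F"
    using f by (simp add: scaleC_spinor_of spinor_of_diff L2_fun_cmult left_diff_distrib)
  then show ?thesis by (simp add: dirac_shift_def)
qed

text \<open>If \<open>Im w = 1\<close>, the equation on the right half-line has the bounded solution
  \<open>exp (- \<i> k x) (1, - \<i> s)\<close> with real \<open>k\<close> and \<open>s\<close>. With an additional damping \<open>e\<close> its squared norm grows like
  \<open>c / (2 e)\<close> as \<open>e\<close> tends to \<open>0\<close>, while the error on the right has squared norm \<open>e * c / 2\<close> and the
  error \<open>K / 2\<close> of the continuous extension by \<open>exp x\<close> to the left does not depend on \<open>e\<close>. For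
  \<open>Im w = - 1\<close> the half-lines change their roles.\<close>

lemma approximate_eigenfunction:
  assumes m: "m \<ge> 0" and w: "\<bar>Im w\<bar> = 1" "m = 0 \<or> \<bar>Re w\<bar> > m" and \<eta>: "\<eta> > 0"
  obtains F where "F \<in> H1" "norm F > 0" "norm (dirac_shift m w F) \<le> \<eta> * norm F"
proof -
  define \<tau> where "\<tau> = Re w"
  define s where "s = (if m = 0 then 1 else sqrt ((\<tau> - m) / (\<tau> + m)))"
  define c where "c = 1 + s^2"
  have c: "c > 0" by (simp add: c_def add_pos_nonneg)
  have s2: "s^2 * (\<tau> + m) = \<tau> - m"
  proof (cases "m = 0")
    case False
    with w m have "\<tau> > m \<or> \<tau> < - m" "m > 0" by (auto simp: \<tau>_def)
    then have "(\<tau> - m) / (\<tau> + m) \<ge> 0" "\<tau> + m \<noteq> 0" by (auto simp: zero_le_divide_iff)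
    then show ?thesis using False by (simp add: s_def)
  qed (simp add: s_def)
  define k where "k = s * (\<tau> + m)"
  have sk: "complex_of_real s * of_real k = of_real \<tau> - of_real m"
    using s2 by (simp add: k_def power2_eq_square mult.assoc flip: of_real_mult of_real_diff)
  note found = that
  have crit: ?thesis
    if F: "\<And>e. 0 < e \<Longrightarrow> F e \<in> H1 \<and> (norm (F e))^2 = c / (2 * e) + c / 2 \<and> (norm (dirac_shift m w (F e)))^2 = (e * c + K) / 2"
      and K: "K \<ge> 0" for F :: "real \<Rightarrow> spinor" and K
  proof -
    \<comment> \<open>This \<open>e \<le> 1\<close> is small enough for \<open>e (e c + K) \<le> \<eta>^2 c\<close>.\<close>
    define e where "e = \<eta>^2 * c / (\<eta>^2 * c + c + K)"
    have pos: "\<eta>^2 * c > 0" using c \<eta> by simp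
    then have e: "0 < e" "e \<le> 1" using c K by (auto simp: e_def)
    have "e * (c + K) \<le> \<eta>^2 * c"
    proof -
      have "e * (c + K) \<le> e * (\<eta>^2 * c + c + K)" using e pos by (intro mult_left_mono) auto
      also have "\<dots> = \<eta>^2 * c" using pos c K by (simp add: e_def)
      finally show ?thesis .
    qed
    moreover have "e * (e * c + K) \<le> e * (c + K)"
      using e c by (intro mult_left_mono add_right_mono mult_left_le_one_le) auto
    ultimately have "e * (e * c + K) \<le> \<eta>^2 * c" by linarith
    then have "(e * c + K) / 2 \<le> \<eta>^2 * (c / (2 * e))"
      using e by (simp add: field_simps)
    also have "\<dots> \<le> \<eta>^2 * (c / (2 * e) + c / 2)"
      using c by (intro mult_left_mono) auto
    finally have "(norm (dirac_shift m w (F e)))^2 \<le> (\<eta> * norm (F e))^2"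
      using F[OF e(1)] by (simp only: power_mult_distrib)
    then have "norm (dirac_shift m w (F e)) \<le> \<eta> * norm (F e)"
      by (rule power2_le_imp_le) (use \<eta> in simp)
    moreover have "norm (F e) > 0"
    proof -
      have "c / (2 * e) + c / 2 > 0" using c e by (simp add: add_pos_pos)
      then have "(norm (F e))^2 \<noteq> 0" using F[OF e(1)] by linarith
      then show ?thesis by simp
    qed
    ultimately show ?thesis
      using found[of "F e"] F[OF e(1)] by blast
  qed
  have cmod_s: "(cmod (- \<i> * of_real s))^2 = s^2" by (simp add: norm_mult)
  have w1: "w = of_real \<tau> + \<i> \<or> w = of_real \<tau> - \<i>"
    using w by (auto simp: \<tau>_def complex_eq_iff abs_if split: if_splits)
  then show ?thesis
  proof
    assume w1: "w = of_real \<tau> + \<i>"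
    define E1 where "E1 = of_real m - (w + \<i>) + \<i> * of_real s * 1"
    define E2 where "E2 = 1 + \<i> * of_real s * (of_real m + (w + \<i>))"
    show ?thesis
    proof (rule crit)
      fix e :: real assume e: "0 < e"
      define \<alpha> where "\<alpha> = \<i> * of_real k + of_real e"
      have Re: "Re \<alpha> > 0" "Re (1::complex) > 0" using e by (simp_all add: \<alpha>_def)
      define F where "F = spinor_of (two_sided \<alpha> 1 1 1) (two_sided \<alpha> 1 (- \<i> * of_real s) (- \<i> * of_real s))"
      note T = dirac_shift_two_sided[OF Re, where s = "of_real s", folded F_def]
      have D: "of_real m - (w - \<i>) - \<i> * of_real s * \<alpha> = - \<i> * of_real (s * e)"
        "- \<alpha> + \<i> * of_real s * (of_real m + (w - \<i>)) = - of_real e"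
        using sk by (simp_all add: w1 \<alpha>_def k_def algebra_simps)
      have "(norm F)^2 = c / (2 * e) + c / 2"
        unfolding F_def norm_two_sided[OF Re] cmod_s by (simp add: c_def \<alpha>_def)
      moreover have "(norm (dirac_shift m w F))^2 = (e * c + ((cmod E1)^2 + (cmod E2)^2)) / 2"
        unfolding T(2) D E1_def[symmetric] E2_def[symmetric] norm_two_sided[OF Re]
        using e by (simp add: norm_mult c_def \<alpha>_def power_mult_distrib field_simps power2_eq_square)
      ultimately show "F \<in> H1 \<and> (norm F)^2 = c / (2 * e) + c / 2 \<and>
          (norm (dirac_shift m w F))^2 = (e * c + ((cmod E1)^2 + (cmod E2)^2)) / 2"
        using T(1) by blast
    qed simp
  next
    assume w1: "w = of_real \<tau> - \<i>"
    define E1 where "E1 = of_real m - (w - \<i>) - \<i> * of_real s * 1"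
    define E2 where "E2 = - 1 + \<i> * of_real s * (of_real m + (w - \<i>))"
    show ?thesis
    proof (rule crit)
      fix e :: real assume e: "0 < e"
      define \<beta> where "\<beta> = - \<i> * of_real k + of_real e"
      have Re: "Re (1::complex) > 0" "Re \<beta> > 0" using e by (simp_all add: \<beta>_def)
      define F where "F = spinor_of (two_sided 1 \<beta> 1 1) (two_sided 1 \<beta> (- \<i> * of_real s) (- \<i> * of_real s))"
      note T = dirac_shift_two_sided[OF Re, where s = "of_real s", folded F_def]
      have D: "of_real m - (w + \<i>) + \<i> * of_real s * \<beta> = \<i> * of_real (s * e)"
        "\<beta> + \<i> * of_real s * (of_real m + (w + \<i>)) = of_real e"
        using sk by (simp_all add: w1 \<beta>_def k_def algebra_simps)
      have "(norm F)^2 = c / (2 * e) + c / 2"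
        unfolding F_def norm_two_sided[OF Re] cmod_s by (simp add: c_def \<beta>_def)
      moreover have "(norm (dirac_shift m w F))^2 = (e * c + ((cmod E1)^2 + (cmod E2)^2)) / 2"
        unfolding T(2) D E1_def[symmetric] E2_def[symmetric] norm_two_sided[OF Re]
        using e by (simp add: norm_mult c_def \<beta>_def power_mult_distrib field_simps power2_eq_square)
      ultimately show "F \<in> H1 \<and> (norm F)^2 = c / (2 * e) + c / 2 \<and>
          (norm (dirac_shift m w F))^2 = (e * c + ((cmod E1)^2 + (cmod E2)^2)) / 2"
        using T(1) by blast
    qed simp
  qed
qed

text \<open>An approximate eigenfunction for the nearest boundary point of the strip, at distance
  \<open>\<bar>Im z\<bar> - 1\<close>, is used as a test vector.\<close>

lemma resolvent_lower_bound:
  assumes m: "m \<ge> 0" and z: "\<bar>Im z\<bar> \<ge> 1" "m = 0 \<or> \<bar>Re z\<bar> > m" and res: "z \<in> resolvent_set H1 (dirac m)"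
  shows "1 \<le> onorm (resolvent H1 (dirac m) z) * (\<bar>Im z\<bar> - 1)"
proof -
  let ?K = "onorm (resolvent H1 (dirac m) z)"
  define w where "w = Complex (Re z) (sgn (Im z))"
  have K: "?K \<ge> 0"
    using res by (intro onorm_pos_le) (simp add: resolvent_set_def)
  have w: "\<bar>Im w\<bar> = 1" "m = 0 \<or> \<bar>Re w\<bar> > m"
    using z by (auto simp: w_def sgn_real_def)
  have wz: "cmod (w - z) = \<bar>Im z\<bar> - 1"
  proof -
    have "w - z = \<i> * of_real (sgn (Im z) - Im z)"
      by (simp add: w_def complex_eq_iff)
    then have "cmod (w - z) = \<bar>sgn (Im z) - Im z\<bar>"
      by (simp only: norm_mult norm_ii norm_of_real mult_1_left)
    then show ?thesis using z by (auto simp: sgn_real_def)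
  qed
  have step: "1 \<le> ?K * (\<bar>Im z\<bar> - 1) + ?K * \<eta>" if \<eta>: "\<eta> > 0" for \<eta>
  proof -
    obtain F where F: "F \<in> H1" "norm F > 0" "norm (dirac_shift m w F) \<le> \<eta> * norm F"
      by (rule approximate_eigenfunction[OF m w \<eta>])
    have "norm (dirac_shift m z F) \<le> norm (dirac_shift m w F) + norm (scaleC (w - z) F)"
      unfolding dirac_shift_change[of m z F w] by (rule norm_triangle_ineq)
    also have "\<dots> \<le> (\<eta> + (\<bar>Im z\<bar> - 1)) * norm F"
      using F(3) by (simp add: norm_scaleC wz distrib_right)
    finally have "?K * norm (dirac_shift m z F) \<le> ?K * ((\<eta> + (\<bar>Im z\<bar> - 1)) * norm F)"
      by (rule mult_left_mono[OF _ K])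
    with resolvent_bound[OF res F(1)] have "1 * norm F \<le> (?K * (\<eta> + (\<bar>Im z\<bar> - 1))) * norm F"
      by (simp add: mult.assoc)
    then have "1 \<le> ?K * (\<eta> + (\<bar>Im z\<bar> - 1))"
      using F(2) by (simp only: mult_le_cancel_right_pos)
    then show ?thesis by (simp add: algebra_simps)
  qed
  show ?thesis
  proof (rule field_le_epsilon)
    fix e :: real assume e: "0 < e"
    have "?K * (e / (?K + 1)) \<le> e"
      using K e by (simp add: field_simps)
    with step[of "e / (?K + 1)"] K e show "1 \<le> ?K * (\<bar>Im z\<bar> - 1) + e"
      by (simp add: add_nonneg_pos)
  qed
qed

lemma boundary_in_spectrum:
  assumes "m \<ge> 0" "\<bar>Im z\<bar> = 1" "m = 0 \<or> \<bar>Re z\<bar> > m"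
  shows "z \<notin> resolvent_set H1 (dirac m)"
  using resolvent_lower_bound[of m z] assms by auto

lemma resolvent_norm_outside_strip:
  assumes "m \<ge> 0" "\<bar>Im z\<bar> > 1" "m = 0 \<or> \<bar>Re z\<bar> > m"
  shows "z \<in> resolvent_set H1 (dirac m)" "onorm (resolvent H1 (dirac m) z) = 1 / (\<bar>Im z\<bar> - 1)"
proof -
  have "m > 0 \<longrightarrow> \<bar>Re z\<bar> > m" using assms by auto
  note up = resolvent_outside_strip[OF assms(1,2) this]
  show "z \<in> resolvent_set H1 (dirac m)" by (rule up)
  have "1 \<le> onorm (resolvent H1 (dirac m) z) * (\<bar>Im z\<bar> - 1)"
    using assms by (intro resolvent_lower_bound up) auto
  then have "1 / (\<bar>Im z\<bar> - 1) \<le> onorm (resolvent H1 (dirac m) z)"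
    using assms(2) by (simp add: field_simps)
  with up(2) show "onorm (resolvent H1 (dirac m) z) = 1 / (\<bar>Im z\<bar> - 1)" by simp
qed

text \<open>For \<open>m = 0\<close> both decaying modes have the direction \<open>(1, - \<i>)\<close>.\<close>

lemma massless_eigenvalue:
  assumes z: "\<bar>Im z\<bar> < 1"
  shows "z \<notin> resolvent_set H1 (dirac 0)"
proof
  assume res: "z \<in> resolvent_set H1 (dirac 0)"
  define \<alpha> where "\<alpha> = \<i> * (z - \<i>)"
  define \<beta> where "\<beta> = - \<i> * (z + \<i>)"
  have Re: "Re \<alpha> > 0" "Re \<beta> > 0" using z by (auto simp: \<alpha>_def \<beta>_def)
  define F where "F = spinor_of (two_sided \<alpha> \<beta> 1 1) (two_sided \<alpha> \<beta> (- \<i> * 1) (- \<i> * 1))"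
  note T = dirac_shift_two_sided[OF Re, where s = 1, folded F_def]
  have "dirac_shift 0 z F = spinor_of (two_sided \<alpha> \<beta> 0 0) (two_sided \<alpha> \<beta> 0 0)"
  proof -
    have "complex_of_real 0 - (z - \<i>) - \<i> * 1 * \<alpha> = 0" "complex_of_real 0 - (z + \<i>) + \<i> * 1 * \<beta> = 0"
      "- \<alpha> + \<i> * 1 * (complex_of_real 0 + (z - \<i>)) = 0" "\<beta> + \<i> * 1 * (complex_of_real 0 + (z + \<i>)) = 0"
      by (simp_all add: \<alpha>_def \<beta>_def algebra_simps)
    then show ?thesis unfolding T(2) by (simp only:)
  qed
  then have "(norm (dirac_shift 0 z F))^2 = 0"
    by (simp add: norm_two_sided[OF Re])
  then have "norm F \<le> 0"
    using resolvent_bound[OF res T(1)] by simp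
  moreover have "(norm F)^2 > 0"
    unfolding F_def norm_two_sided[OF Re] using Re by (simp add: add_pos_pos)
  ultimately show False by simp
qed

section \<open>The pseudospectra\<close>

lemma massless_spectrum: "z \<in> resolvent_set H1 (dirac 0) \<longleftrightarrow> \<bar>Im z\<bar> > 1"
  using massless_eigenvalue[of z] boundary_in_spectrum[of 0 z] resolvent_norm_outside_strip(1)[of 0 z]
  by (cases "\<bar>Im z\<bar>" "1 :: real" rule: linorder_cases) auto

lemma reciprocal_less_iff:
  fixes d \<epsilon> :: real
  assumes "d > 0" "\<epsilon> > 0"
  shows "1 / \<epsilon> < 1 / d \<longleftrightarrow> d < \<epsilon>" "1 / \<epsilon> \<le> 1 / d \<longleftrightarrow> d \<le> \<epsilon>"
  using assms by (auto simp: field_simps)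

lemma massless_pseudospectrum:
  assumes \<epsilon>: "\<epsilon> > 0"
  shows "closed_pseudospectrum H1 (dirac 0) \<epsilon> = {z. \<bar>Im z\<bar> \<le> 1 + \<epsilon>}"
    and "pseudospectrum H1 (dirac 0) \<epsilon> = {z. \<bar>Im z\<bar> < 1 + \<epsilon>}"
proof -
  have "z \<in> closed_pseudospectrum H1 (dirac 0) \<epsilon> \<longleftrightarrow> \<bar>Im z\<bar> \<le> 1 + \<epsilon>"
    "z \<in> pseudospectrum H1 (dirac 0) \<epsilon> \<longleftrightarrow> \<bar>Im z\<bar> < 1 + \<epsilon>" for z
  proof -
    show "z \<in> closed_pseudospectrum H1 (dirac 0) \<epsilon> \<longleftrightarrow> \<bar>Im z\<bar> \<le> 1 + \<epsilon>"
    proof (cases "\<bar>Im z\<bar> > 1")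
      case True
      then show ?thesis
        using resolvent_norm_outside_strip(2)[of 0 z] reciprocal_less_iff(2)[of "\<bar>Im z\<bar> - 1" \<epsilon>] \<epsilon>
        by (auto simp: closed_pseudospectrum_def spectrum_def massless_spectrum)
    qed (use \<epsilon> in \<open>auto simp: closed_pseudospectrum_def spectrum_def massless_spectrum\<close>)
    show "z \<in> pseudospectrum H1 (dirac 0) \<epsilon> \<longleftrightarrow> \<bar>Im z\<bar> < 1 + \<epsilon>"
    proof (cases "\<bar>Im z\<bar> > 1")
      case True
      then show ?thesis
        using resolvent_norm_outside_strip(2)[of 0 z] reciprocal_less_iff(1)[of "\<bar>Im z\<bar> - 1" \<epsilon>] \<epsilon>
        by (auto simp: pseudospectrum_def spectrum_def massless_spectrum)
    qed (use \<epsilon> in \<open>auto simp: pseudospectrum_def spectrum_def massless_spectrum\<close>)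
  qed
  then show "closed_pseudospectrum H1 (dirac 0) \<epsilon> = {z. \<bar>Im z\<bar> \<le> 1 + \<epsilon>}"
    "pseudospectrum H1 (dirac 0) \<epsilon> = {z. \<bar>Im z\<bar> < 1 + \<epsilon>}" by blast+
qed

lemma massless_trivial: "trivial_pseudospectrum H1 (dirac 0)"
  unfolding trivial_pseudospectrum_def
proof (intro exI[of _ 1] conjI allI impI subsetI)
  fix \<epsilon> :: real and z assume \<epsilon>: "0 < \<epsilon>" and "z \<in> pseudospectrum H1 (dirac 0) \<epsilon>"
  then have z: "\<bar>Im z\<bar> < 1 + \<epsilon>" by (simp add: massless_pseudospectrum)
  \<comment> \<open>The nearest point of the strip.\<close>
  define w where "w = Complex (Re z) (max (- 1) (min 1 (Im z)))"
  have w: "w \<in> spectrum H1 (dirac 0)"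
    by (auto simp: spectrum_def massless_spectrum w_def)
  have "z - w = \<i> * of_real (Im z - Im w)"
    by (simp add: w_def complex_eq_iff)
  then have "dist z w = \<bar>Im z - Im w\<bar>"
    by (simp only: dist_norm norm_mult norm_ii norm_of_real mult_1_left)
  also have "\<dots> \<le> 1 * \<epsilon>"
    using z \<epsilon> by (auto simp: w_def max_def min_def)
  finally have "infdist z (spectrum H1 (dirac 0)) \<le> 1 * \<epsilon>"
    using infdist_le[OF w, of z] by linarith
  with w show "z \<in> {z. spectrum H1 (dirac 0) \<noteq> {} \<and> infdist z (spectrum H1 (dirac 0)) \<le> 1 * \<epsilon>}"
    by blast
qed simp

text \<open>At a large real point \<open>\<tau>\<close> the resolvent norm exceeds \<open>\<tau>^2 / (2 m)\<close>, so \<open>\<tau>\<close> belongs to the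
  pseudospectrum for \<open>\<epsilon> = 2 m / \<tau>^2\<close>, although its distance to the spectrum is at least \<open>1\<close>.\<close>

lemma massive_nontrivial:
  assumes m: "m > 0"
  shows "\<not> trivial_pseudospectrum H1 (dirac m)"
proof
  assume "trivial_pseudospectrum H1 (dirac m)"
  then obtain C where C: "C \<ge> 1" and sub: "\<And>\<epsilon> z. \<epsilon> > 0 \<Longrightarrow> z \<in> pseudospectrum H1 (dirac m) \<epsilon> \<Longrightarrow>
      spectrum H1 (dirac m) \<noteq> {} \<and> infdist z (spectrum H1 (dirac m)) \<le> C * \<epsilon>"
    unfolding trivial_pseudospectrum_def by blast
  obtain M where M: "M \<ge> m" "\<And>z. M < \<bar>Re z\<bar> \<Longrightarrow> \<bar>Im z\<bar> < 1 \<Longrightarrow> resolvent_norm_near m (1 / 2) z"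
    by (rule strip_resolvent_asymptotics[OF m, of "1 / 2"]) auto
  define \<tau> where "\<tau> = M + 2 + 2 * m * C"
  define \<epsilon> where "\<epsilon> = 2 * m / \<tau>^2"
  have mC: "2 * m * C > 0" using m C by simp
  have \<tau>: "\<tau> > M + 1" "\<tau> > 1" "\<tau> > 2 * m * C" using M(1) m mC unfolding \<tau>_def by linarith+
  have \<epsilon>: "\<epsilon> > 0" using m \<tau> by (simp add: \<epsilon>_def)
  have "of_real \<tau> \<in> pseudospectrum H1 (dirac m) \<epsilon>"
    using M(2)[of "of_real \<tau>"] \<tau> by (simp add: pseudospectrum_def \<epsilon>_def resolvent_norm_near_def strip_scale_def)
  from sub[OF \<epsilon> this] have ne: "spectrum H1 (dirac m) \<noteq> {}"
    and dist: "infdist (of_real \<tau>) (spectrum H1 (dirac m)) \<le> C * \<epsilon>" by auto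
  have "1 \<le> dist (of_real \<tau>) w" if w: "w \<in> spectrum H1 (dirac m)" for w
  proof (rule ccontr)
    assume "\<not> 1 \<le> dist (complex_of_real \<tau>) w"
    then have "cmod (w - of_real \<tau>) < 1" by (simp add: dist_norm norm_minus_commute)
    then have "\<bar>Re w - \<tau>\<bar> < 1" "\<bar>Im w\<bar> < 1"
      using abs_Re_le_cmod[of "w - of_real \<tau>"] abs_Im_le_cmod[of "w - of_real \<tau>"] by auto
    then have "w \<in> resolvent_set H1 (dirac m)" using M(2)[of w] \<tau> by (auto simp: resolvent_norm_near_def)
    with w show False by (simp add: spectrum_def)
  qed
  then have "1 \<le> infdist (of_real \<tau>) (spectrum H1 (dirac m))"
    unfolding infdist_notempty[OF ne] by (intro cINF_greatest ne)
  with dist have "1 \<le> C * \<epsilon>" by linarith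
  then have "\<tau>^2 \<le> 2 * m * C"
    using \<tau> by (simp add: \<epsilon>_def field_simps)
  moreover have "\<tau> * 1 \<le> \<tau> * \<tau>" using \<tau> by (intro mult_left_mono) auto
  ultimately show False using \<tau> by (simp add: power2_eq_square)
qed

text \<open>Inside the strip, \<open>z \<in> \<Lambda> m c \<epsilon>\<close> means \<open>1 / \<epsilon> \<le> c * strip_scale m z\<close>. Elsewhere the second condition in
  \<^const>\<open>\<Lambda>\<close> always holds, and the exact resolvent norm decides.\<close>

lemma massive_pseudospectrum:
  assumes m: "m > 0" and \<alpha>: "0 < \<alpha>" "\<alpha> < 1"
  shows "\<exists>M>0. \<forall>\<epsilon>>0. \<forall>z. \<bar>Re z\<bar> > M \<longrightarrow>
      (z \<in> \<Lambda> m (1 - \<alpha>) \<epsilon> \<longrightarrow> z \<in> closed_pseudospectrum H1 (dirac m) \<epsilon>) \<and>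
      (z \<in> closed_pseudospectrum H1 (dirac m) \<epsilon> \<longrightarrow> z \<in> \<Lambda> m (1 + \<alpha>) \<epsilon>) \<and>
      (z \<in> \<Lambda> m (1 - \<alpha>) \<epsilon> \<and> \<bar>Im z\<bar> < 1 + \<epsilon> \<longrightarrow> z \<in> pseudospectrum H1 (dirac m) \<epsilon>)"
    (is "\<exists>M>0. \<forall>\<epsilon>>0. \<forall>z. \<bar>Re z\<bar> > M \<longrightarrow> ?P \<epsilon> z")
proof -
  obtain M where M: "M \<ge> m" "\<And>z. M < \<bar>Re z\<bar> \<Longrightarrow> \<bar>Im z\<bar> < 1 \<Longrightarrow> resolvent_norm_near m \<alpha> z"
    by (rule strip_resolvent_asymptotics[OF m \<alpha>]) (rule that, assumption+)
  show ?thesis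
  proof (intro exI[of _ M] conjI)
    show "M > 0" using M(1) m by simp
    show "\<forall>\<epsilon>>0. \<forall>z. \<bar>Re z\<bar> > M \<longrightarrow> ?P \<epsilon> z"
    proof (intro allI impI)
      fix \<epsilon> :: real and z :: complex assume \<epsilon>: "\<epsilon> > 0" and z: "\<bar>Re z\<bar> > M"
      have zm: "\<bar>Re z\<bar> > m" using z M(1) by simp
      consider "\<bar>Im z\<bar> > 1" | "\<bar>Im z\<bar> = 1" | "\<bar>Im z\<bar> < 1" by linarith
      then show "?P \<epsilon> z"
      proof cases
        case 1
        have res: "z \<in> resolvent_set H1 (dirac m)" "onorm (resolvent H1 (dirac m) z) = 1 / (\<bar>Im z\<bar> - 1)"
          using resolvent_norm_outside_strip[of m z] 1 m zm by auto
        have "1 \<le> \<bar>Im z\<bar>^2" using 1 by (intro one_le_power) simp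
        then have "m * (1 - \<bar>Im z\<bar>^2) / ((1 + \<alpha>) * \<epsilon>) \<le> 0"
          using m \<alpha> \<epsilon> by (intro divide_nonpos_pos mult_nonneg_nonpos) auto
        then have "m * (1 - \<bar>Im z\<bar>^2) / ((1 + \<alpha>) * \<epsilon>) \<le> \<bar>Re z\<bar>^2"
          by (rule order_trans) simp
        moreover have "1 / \<epsilon> < 1 / (\<bar>Im z\<bar> - 1) \<longleftrightarrow> \<bar>Im z\<bar> - 1 < \<epsilon>" "1 / \<epsilon> \<le> 1 / (\<bar>Im z\<bar> - 1) \<longleftrightarrow> \<bar>Im z\<bar> - 1 \<le> \<epsilon>"
          using 1 \<epsilon> by (intro reciprocal_less_iff; simp)+
        ultimately show ?thesis
          using res by (auto simp: closed_pseudospectrum_def pseudospectrum_def spectrum_def \<Lambda>_def)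
      next
        case 2
        then have "z \<notin> resolvent_set H1 (dirac m)"
          using boundary_in_spectrum[of m z] m zm by auto
        moreover have "(Im z)^2 = 1" using 2 by (simp add: abs_square_eq_1)
        ultimately show ?thesis
          using 2 \<epsilon> by (auto simp: closed_pseudospectrum_def pseudospectrum_def spectrum_def \<Lambda>_def)
      next
        case 3
        define T where "T = strip_scale m z"
        have "(Im z)^2 < 1" using 3 by (simp add: abs_square_less_1)
        then have pos: "m * (1 - (Im z)^2) > 0" using m by simp
        have \<Lambda>: "z \<in> \<Lambda> m c \<epsilon> \<longleftrightarrow> 1 / \<epsilon> \<le> c * T" if "c > 0" for c
        proof -
          have "z \<in> \<Lambda> m c \<epsilon> \<longleftrightarrow> m * (1 - (Im z)^2) / (c * \<epsilon>) \<le> (Re z)^2"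
            using 3 \<epsilon> by (auto simp: \<Lambda>_def)
          also have "\<dots> \<longleftrightarrow> m * (1 - (Im z)^2) \<le> (Re z)^2 * (c * \<epsilon>)"
            using that \<epsilon> by (intro pos_divide_le_eq) simp
          also have "\<dots> \<longleftrightarrow> 1 / \<epsilon> \<le> c * T"
            using pos \<epsilon> by (simp add: T_def strip_scale_def divide_le_eq le_divide_eq mult_ac)
          finally show ?thesis .
        qed
        show ?thesis
          using M(2)[OF z 3, unfolded resolvent_norm_near_def, folded T_def] \<Lambda>[of "1 - \<alpha>"] \<Lambda>[of "1 + \<alpha>"] \<alpha>
          by (auto simp: closed_pseudospectrum_def pseudospectrum_def spectrum_def)
      qed
    qed
  qed
qed

theorem corollary2p2:
  fixes m :: real
  assumes "m \<ge> 0"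
  shows "(m = 0 \<longrightarrow>
      trivial_pseudospectrum H1 (dirac m) \<and>
      (\<forall>\<epsilon>>0.
        closed_pseudospectrum H1 (dirac m) \<epsilon> = {z. \<bar>Im z\<bar> \<le> 1 + \<epsilon>} \<and>
        pseudospectrum H1 (dirac m) \<epsilon> = {z. \<bar>Im z\<bar> < 1 + \<epsilon>})) \<and>
    (m > 0 \<longrightarrow>
      \<not> trivial_pseudospectrum H1 (dirac m) \<and>
      (\<forall>\<alpha>\<in>{0<..<1}. \<exists>M>0. \<forall>\<epsilon>>0.
        \<Lambda> m (1 - \<alpha>) \<epsilon> \<inter> {z. \<bar>Re z\<bar> > M} \<subseteq>
          closed_pseudospectrum H1 (dirac m) \<epsilon> \<inter> {z. \<bar>Re z\<bar> > M} \<and>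
        closed_pseudospectrum H1 (dirac m) \<epsilon> \<inter> {z. \<bar>Re z\<bar> > M} \<subseteq>
          \<Lambda> m (1 + \<alpha>) \<epsilon> \<inter> {z. \<bar>Re z\<bar> > M} \<and>
        \<Lambda> m (1 - \<alpha>) \<epsilon> \<inter> {z. \<bar>Im z\<bar> < 1 + \<epsilon>} \<inter> {z. \<bar>Re z\<bar> > M} \<subseteq>
          pseudospectrum H1 (dirac m) \<epsilon> \<inter> {z. \<bar>Re z\<bar> > M} \<and>
        pseudospectrum H1 (dirac m) \<epsilon> \<inter> {z. \<bar>Re z\<bar> > M} \<subseteq>
          \<Lambda> m (1 + \<alpha>) \<epsilon> \<inter> {z. \<bar>Re z\<bar> > M}))"
proof (intro conjI impI ballI, goal_cases)
  case 1
  then show ?case by (simp add: massless_trivial)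
next
  case 2
  then show ?case by (simp add: massless_pseudospectrum)
next
  case 3
  then show ?case by (rule massive_nontrivial)
next
  case (4 \<alpha>)
  have "pseudospectrum H1 (dirac m) \<epsilon> \<subseteq> closed_pseudospectrum H1 (dirac m) \<epsilon>" for \<epsilon>
    by (auto simp: pseudospectrum_def closed_pseudospectrum_def)
  moreover have "m > 0" "0 < \<alpha>" "\<alpha> < 1" using 4 by auto
  ultimately show ?case
    using massive_pseudospectrum[of m \<alpha>] by fast
qed

end
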